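(* Let $(A,\mathfrak m,k)$ be a Noetherian local ring, and let $(B,\mathfrak n,l)$ be a Noetherian local ring that is a flat $A$-algebra with $\mathfrak n=\mathfrak m B$. Let $A_\natural$ be an ultrapower of $A$. Then any $A$-algebra map $B\to A_\natural$, if one exists, is faithfully flat.
   Context: An ultrapower of $A$ is a ring of the form $A_\natural=A^X/\mathcal U$, where $X$ is a set, $\mathcal U$ is an ultrafilter on $X$, and two elements of $A^X$ are identified when they agree on a set belonging to $\mathcal U$. It is an $A$-algebra via the diagonal map $A\to A^X\to A_\natural$. *)

theory Defs
  imports "HOL-Algebra.Algebra"
begin

section \<open>Local rings\<close>

definition local_ring :: "('a, 'c) ring_scheme \<Rightarrow> 'a set \<Rightarrow> bool" where
  "local_ring R m \<longleftrightarrow> cring R \<and> maximalideal m R \<and> (\<forall>J. maximalideal J R \<longrightarrow> J = m)"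


section \<open>Tensor products of modules\<close>

definition lin_maps ::
    "('r, 'c) ring_scheme \<Rightarrow> ('r, 'm, 'd) module_scheme \<Rightarrow> ('r, 'n, 'e) module_scheme \<Rightarrow> ('m \<Rightarrow> 'n) set"
  where "lin_maps R M N =
    {f \<in> hom (add_monoid M) (add_monoid N).
       \<forall>r\<in>carrier R. \<forall>x\<in>carrier M. f (r \<odot>\<^bsub>M\<^esub> x) = r \<odot>\<^bsub>N\<^esub> f x}"

text \<open>
  The tensor product is the free abelian group on pairs modulo the bilinearity relations. Only its
  underlying abelian group is constructed, since exactness of a sequence of modules depends on
  nothing else.
\<close>

definition bilinear_relators ::
    "('r, 'c) ring_scheme \<Rightarrow> ('r, 'm, 'd) module_scheme \<Rightarrow> ('r, 'n, 'e) module_scheme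
      \<Rightarrow> ('m \<times> 'n \<Rightarrow>\<^sub>0 int) set"
  where "bilinear_relators R M N =
    {frag_of (x \<oplus>\<^bsub>M\<^esub> x', y) - frag_of (x, y) - frag_of (x', y) | x x' y.
       x \<in> carrier M \<and> x' \<in> carrier M \<and> y \<in> carrier N} \<union>
    {frag_of (x, y \<oplus>\<^bsub>N\<^esub> y') - frag_of (x, y) - frag_of (x, y') | x y y'.
       x \<in> carrier M \<and> y \<in> carrier N \<and> y' \<in> carrier N} \<union>
    {frag_of (r \<odot>\<^bsub>M\<^esub> x, y) - frag_of (x, r \<odot>\<^bsub>N\<^esub> y) | r x y.
       r \<in> carrier R \<and> x \<in> carrier M \<and> y \<in> carrier N}"

abbreviation free_on_pairs ::
    "('r, 'm, 'd) module_scheme \<Rightarrow> ('r, 'n, 'e) module_scheme \<Rightarrow> ('m \<times> 'n \<Rightarrow>\<^sub>0 int) monoid"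
  where "free_on_pairs M N \<equiv> free_Abelian_group (carrier M \<times> carrier N)"

definition tensor_relations ::
    "('r, 'c) ring_scheme \<Rightarrow> ('r, 'm, 'd) module_scheme \<Rightarrow> ('r, 'n, 'e) module_scheme
      \<Rightarrow> ('m \<times> 'n \<Rightarrow>\<^sub>0 int) set"
  where "tensor_relations R M N = generate (free_on_pairs M N) (bilinear_relators R M N)"

definition tensor_product ::
    "('r, 'c) ring_scheme \<Rightarrow> ('r, 'm, 'd) module_scheme \<Rightarrow> ('r, 'n, 'e) module_scheme
      \<Rightarrow> ('m \<times> 'n \<Rightarrow>\<^sub>0 int) set monoid"
  where "tensor_product R M N = free_on_pairs M N Mod tensor_relations R M N"

text \<open>
  For a linear map \<open>f\<close> from \<open>M\<close> to \<open>M'\<close>, the map from \<open>M \<otimes> N\<close> to \<open>M' \<otimes> N\<close> induced by \<open>f\<close> and the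
  identity of \<open>N\<close>. The class of \<open>frag_extend \<dots> c\<close> is the same for all \<open>c\<close> in one coset \<open>C\<close>
  (see \<open>tensor_map_coset\<close>), so \<open>the_elem\<close> picks the only member of a singleton.
\<close>

definition tensor_map ::
    "('r, 'c) ring_scheme \<Rightarrow> ('r, 'm', 'd) module_scheme \<Rightarrow> ('r, 'n, 'e) module_scheme
      \<Rightarrow> ('m \<Rightarrow> 'm') \<Rightarrow> ('m \<times> 'n \<Rightarrow>\<^sub>0 int) set \<Rightarrow> ('m' \<times> 'n \<Rightarrow>\<^sub>0 int) set"
  where "tensor_map R M' N f C =
    the_elem ((\<lambda>c. tensor_relations R M' N #>\<^bsub>free_on_pairs M' N\<^esub>
                     frag_extend (\<lambda>(x, y). frag_of (f x, y)) c) ` C)"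

lemma bilinear_relators_subset:
  assumes "module R M" "module R N"
  shows "bilinear_relators R M N \<subseteq> carrier (free_on_pairs M N)"
proof -
  interpret M: module R M by fact
  interpret N: module R N by fact
  show ?thesis
  proof
    fix k assume "k \<in> bilinear_relators R M N"
    then consider
        x x' y where "k = frag_of (x \<oplus>\<^bsub>M\<^esub> x', y) - frag_of (x, y) - frag_of (x', y)"
          "x \<in> carrier M" "x' \<in> carrier M" "y \<in> carrier N"
      | x y y' where "k = frag_of (x, y \<oplus>\<^bsub>N\<^esub> y') - frag_of (x, y) - frag_of (x, y')"
          "x \<in> carrier M" "y \<in> carrier N" "y' \<in> carrier N"
      | r x y where "k = frag_of (r \<odot>\<^bsub>M\<^esub> x, y) - frag_of (x, r \<odot>\<^bsub>N\<^esub> y)"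
          "r \<in> carrier R" "x \<in> carrier M" "y \<in> carrier N"
      unfolding bilinear_relators_def by blast
    then show "k \<in> carrier (free_on_pairs M N)"
      unfolding carrier_free_Abelian_group_iff
      by cases (auto dest!: subsetD[OF keys_diff] split: if_splits)
  qed
qed

lemma frag_extend_tensor_relations:
  assumes "module R M" "module R M'" "module R N" and f: "f \<in> lin_maps R M M'"
    and c: "c \<in> tensor_relations R M N"
  shows "frag_extend (\<lambda>(x, y). frag_of (f x, y)) c \<in> tensor_relations R M' N"
proof -
  interpret M: module R M by fact
  interpret M': module R M' by fact
  interpret N: module R N by fact
  let ?h = "frag_extend (\<lambda>(x, y). frag_of (f x, y))"
  interpret F: group "free_on_pairs M N" by simp
  interpret F': group "free_on_pairs M' N" by simp
  note inv_free = inv_free_Abelian_group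
  have sub: "bilinear_relators R M N \<subseteq> carrier (free_on_pairs M N)"
    and sub': "bilinear_relators R M' N \<subseteq> carrier (free_on_pairs M' N)"
    by (intro bilinear_relators_subset assms)+
  have fc: "f x \<in> carrier M'" if "x \<in> carrier M" for x
    using f that by (auto simp: lin_maps_def hom_def)
  have fa: "f (x \<oplus>\<^bsub>M\<^esub> x') = f x \<oplus>\<^bsub>M'\<^esub> f x'" if "x \<in> carrier M" "x' \<in> carrier M" for x x'
    using f that by (auto simp: lin_maps_def hom_def)
  have fs: "f (r \<odot>\<^bsub>M\<^esub> x) = r \<odot>\<^bsub>M'\<^esub> f x" if "r \<in> carrier R" "x \<in> carrier M" for r x
    using f that by (auto simp: lin_maps_def)
  have rel: "?h k \<in> bilinear_relators R M' N" if "k \<in> bilinear_relators R M N" for k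
  proof -
    from that consider
        x x' y where "k = frag_of (x \<oplus>\<^bsub>M\<^esub> x', y) - frag_of (x, y) - frag_of (x', y)"
          "x \<in> carrier M" "x' \<in> carrier M" "y \<in> carrier N"
      | x y y' where "k = frag_of (x, y \<oplus>\<^bsub>N\<^esub> y') - frag_of (x, y) - frag_of (x, y')"
          "x \<in> carrier M" "y \<in> carrier N" "y' \<in> carrier N"
      | r x y where "k = frag_of (r \<odot>\<^bsub>M\<^esub> x, y) - frag_of (x, r \<odot>\<^bsub>N\<^esub> y)"
          "r \<in> carrier R" "x \<in> carrier M" "y \<in> carrier N"
      unfolding bilinear_relators_def by blast
    then show ?thesis
    proof cases
      case 1
      then have "?h k = frag_of (f x \<oplus>\<^bsub>M'\<^esub> f x', y) - frag_of (f x, y) - frag_of (f x', y)"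
        by (simp add: frag_extend_diff fa)
      then show ?thesis using 1 fc unfolding bilinear_relators_def by blast
    next
      case 2
      then have "?h k = frag_of (f x, y \<oplus>\<^bsub>N\<^esub> y') - frag_of (f x, y) - frag_of (f x, y')"
        by (simp add: frag_extend_diff)
      then show ?thesis using 2 fc unfolding bilinear_relators_def by blast
    next
      case 3
      then have "?h k = frag_of (r \<odot>\<^bsub>M'\<^esub> f x, y) - frag_of (f x, r \<odot>\<^bsub>N\<^esub> y)"
        by (simp add: frag_extend_diff fs)
      then show ?thesis using 3 fc unfolding bilinear_relators_def by blast
    qed
  qed
  show ?thesis
    using c unfolding tensor_relations_def
  proof (induction rule: generate.induct)
    case one
    then show ?case using generate.one[of "free_on_pairs M' N"] by simp
  next
    case (incl k)
    then show ?case by (intro generate.incl rel)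
  next
    case (inv k)
    have "inv\<^bsub>free_on_pairs M' N\<^esub> (?h k) = - ?h k"
      using rel[OF inv] sub' by (auto simp: inv_free)
    moreover have "inv\<^bsub>free_on_pairs M N\<^esub> k = - k"
      using inv sub by (auto simp: inv_free)
    ultimately show ?case
      using generate.inv[OF rel[OF inv], of "free_on_pairs M' N"] by (simp add: frag_extend_minus)
  next
    case (eng k l)
    then show ?case
      using generate.eng[OF eng.IH] by (simp add: frag_extend_add)
  qed
qed

lemma tensor_map_coset:
  assumes "module R M" "module R M'" "module R N" and f: "f \<in> lin_maps R M M'"
    and c: "c \<in> carrier (free_on_pairs M N)"
  shows "tensor_map R M' N f (tensor_relations R M N #>\<^bsub>free_on_pairs M N\<^esub> c) =
    tensor_relations R M' N #>\<^bsub>free_on_pairs M' N\<^esub> frag_extend (\<lambda>(x, y). frag_of (f x, y)) c"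
proof -
  let ?h = "frag_extend (\<lambda>(x, y). frag_of (f x, y))"
  let ?K = "tensor_relations R M N" and ?K' = "tensor_relations R M' N"
  interpret F: group "free_on_pairs M N" by simp
  interpret F': group "free_on_pairs M' N" by simp
  have sg: "subgroup ?K (free_on_pairs M N)"
    unfolding tensor_relations_def by (intro F.generate_is_subgroup bilinear_relators_subset assms)
  have sg': "subgroup ?K' (free_on_pairs M' N)"
    unfolding tensor_relations_def by (intro F'.generate_is_subgroup bilinear_relators_subset assms)
  have fc: "f x \<in> carrier M'" if "x \<in> carrier M" for x
    using f that by (auto simp: lin_maps_def hom_def)
  have hc: "?h c \<in> carrier (free_on_pairs M' N)"
    using c keys_frag_extend[of "\<lambda>(x, y). frag_of (f x, y)" c]
    by (fastforce simp: carrier_free_Abelian_group_iff fc split: prod.splits)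
  have eq: "?K' #>\<^bsub>free_on_pairs M' N\<^esub> ?h d = ?K' #>\<^bsub>free_on_pairs M' N\<^esub> ?h c"
    if "d \<in> ?K #>\<^bsub>free_on_pairs M N\<^esub> c" for d
  proof -
    have "\<exists>k\<in>?K. d = k + c"
      using that by (simp add: r_coset_def free_Abelian_group_def)
    then obtain k where k: "k \<in> ?K" "d = k + c" by blast
    have "?h d = ?h k + ?h c" using k by (simp add: frag_extend_add)
    moreover have "?h k \<in> ?K'" using frag_extend_tensor_relations[OF assms(1-4) k(1)] .
    ultimately have "?h d \<in> ?K' #>\<^bsub>free_on_pairs M' N\<^esub> ?h c"
      by (auto simp: r_coset_def free_Abelian_group_def)
    then show ?thesis using F'.repr_independence[OF _ hc sg'] by simp
  qed
  have "c \<in> ?K #>\<^bsub>free_on_pairs M N\<^esub> c"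
    using F.rcos_self[OF c sg] .
  then have "(\<lambda>d. ?K' #>\<^bsub>free_on_pairs M' N\<^esub> ?h d) ` (?K #>\<^bsub>free_on_pairs M N\<^esub> c)
      = {?K' #>\<^bsub>free_on_pairs M' N\<^esub> ?h c}"
    using eq by blast
  then show ?thesis by (simp add: tensor_map_def)
qed


section \<open>Flatness and faithful flatness\<close>

definition exact_at ::
    "('a, 'c) monoid_scheme \<Rightarrow> ('a \<Rightarrow> 'b) \<Rightarrow> ('b, 'd) monoid_scheme \<Rightarrow> ('b \<Rightarrow> 'e) \<Rightarrow> ('e, 'g) monoid_scheme \<Rightarrow> bool"
  where "exact_at G f H g K \<longleftrightarrow> f ` carrier G = kernel H K g"

text \<open>
  HOL cannot quantify over types inside a definition, so the type \<open>'m\<close> that carries the test modules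
  is an explicit argument of both notions. Every finitely generated (even every countably
  generated) \<open>R\<close>-module with \<open>R\<close> on the type \<open>'r\<close> has an isomorphic copy on the type
  \<open>(nat \<Rightarrow> 'r) set\<close>, namely a set of cosets in a free module of finitely supported sequences; since
  flatness can be tested on finitely generated modules, that type already gives flatness
  in the unrestricted sense. As a conclusion, either notion is unrestricted when \<open>'m\<close> is left as a
  type variable.
\<close>

definition flat_module ::
    "'m itself \<Rightarrow> ('r, 'c) ring_scheme \<Rightarrow> ('r, 'n, 'd) module_scheme \<Rightarrow> bool"
  where "flat_module (_ :: 'm itself) R N \<longleftrightarrow> module R N \<and>
    (\<forall>(M1 :: ('r, 'm) module) (M2 :: ('r, 'm) module) (M3 :: ('r, 'm) module) f g.
       module R M1 \<and> module R M2 \<and> module R M3 \<and>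
       f \<in> lin_maps R M1 M2 \<and> g \<in> lin_maps R M2 M3 \<longrightarrow>
         exact_at (add_monoid M1) f (add_monoid M2) g (add_monoid M3) \<longrightarrow>
         exact_at (tensor_product R M1 N) (tensor_map R M2 N f)
                  (tensor_product R M2 N) (tensor_map R M3 N g) (tensor_product R M3 N))"

definition faithfully_flat_module ::
    "'m itself \<Rightarrow> ('r, 'c) ring_scheme \<Rightarrow> ('r, 'n, 'd) module_scheme \<Rightarrow> bool"
  where "faithfully_flat_module (_ :: 'm itself) R N \<longleftrightarrow> module R N \<and>
    (\<forall>(M1 :: ('r, 'm) module) (M2 :: ('r, 'm) module) (M3 :: ('r, 'm) module) f g.
       module R M1 \<and> module R M2 \<and> module R M3 \<and>
       f \<in> lin_maps R M1 M2 \<and> g \<in> lin_maps R M2 M3 \<longrightarrow>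
         (exact_at (add_monoid M1) f (add_monoid M2) g (add_monoid M3) \<longleftrightarrow>
          exact_at (tensor_product R M1 N) (tensor_map R M2 N f)
                   (tensor_product R M2 N) (tensor_map R M3 N g) (tensor_product R M3 N)))"

definition module_via :: "('r \<Rightarrow> 's) \<Rightarrow> ('s, 'c) ring_scheme \<Rightarrow> ('r, 's) module" where
  "module_via \<phi> S =
    \<lparr>carrier = carrier S, monoid.mult = monoid.mult S, one = one S, ring.zero = ring.zero S, add = add S,
     smult = (\<lambda>r s. \<phi> r \<otimes>\<^bsub>S\<^esub> s)\<rparr>"

definition flat_ring_map ::
    "'m itself \<Rightarrow> ('r, 'c) ring_scheme \<Rightarrow> ('s, 'd) ring_scheme \<Rightarrow> ('r \<Rightarrow> 's) \<Rightarrow> bool"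
  where "flat_ring_map T R S \<phi> \<longleftrightarrow> \<phi> \<in> ring_hom R S \<and> flat_module T R (module_via \<phi> S)"

definition faithfully_flat_ring_map ::
    "'m itself \<Rightarrow> ('r, 'c) ring_scheme \<Rightarrow> ('s, 'd) ring_scheme \<Rightarrow> ('r \<Rightarrow> 's) \<Rightarrow> bool"
  where "faithfully_flat_ring_map T R S \<phi> \<longleftrightarrow>
    \<phi> \<in> ring_hom R S \<and> faithfully_flat_module T R (module_via \<phi> S)"


section \<open>Ultrapowers\<close>

definition ultrafilter_on :: "'x set \<Rightarrow> 'x set set \<Rightarrow> bool" where
  "ultrafilter_on I U \<longleftrightarrow>
     U \<subseteq> Pow I \<and> I \<in> U \<and> {} \<notin> U \<and>
     (\<forall>S\<in>U. \<forall>T\<in>U. S \<inter> T \<in> U) \<and>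
     (\<forall>S\<in>U. \<forall>T. S \<subseteq> T \<and> T \<subseteq> I \<longrightarrow> T \<in> U) \<and>
     (\<forall>S. S \<subseteq> I \<longrightarrow> S \<in> U \<or> I - S \<in> U)"

definition power_ring :: "('a, 'c) ring_scheme \<Rightarrow> 'x set \<Rightarrow> ('x \<Rightarrow> 'a) ring" where
  "power_ring A I =
    \<lparr>carrier = I \<rightarrow>\<^sub>E carrier A,
     monoid.mult = (\<lambda>f g. \<lambda>x\<in>I. f x \<otimes>\<^bsub>A\<^esub> g x),
     monoid.one = (\<lambda>x\<in>I. \<one>\<^bsub>A\<^esub>),
     ring.zero = (\<lambda>x\<in>I. \<zero>\<^bsub>A\<^esub>),
     ring.add = (\<lambda>f g. \<lambda>x\<in>I. f x \<oplus>\<^bsub>A\<^esub> g x)\<rparr>"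

definition null_ideal :: "('a, 'c) ring_scheme \<Rightarrow> 'x set \<Rightarrow> 'x set set \<Rightarrow> ('x \<Rightarrow> 'a) set" where
  "null_ideal A I U = {f \<in> carrier (power_ring A I). {x \<in> I. f x = \<zero>\<^bsub>A\<^esub>} \<in> U}"

text \<open>
  Two elements of the power have the same class if and only if they agree on a member of \<open>U\<close>; see
  \<open>ultrapower_class_eq_iff\<close>.
\<close>

definition ultrapower :: "('a, 'c) ring_scheme \<Rightarrow> 'x set \<Rightarrow> 'x set set \<Rightarrow> ('x \<Rightarrow> 'a) set ring" where
  "ultrapower A I U = power_ring A I Quot null_ideal A I U"

definition ultrapower_diagonal ::
    "('a, 'c) ring_scheme \<Rightarrow> 'x set \<Rightarrow> 'x set set \<Rightarrow> 'a \<Rightarrow> ('x \<Rightarrow> 'a) set"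
  where "ultrapower_diagonal A I U a = null_ideal A I U +>\<^bsub>power_ring A I\<^esub> (\<lambda>x\<in>I. a)"

lemma power_ring_cring:
  assumes "cring A"
  shows "cring (power_ring A I)"
proof -
  interpret A: cring A by fact
  have val: "f x \<in> carrier A" if "f \<in> I \<rightarrow>\<^sub>E carrier A" "x \<in> I" for f x
    using that by auto
  show ?thesis
  proof (intro cringI abelian_groupI comm_monoidI, goal_cases)
    case (6 f)
    then show ?case
      by (intro bexI[where x = "\<lambda>x\<in>I. \<ominus>\<^bsub>A\<^esub> f x"])
        (auto simp: power_ring_def intro!: restrict_ext A.l_neg)
  next
    case (3 f g h)
    then show ?case by (auto simp: power_ring_def intro!: restrict_ext A.a_assoc)
  next
    case (4 f g)
    then show ?case by (auto simp: power_ring_def fun_eq_iff restrict_def A.a_comm val)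
  next
    case (5 f)
    then show ?case by (auto simp: power_ring_def fun_eq_iff val PiE_arb[of f I "\<lambda>_. carrier A"])
  next
    case (9 f g h)
    then show ?case by (auto simp: power_ring_def intro!: restrict_ext A.m_assoc)
  next
    case (10 f)
    then show ?case by (auto simp: power_ring_def fun_eq_iff val PiE_arb[of f I "\<lambda>_. carrier A"])
  next
    case (11 f g)
    then show ?case by (auto simp: power_ring_def fun_eq_iff restrict_def A.m_comm val)
  next
    case (12 f g h)
    then show ?case by (auto simp: power_ring_def intro!: restrict_ext A.l_distr)
  qed (auto simp: power_ring_def)
qed

lemma null_ideal_ideal:
  assumes "cring A" "ultrafilter_on I U"
  shows "ideal (null_ideal A I U) (power_ring A I)"
proof -
  interpret A: cring A by fact
  interpret P: cring "power_ring A I" by (rule power_ring_cring) fact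
  have carr: "I \<in> U" and inter: "\<And>S T. S \<in> U \<Longrightarrow> T \<in> U \<Longrightarrow> S \<inter> T \<in> U"
    and up: "\<And>S T. S \<in> U \<Longrightarrow> S \<subseteq> T \<Longrightarrow> T \<subseteq> I \<Longrightarrow> T \<in> U"
    using assms(2) unfolding ultrafilter_on_def by blast+
  have val: "f x \<in> carrier A" if "f \<in> carrier (power_ring A I)" "x \<in> I" for f x
    using that by (auto simp: power_ring_def)
  have addv: "(f \<oplus>\<^bsub>power_ring A I\<^esub> g) x = f x \<oplus>\<^bsub>A\<^esub> g x"
    and multv: "(f \<otimes>\<^bsub>power_ring A I\<^esub> g) x = f x \<otimes>\<^bsub>A\<^esub> g x"
    and zerov: "\<zero>\<^bsub>power_ring A I\<^esub> x = \<zero>\<^bsub>A\<^esub>" if "x \<in> I" for f g x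
    using that by (auto simp: power_ring_def)
  have "subgroup (null_ideal A I U) (add_monoid (power_ring A I))"
  proof (rule P.add.subgroupI)
    show "null_ideal A I U \<subseteq> carrier (power_ring A I)" by (auto simp: null_ideal_def)
    have "{x \<in> I. \<zero>\<^bsub>power_ring A I\<^esub> x = \<zero>\<^bsub>A\<^esub>} = I" by (auto simp: zerov)
    then have "\<zero>\<^bsub>power_ring A I\<^esub> \<in> null_ideal A I U"
      using carr by (simp add: null_ideal_def)
    then show "null_ideal A I U \<noteq> {}" by blast
  next
    fix f assume f: "f \<in> null_ideal A I U"
    then have fc: "f \<in> carrier (power_ring A I)" by (auto simp: null_ideal_def)
    have "(\<ominus>\<^bsub>power_ring A I\<^esub> f) x = \<zero>\<^bsub>A\<^esub>" if x: "x \<in> I" "f x = \<zero>\<^bsub>A\<^esub>" for x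
    proof -
      have "(\<ominus>\<^bsub>power_ring A I\<^esub> f \<oplus>\<^bsub>power_ring A I\<^esub> f) x = \<zero>\<^bsub>A\<^esub>"
        using fc x by (simp add: P.l_neg zerov)
      then show ?thesis using x fc val[OF P.a_inv_closed[OF fc]] by (simp add: addv)
    qed
    then have "{x \<in> I. f x = \<zero>\<^bsub>A\<^esub>} \<subseteq> {x \<in> I. (\<ominus>\<^bsub>power_ring A I\<^esub> f) x = \<zero>\<^bsub>A\<^esub>}" by blast
    from up[OF _ this] show "\<ominus>\<^bsub>power_ring A I\<^esub> f \<in> null_ideal A I U"
      using f fc by (auto simp: null_ideal_def)
  next
    fix f g assume fg: "f \<in> null_ideal A I U" "g \<in> null_ideal A I U"
    then have c: "f \<in> carrier (power_ring A I)" "g \<in> carrier (power_ring A I)"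
      by (auto simp: null_ideal_def)
    have "{x \<in> I. f x = \<zero>\<^bsub>A\<^esub>} \<inter> {x \<in> I. g x = \<zero>\<^bsub>A\<^esub>}
        \<subseteq> {x \<in> I. (f \<oplus>\<^bsub>power_ring A I\<^esub> g) x = \<zero>\<^bsub>A\<^esub>}" by (auto simp: addv)
    from up[OF inter this] have "{x \<in> I. (f \<oplus>\<^bsub>power_ring A I\<^esub> g) x = \<zero>\<^bsub>A\<^esub>} \<in> U"
      using fg by (auto simp: null_ideal_def)
    then show "f \<oplus>\<^bsub>power_ring A I\<^esub> g \<in> null_ideal A I U"
      using c by (auto simp: null_ideal_def)
  qed
  moreover have "r \<otimes>\<^bsub>power_ring A I\<^esub> f \<in> null_ideal A I U"
    if "f \<in> null_ideal A I U" "r \<in> carrier (power_ring A I)" for f r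
  proof -
    have "{x \<in> I. f x = \<zero>\<^bsub>A\<^esub>} \<subseteq> {x \<in> I. (r \<otimes>\<^bsub>power_ring A I\<^esub> f) x = \<zero>\<^bsub>A\<^esub>}"
      using that val by (auto simp: multv)
    from up[OF _ this] show ?thesis using that by (auto simp: null_ideal_def)
  qed
  ultimately show ?thesis
    by (intro idealI P.ring_axioms) (auto simp: null_ideal_def P.m_comm)
qed

lemma ultrapower_class_eq_iff:
  assumes "cring A" "ultrafilter_on I U"
    and f: "f \<in> carrier (power_ring A I)" and g: "g \<in> carrier (power_ring A I)"
  shows "null_ideal A I U +>\<^bsub>power_ring A I\<^esub> f = null_ideal A I U +>\<^bsub>power_ring A I\<^esub> g
    \<longleftrightarrow> {x \<in> I. f x = g x} \<in> U"
proof -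
  interpret A: cring A by fact
  interpret N: ideal "null_ideal A I U" "power_ring A I" by (rule null_ideal_ideal) fact+
  have val: "f x \<in> carrier A" if "f \<in> carrier (power_ring A I)" "x \<in> I" for f x
    using that by (auto simp: power_ring_def)
  have "(f \<ominus>\<^bsub>power_ring A I\<^esub> g) x = \<zero>\<^bsub>A\<^esub> \<longleftrightarrow> f x = g x" if x: "x \<in> I" for x
  proof -
    let ?d = "f \<ominus>\<^bsub>power_ring A I\<^esub> g"
    have d: "?d \<in> carrier (power_ring A I)" using f g by simp
    have "?d \<oplus>\<^bsub>power_ring A I\<^esub> g = f" using f g by (simp add: N.minus_eq N.a_assoc N.l_neg)
    moreover have "(?d \<oplus>\<^bsub>power_ring A I\<^esub> g) x = ?d x \<oplus>\<^bsub>A\<^esub> g x"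
      using x by (simp add: power_ring_def)
    ultimately have "f x = ?d x \<oplus>\<^bsub>A\<^esub> g x" by simp
    then show ?thesis using A.add.r_cancel_one[OF val[OF g x] val[OF d x]] by auto
  qed
  then have eq: "{x \<in> I. (f \<ominus>\<^bsub>power_ring A I\<^esub> g) x = \<zero>\<^bsub>A\<^esub>} = {x \<in> I. f x = g x}"
    by blast
  have "null_ideal A I U +>\<^bsub>power_ring A I\<^esub> f = null_ideal A I U +>\<^bsub>power_ring A I\<^esub> g
      \<longleftrightarrow> f \<ominus>\<^bsub>power_ring A I\<^esub> g \<in> null_ideal A I U"
    by (rule N.quotient_eq_iff_same_a_r_cos[OF N.ideal_axioms f g, symmetric])
  also have "\<dots> \<longleftrightarrow> {x \<in> I. f x = g x} \<in> U"
    unfolding null_ideal_def mem_Collect_eq eq using N.minus_closed[OF f g] by simp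
  finally show ?thesis .
qed

end

theory Submission
  imports Defs
begin

text \<open>
  Regard the ultrapower as a \<open>B\<close>-module \<open>N\<close> along \<open>\<psi>\<close>. Flatness is proved in its equational form: every
  linear relation over \<open>B\<close> among elements of \<open>N\<close> is a combination of syzygies over \<open>B\<close>, that is,
  \<open>Tor\<^sub>1(B/J, N) = 0\<close> for every ideal \<open>J\<close>.

  Suppose this fails and take an ideal \<open>J\<close> maximal among those for which it fails. For \<open>b\<close> outside \<open>J\<close>
  there is an exact sequence \<open>Tor\<^sub>1(B/(J:b), N) \<rightarrow> Tor\<^sub>1(B/J, N) \<rightarrow> Tor\<^sub>1(B/(J+b), N)\<close> with last term zero
  (\<open>relation_from_colon_ideal\<close>), so \<open>(J:b) = J\<close> for all such \<open>b\<close>. The unit ideal is not a counterexample, and neither is \<open>n\<close>: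
  since \<open>n = mB\<close>, it has generators from \<open>A\<close>, and relations whose coefficients are constant in the
  ultrapower are solved by the same syzygies over \<open>A\<close> at every index
  (\<open>closed_point_relations_trivial\<close>). Hence \<open>J\<close> does not contain \<open>n\<close>, there is an \<open>a\<close> in \<open>m\<close> whose image in \<open>B\<close>
  lies outside \<open>J\<close>, and the exact sequence says that \<open>a\<close> acts surjectively on \<open>Tor\<^sub>1(B/J, N)\<close>.

  Nakayama's lemma does not apply to this \<open>Tor\<^sub>1\<close> directly, because the ultrapower is in general not
  noetherian and \<open>Tor\<^sub>1\<close> need not be finitely generated over it. But \<open>B\<close> is noetherian, so \<open>Tor\<^sub>1(B/J, N)\<close> is the homology of a complex of finite free modules over the
  ultrapower, and therefore an ultraproduct of finitely generated \<open>A\<close>-modules. If \<open>a\<close> acts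
  surjectively on the ultraproduct, it does so on almost all factors; these vanish by Nakayama's
  lemma over \<open>A\<close>, and so does the ultraproduct (\<open>ultrapower_nakayama\<close>). This contradicts the
  choice of \<open>J\<close> (\<open>relations_trivial_from_closed_point\<close>).

  For faithfulness, \<open>nN\<close> is not all of \<open>N\<close>: otherwise \<open>1\<close> would be a combination of elements of \<open>m\<close> at
  almost every index (\<open>one_has_unit_coefficient\<close>). The passage from relations to tensor products is
  the criterion that, for flat \<open>N\<close>, a tensor \<open>\<Sum> x\<^sub>i \<otimes> y\<^sub>i\<close> vanishes if and only if the \<open>y\<^sub>i\<close> are combinations of elements \<open>w\<^sub>j\<close> of \<open>N\<close>
  whose coefficients combine the \<open>x\<^sub>i\<close> to zero for each \<open>j\<close> (\<open>tensor_vanishing_criterion\<close>,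
  \<open>tensor_change_coordinates\<close>).
\<close>

section \<open>Finite sums\<close>

lemma (in abelian_monoid) finsum_lessThan_Suc:
  assumes "\<And>i. i \<le> k \<Longrightarrow> f i \<in> carrier G"
  shows "(\<Oplus>i\<in>{..<Suc k}. f i) = (\<Oplus>i\<in>{..<k}. f i) \<oplus> f k"
  using assms by (simp add: lessThan_Suc finsum_insert a_comm finsum_closed Pi_def)

lemma (in abelian_monoid) finsum_swap:
  assumes "finite S" "finite T" "\<And>i j. i \<in> S \<Longrightarrow> j \<in> T \<Longrightarrow> f i j \<in> carrier G"
  shows "(\<Oplus>i\<in>S. \<Oplus>j\<in>T. f i j) = (\<Oplus>j\<in>T. \<Oplus>i\<in>S. f i j)"
  using assms(1,3)
proof (induction S)
  case empty
  then show ?case by (simp add: finsum_zero)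
next
  case (insert x S)
  then have "(\<Oplus>j\<in>T. \<Oplus>i\<in>insert x S. f i j) = (\<Oplus>j\<in>T. f x j \<oplus> (\<Oplus>i\<in>S. f i j))"
    by (intro finsum_cong') (auto simp: finsum_insert intro!: finsum_closed)
  also have "\<dots> = (\<Oplus>j\<in>T. f x j) \<oplus> (\<Oplus>j\<in>T. \<Oplus>i\<in>S. f i j)"
    using insert by (intro finsum_addf) (auto intro!: finsum_closed)
  finally show ?case
    using insert by (simp add: finsum_insert Pi_def finsum_closed)
qed

lemma (in module) finsum_smult_rdistr:
  assumes "finite S" "x \<in> carrier M" "\<And>i. i \<in> S \<Longrightarrow> f i \<in> carrier R"
  shows "(\<Oplus>i\<in>S. f i) \<odot>\<^bsub>M\<^esub> x = (\<Oplus>\<^bsub>M\<^esub>i\<in>S. f i \<odot>\<^bsub>M\<^esub> x)"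
  using assms(1,3)
  by (induction S) (auto simp: finsum_insert M.finsum_insert smult_l_distr assms(2) Pi_def)

lemma (in module) finsum_smult_swap:
  assumes "finite S" "finite T" "\<And>i. i \<in> S \<Longrightarrow> c i \<in> carrier R"
    "\<And>i j. i \<in> S \<Longrightarrow> j \<in> T \<Longrightarrow> f i j \<in> carrier R" "\<And>j. j \<in> T \<Longrightarrow> y j \<in> carrier M"
  shows "(\<Oplus>\<^bsub>M\<^esub>i\<in>S. c i \<odot>\<^bsub>M\<^esub> (\<Oplus>\<^bsub>M\<^esub>j\<in>T. f i j \<odot>\<^bsub>M\<^esub> y j))
    = (\<Oplus>\<^bsub>M\<^esub>j\<in>T. (\<Oplus>i\<in>S. c i \<otimes> f i j) \<odot>\<^bsub>M\<^esub> y j)"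
proof -
  have "(\<Oplus>\<^bsub>M\<^esub>i\<in>S. c i \<odot>\<^bsub>M\<^esub> (\<Oplus>\<^bsub>M\<^esub>j\<in>T. f i j \<odot>\<^bsub>M\<^esub> y j))
      = (\<Oplus>\<^bsub>M\<^esub>i\<in>S. \<Oplus>\<^bsub>M\<^esub>j\<in>T. (c i \<otimes> f i j) \<odot>\<^bsub>M\<^esub> y j)"
    using assms
    by (intro M.finsum_cong') (auto simp: finsum_smult_ldistr smult_assoc1 Pi_def
        intro!: M.finsum_closed M.finsum_cong')
  also have "\<dots> = (\<Oplus>\<^bsub>M\<^esub>j\<in>T. \<Oplus>\<^bsub>M\<^esub>i\<in>S. (c i \<otimes> f i j) \<odot>\<^bsub>M\<^esub> y j)"
    using assms by (intro M.finsum_swap) auto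
  also have "\<dots> = (\<Oplus>\<^bsub>M\<^esub>j\<in>T. (\<Oplus>i\<in>S. c i \<otimes> f i j) \<odot>\<^bsub>M\<^esub> y j)"
    using assms by (intro M.finsum_cong') (auto simp: finsum_smult_rdistr intro!: M.finsum_closed)
  finally show ?thesis .
qed

lemma (in module) finsum_smult_add_smult:
  assumes "finite S" "\<And>k. k \<in> S \<Longrightarrow> f k \<in> carrier R" "\<And>k. k \<in> S \<Longrightarrow> v k \<in> carrier M"
    "\<And>k. k \<in> S \<Longrightarrow> e k \<in> carrier R" "z \<in> carrier M"
  shows "(\<Oplus>\<^bsub>M\<^esub>k\<in>S. f k \<odot>\<^bsub>M\<^esub> (v k \<oplus>\<^bsub>M\<^esub> e k \<odot>\<^bsub>M\<^esub> z))
    = (\<Oplus>\<^bsub>M\<^esub>k\<in>S. f k \<odot>\<^bsub>M\<^esub> v k) \<oplus>\<^bsub>M\<^esub> (\<Oplus>k\<in>S. f k \<otimes> e k) \<odot>\<^bsub>M\<^esub> z"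
proof -
  have "(\<Oplus>\<^bsub>M\<^esub>k\<in>S. f k \<odot>\<^bsub>M\<^esub> (v k \<oplus>\<^bsub>M\<^esub> e k \<odot>\<^bsub>M\<^esub> z))
      = (\<Oplus>\<^bsub>M\<^esub>k\<in>S. f k \<odot>\<^bsub>M\<^esub> v k \<oplus>\<^bsub>M\<^esub> (f k \<otimes> e k) \<odot>\<^bsub>M\<^esub> z)"
    using assms by (intro M.finsum_cong') (auto simp: smult_r_distr smult_assoc1)
  also have "\<dots> = (\<Oplus>\<^bsub>M\<^esub>k\<in>S. f k \<odot>\<^bsub>M\<^esub> v k) \<oplus>\<^bsub>M\<^esub> (\<Oplus>\<^bsub>M\<^esub>k\<in>S. (f k \<otimes> e k) \<odot>\<^bsub>M\<^esub> z)"
    using assms by (intro M.finsum_addf) auto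
  also have "(\<Oplus>\<^bsub>M\<^esub>k\<in>S. (f k \<otimes> e k) \<odot>\<^bsub>M\<^esub> z) = (\<Oplus>k\<in>S. f k \<otimes> e k) \<odot>\<^bsub>M\<^esub> z"
    using assms by (intro finsum_smult_rdistr[symmetric]) auto
  finally show ?thesis .
qed

lemma (in module) finsum_delta_smult:
  assumes "finite S" "j \<in> S" "\<And>k. k \<in> S \<Longrightarrow> y k \<in> carrier M" "a \<in> carrier R"
  shows "(\<Oplus>\<^bsub>M\<^esub>k\<in>S. (if k = j then a else \<zero>) \<odot>\<^bsub>M\<^esub> y k) = a \<odot>\<^bsub>M\<^esub> y j"
proof -
  have "(\<Oplus>\<^bsub>M\<^esub>k\<in>S. (if k = j then a else \<zero>) \<odot>\<^bsub>M\<^esub> y k)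
      = (\<Oplus>\<^bsub>M\<^esub>k\<in>S. if k = j then a \<odot>\<^bsub>M\<^esub> y k else \<zero>\<^bsub>M\<^esub>)"
    using assms by (intro M.finsum_cong') auto
  also have "\<dots> = a \<odot>\<^bsub>M\<^esub> y j"
    using assms by (intro M.add.finprod_singleton_swap) auto
  finally show ?thesis .
qed

lemma (in cring) finsum_mult_delta:
  assumes "finite S" "j \<in> S" "\<And>k. k \<in> S \<Longrightarrow> y k \<in> carrier R" "a \<in> carrier R"
  shows "(\<Oplus>k\<in>S. y k \<otimes> (if j = k then a else \<zero>)) = y j \<otimes> a"
proof -
  have "(\<Oplus>k\<in>S. y k \<otimes> (if j = k then a else \<zero>)) = (\<Oplus>k\<in>S. if j = k then y k \<otimes> a else \<zero>)"
    using assms by (intro finsum_cong') auto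
  also have "\<dots> = y j \<otimes> a"
    using assms by (intro add.finprod_singleton) auto
  finally show ?thesis .
qed

lemma module_via_module:
  assumes "cring R" "cring S" "\<phi> \<in> ring_hom R S"
  shows "module R (module_via \<phi> S)"
proof -
  interpret R: cring R by fact
  interpret S: cring S by fact
  interpret h: ring_hom_cring R S \<phi>
    by (simp add: ring_hom_cring_def ring_hom_cring_axioms_def assms)
  have "abelian_group (module_via \<phi> S)"
    by (rule abelian_groupI)
      (auto simp: module_via_def S.a_assoc S.a_comm S.a_lcomm intro!: bexI[of _ "\<ominus>\<^bsub>S\<^esub> _"] S.l_neg)
  then show ?thesis
    by (intro moduleI) (auto simp: module_via_def R.is_cring S.l_distr S.r_distr S.m_assoc)
qed

lemma finsum_module_via [simp]:
  "(\<Oplus>\<^bsub>module_via h S\<^esub>i\<in>T. g i) = (\<Oplus>\<^bsub>S\<^esub>i\<in>T. g i)"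
  by (simp add: finsum_def finprod_def module_via_def)

section \<open>Trivial relations\<close>

definition linear_relation ::
    "('r, 'c) ring_scheme \<Rightarrow> ('r, 'n, 'd) module_scheme \<Rightarrow> nat \<Rightarrow> (nat \<Rightarrow> 'r) \<Rightarrow> (nat \<Rightarrow> 'n) \<Rightarrow> bool"
  where "linear_relation R N r b y \<longleftrightarrow>
    (\<forall>i<r. y i \<in> carrier N) \<and> (\<Oplus>\<^bsub>N\<^esub>i\<in>{..<r}. b i \<odot>\<^bsub>N\<^esub> y i) = \<zero>\<^bsub>N\<^esub>"

definition syzygy :: "('r, 'c) ring_scheme \<Rightarrow> nat \<Rightarrow> (nat \<Rightarrow> 'r) \<Rightarrow> (nat \<Rightarrow> 'r) \<Rightarrow> bool"
  where "syzygy R r b s \<longleftrightarrow>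
    (\<forall>i<r. s i \<in> carrier R) \<and> (\<Oplus>\<^bsub>R\<^esub>i\<in>{..<r}. b i \<otimes>\<^bsub>R\<^esub> s i) = \<zero>\<^bsub>R\<^esub>"

text \<open>
  The trivial relations are the combinations of syzygies with coefficients in the module. Only the
  first \<open>r\<close> coordinates of a vector matter, so both rules leave the others free.
\<close>

inductive trivial_relation ::
    "('r, 'c) ring_scheme \<Rightarrow> ('r, 'n, 'd) module_scheme \<Rightarrow> nat \<Rightarrow> (nat \<Rightarrow> 'r) \<Rightarrow> (nat \<Rightarrow> 'n) \<Rightarrow> bool"
  for R N r b where
  zero: "(\<And>i. i < r \<Longrightarrow> y i = \<zero>\<^bsub>N\<^esub>) \<Longrightarrow> trivial_relation R N r b y"
| add_syzygy: "trivial_relation R N r b x \<Longrightarrow> syzygy R r b s \<Longrightarrow> z \<in> carrier N \<Longrightarrow>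
    (\<And>i. i < r \<Longrightarrow> y i = x i \<oplus>\<^bsub>N\<^esub> s i \<odot>\<^bsub>N\<^esub> z) \<Longrightarrow> trivial_relation R N r b y"

text \<open>
  When the \<open>b i\<close> generate an ideal \<open>J\<close>, this is the vanishing of \<open>Tor\<^sub>1(R/J, N)\<close>.
\<close>

definition relations_trivial ::
    "('r, 'c) ring_scheme \<Rightarrow> ('r, 'n, 'd) module_scheme \<Rightarrow> nat \<Rightarrow> (nat \<Rightarrow> 'r) \<Rightarrow> bool"
  where "relations_trivial R N r b \<longleftrightarrow>
    (\<forall>y. linear_relation R N r b y \<longrightarrow> trivial_relation R N r b y)"

lemma trivial_relation_cong:
  assumes "trivial_relation R N r b x" "\<And>i. i < r \<Longrightarrow> y i = x i"
  shows "trivial_relation R N r b y"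
  using assms by cases (auto intro: trivial_relation.intros)

context module
begin

lemma trivial_relation_closed:
  assumes "trivial_relation R M r b y" "i < r"
  shows "y i \<in> carrier M"
  using assms by induction (auto simp: syzygy_def)

lemma trivial_relation_add:
  assumes "trivial_relation R M r b y" "trivial_relation R M r b x"
  shows "trivial_relation R M r b (\<lambda>i. x i \<oplus>\<^bsub>M\<^esub> y i)"
  using assms(1)
proof induction
  case (zero y)
  then show ?case
    by (auto intro: trivial_relation_cong[OF assms(2)] simp: trivial_relation_closed[OF assms(2)])
next
  case (add_syzygy y s z y')
  show ?case
    by (rule trivial_relation.add_syzygy[OF add_syzygy.IH add_syzygy.hyps(2,3)])
      (use add_syzygy in \<open>auto simp: syzygy_def M.a_assoc trivial_relation_closed[OF assms(2)]
        trivial_relation_closed[OF add_syzygy.hyps(1)]\<close>)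
qed

lemma trivial_relation_minus:
  assumes "trivial_relation R M r b y"
  shows "trivial_relation R M r b (\<lambda>i. \<ominus>\<^bsub>M\<^esub> y i)"
  using assms
proof induction
  case (zero y)
  then show ?case by (intro trivial_relation.zero) auto
next
  case (add_syzygy y s z y')
  show ?case
    by (rule trivial_relation.add_syzygy[OF add_syzygy.IH add_syzygy.hyps(2) M.a_inv_closed[OF add_syzygy.hyps(3)]])
      (use add_syzygy in \<open>auto simp: syzygy_def M.minus_add smult_r_minus trivial_relation_closed[OF add_syzygy.hyps(1)]\<close>)
qed

lemma trivial_relation_explicit:
  assumes "trivial_relation R M r b y"
  obtains t s z where "\<And>j. j < t \<Longrightarrow> syzygy R r b (s j)" "\<And>j. j < t \<Longrightarrow> z j \<in> carrier M"
    "\<And>i. i < r \<Longrightarrow> y i = (\<Oplus>\<^bsub>M\<^esub>j\<in>{..<t::nat}. s j i \<odot>\<^bsub>M\<^esub> z j)"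
proof -
  have "\<exists>t s z. (\<forall>j<t. syzygy R r b (s j) \<and> z j \<in> carrier M) \<and>
      (\<forall>i<r. y i = (\<Oplus>\<^bsub>M\<^esub>j\<in>{..<t::nat}. s j i \<odot>\<^bsub>M\<^esub> z j))"
    using assms
  proof induction
    case (zero y)
    then show ?case by (intro exI[of _ 0]) (simp add: M.finsum_empty)
  next
    case (add_syzygy y s' z' y')
    then obtain t s z where *: "\<forall>j<t. syzygy R r b (s j) \<and> z j \<in> carrier M"
      "\<forall>i<r. y i = (\<Oplus>\<^bsub>M\<^esub>j\<in>{..<t::nat}. s j i \<odot>\<^bsub>M\<^esub> z j)" by blast
    have "y' i = (\<Oplus>\<^bsub>M\<^esub>j\<in>{..<Suc t}. (s(t := s')) j i \<odot>\<^bsub>M\<^esub> (z(t := z')) j)" if "i < r" for i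
    proof -
      have "(\<Oplus>\<^bsub>M\<^esub>j\<in>{..<Suc t}. (s(t := s')) j i \<odot>\<^bsub>M\<^esub> (z(t := z')) j)
          = (\<Oplus>\<^bsub>M\<^esub>j\<in>{..<t}. (s(t := s')) j i \<odot>\<^bsub>M\<^esub> (z(t := z')) j) \<oplus>\<^bsub>M\<^esub> s' i \<odot>\<^bsub>M\<^esub> z'"
        using * add_syzygy that by (subst M.finsum_lessThan_Suc) (auto simp: syzygy_def less_Suc_eq)
      also have "(\<Oplus>\<^bsub>M\<^esub>j\<in>{..<t}. (s(t := s')) j i \<odot>\<^bsub>M\<^esub> (z(t := z')) j) = y i"
        using * that by (auto simp: syzygy_def intro!: M.finsum_cong')
      finally show ?thesis using add_syzygy that by simp
    qed
    moreover have "\<forall>j<Suc t. syzygy R r b ((s(t := s')) j) \<and> (z(t := z')) j \<in> carrier M"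
      using * add_syzygy by (auto simp: less_Suc_eq)
    ultimately show ?case by blast
  qed
  then show ?thesis using that by blast
qed

lemma trivial_relation_sum:
  assumes "\<And>j. j < t \<Longrightarrow> syzygy R r b (s j)" "\<And>j. j < t \<Longrightarrow> z j \<in> carrier M"
    "\<And>i. i < r \<Longrightarrow> y i = (\<Oplus>\<^bsub>M\<^esub>j\<in>{..<t::nat}. s j i \<odot>\<^bsub>M\<^esub> z j)"
  shows "trivial_relation R M r b y"
  using assms
proof (induction t arbitrary: y)
  case 0
  then show ?case by (intro trivial_relation.zero) (simp add: M.finsum_empty)
next
  case (Suc t)
  show ?case
    by (rule trivial_relation.add_syzygy[OF Suc.IH[OF _ _ refl] Suc.prems(1)[of t] Suc.prems(2)[of t]])
      (use Suc.prems in \<open>auto simp: syzygy_def M.finsum_lessThan_Suc\<close>)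
qed

text \<open>A matrix \<open>F\<close> that carries syzygies to syzygies carries trivial relations to trivial ones.\<close>

lemma trivial_relation_map:
  assumes y: "trivial_relation R M q d v"
    and F: "\<And>k i. k < q \<Longrightarrow> i < r \<Longrightarrow> F k i \<in> carrier R"
    and syz: "\<And>s. syzygy R q d s \<Longrightarrow> syzygy R r b (\<lambda>i. \<Oplus>k\<in>{..<q}. F k i \<otimes> s k)"
  shows "trivial_relation R M r b (\<lambda>i. \<Oplus>\<^bsub>M\<^esub>k\<in>{..<q}. F k i \<odot>\<^bsub>M\<^esub> v k)"
  using y
proof induction
  case (zero y)
  then show ?case using F
    by (intro trivial_relation.zero) (auto simp: Pi_def intro!: M.add.finprod_one_eqI)
next
  case (add_syzygy x s z y)
  have x: "x k \<in> carrier M" and s: "s k \<in> carrier R" if "k < q" for k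
    using add_syzygy that by (auto simp: trivial_relation_closed syzygy_def)
  have "(\<Oplus>\<^bsub>M\<^esub>k\<in>{..<q}. F k i \<odot>\<^bsub>M\<^esub> y k)
      = (\<Oplus>\<^bsub>M\<^esub>k\<in>{..<q}. F k i \<odot>\<^bsub>M\<^esub> x k) \<oplus>\<^bsub>M\<^esub> (\<Oplus>k\<in>{..<q}. F k i \<otimes> s k) \<odot>\<^bsub>M\<^esub> z" if i: "i < r" for i
  proof -
    have "(\<Oplus>\<^bsub>M\<^esub>k\<in>{..<q}. F k i \<odot>\<^bsub>M\<^esub> y k) = (\<Oplus>\<^bsub>M\<^esub>k\<in>{..<q}. F k i \<odot>\<^bsub>M\<^esub> (x k \<oplus>\<^bsub>M\<^esub> s k \<odot>\<^bsub>M\<^esub> z))"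
      using add_syzygy x s F i by (intro M.finsum_cong') auto
    also have "\<dots> = (\<Oplus>\<^bsub>M\<^esub>k\<in>{..<q}. F k i \<odot>\<^bsub>M\<^esub> x k) \<oplus>\<^bsub>M\<^esub> (\<Oplus>k\<in>{..<q}. F k i \<otimes> s k) \<odot>\<^bsub>M\<^esub> z"
      using add_syzygy.hyps(3) x s F i by (intro finsum_smult_add_smult) auto
    finally show ?thesis .
  qed
  then show ?case
    by (rule trivial_relation.add_syzygy[OF add_syzygy.IH syz[OF add_syzygy.hyps(2)] add_syzygy.hyps(3)])
qed

end

lemma (in cring) sum_mult_swap:
  assumes "finite S" "finite T" "\<And>i. i \<in> S \<Longrightarrow> c i \<in> carrier R"
    "\<And>i j. i \<in> S \<Longrightarrow> j \<in> T \<Longrightarrow> f i j \<in> carrier R" "\<And>j. j \<in> T \<Longrightarrow> y j \<in> carrier R"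
  shows "(\<Oplus>i\<in>S. c i \<otimes> (\<Oplus>j\<in>T. f i j \<otimes> y j)) = (\<Oplus>j\<in>T. (\<Oplus>i\<in>S. c i \<otimes> f i j) \<otimes> y j)"
proof -
  interpret S: module R "module_via (\<lambda>x. x) R"
    by (intro module_via_module is_cring) (auto simp: ring_hom_def)
  show ?thesis
    using S.finsum_smult_swap[of S T c f y] assms
    by (simp) (simp add: module_via_def)
qed

section \<open>Submodules of finite free modules\<close>

text \<open>
  Vectors of length \<open>r\<close> are functions on the natural numbers whose values from \<open>r\<close> on are irrelevant.
  The last clause makes membership independent of those values.
\<close>

definition vector_submodule :: "('r, 'c) ring_scheme \<Rightarrow> nat \<Rightarrow> (nat \<Rightarrow> 'r) set \<Rightarrow> bool"
  where "vector_submodule R r V \<longleftrightarrow>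
    (\<lambda>i. \<zero>\<^bsub>R\<^esub>) \<in> V \<and> (\<forall>v\<in>V. \<forall>i<r. v i \<in> carrier R) \<and>
    (\<forall>v\<in>V. \<forall>w\<in>V. (\<lambda>i. v i \<oplus>\<^bsub>R\<^esub> w i) \<in> V) \<and>
    (\<forall>v\<in>V. \<forall>c\<in>carrier R. (\<lambda>i. c \<otimes>\<^bsub>R\<^esub> v i) \<in> V) \<and>
    (\<forall>v\<in>V. \<forall>w. (\<forall>i<r. w i = v i) \<longrightarrow> w \<in> V)"

definition combinations :: "('r, 'c) ring_scheme \<Rightarrow> nat \<Rightarrow> nat \<Rightarrow> (nat \<Rightarrow> nat \<Rightarrow> 'r) \<Rightarrow> (nat \<Rightarrow> 'r) set"
  where "combinations R r t s =
    {v. \<exists>z. (\<forall>j<t. z j \<in> carrier R) \<and> (\<forall>i<r. v i = (\<Oplus>\<^bsub>R\<^esub>j\<in>{..<t}. s j i \<otimes>\<^bsub>R\<^esub> z j))}"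

lemma vector_submoduleD:
  assumes "vector_submodule R r V"
  shows "(\<lambda>i. \<zero>\<^bsub>R\<^esub>) \<in> V"
    and "v \<in> V \<Longrightarrow> i < r \<Longrightarrow> v i \<in> carrier R"
    and "v \<in> V \<Longrightarrow> w \<in> V \<Longrightarrow> (\<lambda>i. v i \<oplus>\<^bsub>R\<^esub> w i) \<in> V"
    and "v \<in> V \<Longrightarrow> c \<in> carrier R \<Longrightarrow> (\<lambda>i. c \<otimes>\<^bsub>R\<^esub> v i) \<in> V"
    and "v \<in> V \<Longrightarrow> (\<And>i. i < r \<Longrightarrow> w i = v i) \<Longrightarrow> w \<in> V"
  using assms unfolding vector_submodule_def by blast+

context cring
begin

lemma combinations_Suc:
  assumes "\<And>j i. j \<le> t \<Longrightarrow> i < r \<Longrightarrow> s j i \<in> carrier R"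
  shows "v \<in> combinations R r (Suc t) s \<longleftrightarrow>
    (\<exists>w\<in>combinations R r t s. \<exists>c\<in>carrier R. \<forall>i<r. v i = w i \<oplus> s t i \<otimes> c)"
proof
  assume "v \<in> combinations R r (Suc t) s"
  then obtain z where z: "\<forall>j<Suc t. z j \<in> carrier R"
    "\<forall>i<r. v i = (\<Oplus>j\<in>{..<Suc t}. s j i \<otimes> z j)"
    unfolding combinations_def by blast
  then have "\<forall>i<r. v i = (\<Oplus>j\<in>{..<t}. s j i \<otimes> z j) \<oplus> s t i \<otimes> z t"
    using assms by (simp add: finsum_lessThan_Suc)
  moreover have "(\<lambda>i. \<Oplus>j\<in>{..<t}. s j i \<otimes> z j) \<in> combinations R r t s"
    using z unfolding combinations_def by (auto intro!: exI[of _ z])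
  ultimately show "\<exists>w\<in>combinations R r t s. \<exists>c\<in>carrier R. \<forall>i<r. v i = w i \<oplus> s t i \<otimes> c"
    using z(1) by (intro bexI[of _ "\<lambda>i. \<Oplus>j\<in>{..<t}. s j i \<otimes> z j"] bexI[of _ "z t"]) auto
next
  assume "\<exists>w\<in>combinations R r t s. \<exists>c\<in>carrier R. \<forall>i<r. v i = w i \<oplus> s t i \<otimes> c"
  then obtain z c where z: "\<forall>j<t. z j \<in> carrier R" "c \<in> carrier R"
    "\<forall>i<r. v i = (\<Oplus>j\<in>{..<t}. s j i \<otimes> z j) \<oplus> s t i \<otimes> c"
    unfolding combinations_def by auto
  have "v i = (\<Oplus>j\<in>{..<Suc t}. s j i \<otimes> (z(t := c)) j)" if i: "i < r" for i
  proof -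
    have "(\<Oplus>j\<in>{..<Suc t}. s j i \<otimes> (z(t := c)) j)
        = (\<Oplus>j\<in>{..<t}. s j i \<otimes> (z(t := c)) j) \<oplus> s t i \<otimes> c"
      using assms z i by (subst finsum_lessThan_Suc) (auto simp: le_less)
    also have "(\<Oplus>j\<in>{..<t}. s j i \<otimes> (z(t := c)) j) = (\<Oplus>j\<in>{..<t}. s j i \<otimes> z j)"
      using assms z i by (intro finsum_cong') auto
    finally show ?thesis using z i by simp
  qed
  then show "v \<in> combinations R r (Suc t) s"
    unfolding combinations_def using z by (auto intro!: exI[of _ "z(t := c)"] simp: less_Suc_eq)
qed

lemma combinations_submodule:
  assumes s: "\<And>j i. j < t \<Longrightarrow> i < r \<Longrightarrow> s j i \<in> carrier R"
  shows "vector_submodule R r (combinations R r t s)"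
  unfolding vector_submodule_def
proof (intro conjI ballI allI impI)
  show "(\<lambda>i. \<zero>) \<in> combinations R r t s"
    unfolding combinations_def using s
    by (auto intro!: exI[of _ "\<lambda>_. \<zero>"] add.finprod_one_eqI[symmetric])
next
  fix v i assume "v \<in> combinations R r t s" "i < r"
  then show "v i \<in> carrier R" using s by (auto simp: combinations_def intro!: finsum_closed)
next
  fix v w assume "v \<in> combinations R r t s" "w \<in> combinations R r t s"
  then obtain z y where zy: "\<forall>j<t. z j \<in> carrier R" "\<forall>i<r. v i = (\<Oplus>j\<in>{..<t}. s j i \<otimes> z j)"
    "\<forall>j<t. y j \<in> carrier R" "\<forall>i<r. w i = (\<Oplus>j\<in>{..<t}. s j i \<otimes> y j)"
    unfolding combinations_def by blast
  have "v i \<oplus> w i = (\<Oplus>j\<in>{..<t}. s j i \<otimes> (z j \<oplus> y j))" if "i < r" for i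
  proof -
    have "(\<Oplus>j\<in>{..<t}. s j i \<otimes> (z j \<oplus> y j)) = (\<Oplus>j\<in>{..<t}. s j i \<otimes> z j \<oplus> s j i \<otimes> y j)"
      using s zy that by (intro finsum_cong') (auto simp: r_distr)
    also have "\<dots> = (\<Oplus>j\<in>{..<t}. s j i \<otimes> z j) \<oplus> (\<Oplus>j\<in>{..<t}. s j i \<otimes> y j)"
      using s zy that by (intro finsum_addf) auto
    finally show ?thesis using zy that by simp
  qed
  then show "(\<lambda>i. v i \<oplus> w i) \<in> combinations R r t s"
    unfolding combinations_def using zy by (auto intro!: exI[of _ "\<lambda>j. z j \<oplus> y j"])
next
  fix v c assume "v \<in> combinations R r t s" and c: "c \<in> carrier R"
  then obtain z where z: "\<forall>j<t. z j \<in> carrier R" "\<forall>i<r. v i = (\<Oplus>j\<in>{..<t}. s j i \<otimes> z j)"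
    unfolding combinations_def by blast
  have "c \<otimes> v i = (\<Oplus>j\<in>{..<t}. s j i \<otimes> (c \<otimes> z j))" if "i < r" for i
  proof -
    have "c \<otimes> v i = (\<Oplus>j\<in>{..<t}. c \<otimes> (s j i \<otimes> z j))"
      using s z c that by (simp add: finsum_rdistr Pi_def)
    also have "\<dots> = (\<Oplus>j\<in>{..<t}. s j i \<otimes> (c \<otimes> z j))"
      using s z c that by (intro finsum_cong') (auto simp: m_lcomm)
    finally show ?thesis .
  qed
  then show "(\<lambda>i. c \<otimes> v i) \<in> combinations R r t s"
    unfolding combinations_def using z c by (auto intro!: exI[of _ "\<lambda>j. c \<otimes> z j"])
next
  fix v w assume "v \<in> combinations R r t s" "\<forall>i<r. w i = v i"
  then show "w \<in> combinations R r t s" by (auto simp: combinations_def)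
qed

lemma combinations_subset:
  assumes V: "vector_submodule R r V" and s: "\<And>j. j < t \<Longrightarrow> s j \<in> V"
  shows "combinations R r t s \<subseteq> V"
  using s
proof (induction t)
  case 0
  then show ?case
    using vector_submoduleD(5)[OF V vector_submoduleD(1)[OF V]]
    by (auto simp: combinations_def finsum_empty)
next
  case (Suc t)
  show ?case
  proof
    fix v assume "v \<in> combinations R r (Suc t) s"
    moreover have sc: "s j i \<in> carrier R" if "j \<le> t" "i < r" for j i
      using vector_submoduleD(2)[OF V] Suc.prems that by auto
    ultimately obtain w c where w: "w \<in> combinations R r t s" "c \<in> carrier R"
      "\<forall>i<r. v i = w i \<oplus> s t i \<otimes> c"
      using combinations_Suc[of t r s v] by blast
    have "(\<lambda>i. w i \<oplus> c \<otimes> s t i) \<in> V"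
      by (intro vector_submoduleD(3,4)[OF V]) (use w Suc in auto)
    then show "v \<in> V"
      by (rule vector_submoduleD(5)[OF V]) (use w sc in \<open>auto simp: m_comm\<close>)
  qed
qed

lemma in_combinations:
  assumes "\<And>j i. j < t \<Longrightarrow> i < r \<Longrightarrow> s j i \<in> carrier R" "k < t"
  shows "s k \<in> combinations R r t s"
proof -
  have "s k i = (\<Oplus>j\<in>{..<t}. s j i \<otimes> (if k = j then \<one> else \<zero>))" if "i < r" for i
  proof -
    have "(\<Oplus>j\<in>{..<t}. s j i \<otimes> (if k = j then \<one> else \<zero>)) = (\<Oplus>j\<in>{..<t}. if k = j then s j i else \<zero>)"
      using assms that by (intro finsum_cong') auto
    also have "\<dots> = s k i" using assms that by (intro add.finprod_singleton) auto
    finally show ?thesis ..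
  qed
  then show ?thesis
    unfolding combinations_def by (auto intro!: exI[of _ "\<lambda>j. if k = j then \<one> else \<zero>"])
qed

end

definition generates :: "('r, 'c) ring_scheme \<Rightarrow> nat \<Rightarrow> (nat \<Rightarrow> 'r) \<Rightarrow> 'r set \<Rightarrow> bool"
  where "generates R r b J \<longleftrightarrow> (\<forall>i<r. b i \<in> J) \<and>
    (\<forall>x\<in>J. \<exists>c. (\<forall>i<r. c i \<in> carrier R) \<and> x = (\<Oplus>\<^bsub>R\<^esub>i\<in>{..<r}. b i \<otimes>\<^bsub>R\<^esub> c i))"

lemma (in cring) genideal_generates:
  assumes b: "\<And>i. i < r \<Longrightarrow> b i \<in> carrier R"
  shows "generates R r b (Idl (b ` {..<r}))"
proof -
  \<comment> \<open>The ideal of linear combinations is the submodule of combinations in rank one.\<close>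
  define C where "C = combinations R 1 r (\<lambda>j _. b j)"
  define L where "L = {x. (\<lambda>_. x) \<in> C}"
  have sub: "vector_submodule R 1 C"
    unfolding C_def by (rule combinations_submodule) (use b in auto)
  note C = vector_submoduleD[OF sub]
  have Lc: "x \<in> carrier R" if "x \<in> L" for x
    using C(2)[of "\<lambda>_. x" 0] that by (simp add: L_def)
  have Lm: "y \<otimes> x \<in> L" if "x \<in> L" "y \<in> carrier R" for x y
    using C(4)[of "\<lambda>_. x" y] that by (simp add: L_def)
  have "ideal L R"
  proof (rule idealI)
    show "subgroup L (add_monoid R)"
    proof (rule add.subgroupI)
      show "L \<subseteq> carrier R" using Lc by blast
      show "L \<noteq> {}" using C(1) by (auto simp: L_def)
      fix x y assume x: "x \<in> L"
      show "\<ominus> x \<in> L" using Lm[OF x, of "\<ominus> \<one>"] Lc[OF x] by (simp add: l_minus)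
      assume "y \<in> L" then show "x \<oplus> y \<in> L"
        using C(3)[of "\<lambda>_. x" "\<lambda>_. y"] x by (simp add: L_def)
    qed
    fix a x assume a: "a \<in> L" "x \<in> carrier R"
    show "x \<otimes> a \<in> L" using Lm a by blast
    then show "a \<otimes> x \<in> L" using a Lc[OF a(1)] by (simp add: m_comm)
  qed (rule ring_axioms)
  moreover have "b i \<in> L" if "i < r" for i
    using in_combinations[of r 1 "\<lambda>j _. b j" i] b that by (simp add: L_def C_def)
  then have "b ` {..<r} \<subseteq> L" by blast
  ultimately have "Idl (b ` {..<r}) \<subseteq> L" by (rule genideal_minimal)
  moreover have "\<exists>c. (\<forall>i<r. c i \<in> carrier R) \<and> x = (\<Oplus>i\<in>{..<r}. b i \<otimes> c i)" if "x \<in> L" for x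
    using that by (auto simp: L_def C_def combinations_def)
  moreover have "b ` {..<r} \<subseteq> Idl (b ` {..<r})" by (rule genideal_self) (use b in auto)
  ultimately show ?thesis unfolding generates_def by blast
qed

lemma noetherian_generators:
  fixes R (structure)
  assumes "noetherian_ring R" "cring R" "ideal J R"
  obtains r b where "generates R r b J"
proof -
  interpret cring R by fact
  obtain S where S: "S \<subseteq> carrier R" "finite S" "J = Idl\<^bsub>R\<^esub> S"
    using noetherian_ring.finetely_gen[OF assms(1,3)] by blast
  obtain b and r::nat where "S = b ` {..<r}"
    using S(2) by (metis finite_imp_nat_seg_image_inj_on lessThan_def)
  then show ?thesis using that genideal_generates[of r b] S by auto
qed

text \<open>
  The last coordinates of the vectors in \<open>V\<close> form an ideal. Lifts of its generators, together
  with generators for the vectors in \<open>V\<close> with last coordinate zero, generate \<open>V\<close>.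
\<close>

lemma vector_submodule_finitely_generated:
  fixes R (structure)
  assumes noeth: "noetherian_ring R" and R: "cring R" and V: "vector_submodule R r V"
  obtains t s where "\<And>j. j < t \<Longrightarrow> s j \<in> V" "V \<subseteq> combinations R r t s"
proof -
  interpret cring R by fact
  have "\<exists>t s. (\<forall>j<t. s j \<in> V) \<and> V \<subseteq> combinations R r t s"
    using V
  proof (induction r arbitrary: V)
    case 0
    then show ?case by (intro exI[of _ 0]) (auto simp: combinations_def)
  next
    case (Suc r)
    note V = vector_submoduleD[OF Suc.prems]
    let ?L = "(\<lambda>v. v r) ` V"
    have "ideal ?L R"
    proof (rule idealI)
      show "subgroup ?L (add_monoid R)"
      proof (rule add.subgroupI)
        show "?L \<subseteq> carrier R" using V(2) by auto
        show "?L \<noteq> {}" using V(1) by blast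
        fix x y assume "x \<in> ?L"
        then obtain v where v: "v \<in> V" "x = v r" by blast
        then have "(\<lambda>i. \<ominus> \<one> \<otimes> v i) \<in> V" using V(4)[of v "\<ominus> \<one>"] by simp
        then show "\<ominus> x \<in> ?L"
          using v V(2)[of v r] by (intro image_eqI[of _ _ "\<lambda>i. \<ominus> \<one> \<otimes> v i"]) (auto simp: l_minus)
        assume "y \<in> ?L"
        then show "x \<oplus> y \<in> ?L" using v V(3)[of v]
          by (auto intro!: image_eqI[of "_ \<oplus> _" _ "\<lambda>i. _ i \<oplus> _ i"])
      qed
      fix a x assume a: "a \<in> ?L" "x \<in> carrier R"
      then obtain v where v: "v \<in> V" "a = v r" by blast
      then show "x \<otimes> a \<in> ?L" using V(4)[of v x] a
        by (intro image_eqI[of _ _ "\<lambda>i. x \<otimes> v i"]) auto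
      then show "a \<otimes> x \<in> ?L" using a v V(2)[of v r] by (simp add: m_comm)
    qed (rule ring_axioms)
    from noetherian_generators[OF noeth R this]
    obtain q g where g: "generates R q g ?L" .
    then have "g k \<in> ?L" if "k < q" for k using that unfolding generates_def by blast
    then have "\<exists>w. w \<in> V \<and> w r = g k" if "k < q" for k using that by fastforce
    then obtain w where w: "\<And>k. k < q \<Longrightarrow> w k \<in> V" "\<And>k. k < q \<Longrightarrow> w k r = g k" by metis
    have gc: "g k \<in> carrier R" if "k < q" for k
      using V(2)[OF w(1)[OF that], of r] w(2)[OF that] by simp
    define V0 where "V0 = {v. v(r := \<zero>) \<in> V}"
    have "vector_submodule R r V0"
      unfolding vector_submodule_def
    proof (intro conjI ballI allI impI)
      show "(\<lambda>i. \<zero>) \<in> V0" using V(1) by (simp add: V0_def fun_upd_def)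
      fix v assume v: "v \<in> V0"
      show "v i \<in> carrier R" if "i < r" for i
        using V(2)[of "v(r := \<zero>)" i] v that by (simp add: V0_def)
      show "(\<lambda>i. v i \<oplus> u i) \<in> V0" if "u \<in> V0" for u
        unfolding V0_def mem_Collect_eq
        by (rule V(5)[OF V(3)[of "v(r := \<zero>)" "u(r := \<zero>)"]]) (use v that in \<open>auto simp: V0_def\<close>)
      show "(\<lambda>i. c \<otimes> v i) \<in> V0" if "c \<in> carrier R" for c
        unfolding V0_def mem_Collect_eq
        by (rule V(5)[OF V(4)[of "v(r := \<zero>)" c]]) (use v that in \<open>auto simp: V0_def\<close>)
      show "u \<in> V0" if "\<forall>i<r. u i = v i" for u
        unfolding V0_def mem_Collect_eq
        by (rule V(5)[of "v(r := \<zero>)"]) (use v that in \<open>auto simp: V0_def\<close>)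
    qed
    note V0 = this
    from Suc.IH[OF V0] obtain t s where s: "\<forall>j<t. s j \<in> V0" "V0 \<subseteq> combinations R r t s"
      by blast
    have sc: "s j i \<in> carrier R" if "j < t" "i < r" for j i
      using vector_submoduleD(2)[OF V0] s(1) that by blast
    define f where "f j = (if j < t then (s j)(r := \<zero>) else w (j - t))" for j
    have fV: "f j \<in> V" if "j < t + q" for j
      using s w that by (auto simp: f_def V0_def)
    let ?W = "combinations R (Suc r) (t + q) f"
    have fc: "f j i \<in> carrier R" if "j < t + q" "i < Suc r" for j i using V(2) fV that by blast
    have Wsub: "vector_submodule R (Suc r) ?W" by (rule combinations_submodule) (rule fc)
    note W = vector_submoduleD[OF Wsub]
    have fW: "f j \<in> ?W" if "j < t + q" for j
      by (rule in_combinations) (use fc that in auto)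
    have wsum: "(\<lambda>i. \<Oplus>k\<in>{..<q}. w k i \<otimes> c k) \<in> combinations R (Suc r) q w"
      if "\<forall>k<q. c k \<in> carrier R" for c
      using that unfolding combinations_def by auto
    have "v \<in> ?W" if v: "v \<in> V" for v
    proof -
      obtain c where c: "\<forall>k<q. c k \<in> carrier R" "v r = (\<Oplus>k\<in>{..<q}. g k \<otimes> c k)"
        using g v unfolding generates_def by blast
      define u where "u i = (\<Oplus>k\<in>{..<q}. w k i \<otimes> c k)" for i
      have uV: "u \<in> V"
        unfolding u_def using wsum[OF c(1)] combinations_subset[OF Suc.prems, of q w] w by blast
      have uW: "u \<in> ?W"
      proof -
        have "w k \<in> ?W" if "k < q" for k using fW[of "t + k"] that by (simp add: f_def)
        then show ?thesis
          unfolding u_def using wsum[OF c(1)]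
            combinations_subset[OF Wsub, of q w] by blast
      qed
      define x where "x i = v i \<oplus> \<ominus> \<one> \<otimes> u i" for i
      have xV: "x \<in> V" unfolding x_def by (intro V(3,4) v uV) auto
      have "u r = v r"
        unfolding u_def c(2) using w c(1) gc by (intro finsum_cong') auto
      then have xr: "x r = \<zero>" using V(2)[OF v, of r] by (simp add: x_def l_minus r_neg)
      then have "x(r := \<zero>) = x" by auto
      then have "x \<in> V0" using xV by (simp add: V0_def)
      then obtain z where z: "\<forall>j<t. z j \<in> carrier R" "\<forall>i<r. x i = (\<Oplus>j\<in>{..<t}. s j i \<otimes> z j)"
        using s(2) unfolding combinations_def by blast
      have "x i = (\<Oplus>j\<in>{..<t}. f j i \<otimes> z j)" if i: "i < Suc r" for i
      proof (cases "i = r")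
        case True
        then show ?thesis using xr z
          by (auto simp: f_def intro!: add.finprod_one_eqI[symmetric])
      next
        case False
        then have "(\<Oplus>j\<in>{..<t}. f j i \<otimes> z j) = (\<Oplus>j\<in>{..<t}. s j i \<otimes> z j)"
          using i z sc by (intro finsum_cong') (auto simp: f_def)
        with False i z show ?thesis by simp
      qed
      then have "x \<in> combinations R (Suc r) t f" using z unfolding combinations_def by blast
      then have "x \<in> ?W"
        using combinations_subset[OF Wsub, of t f] fW by auto
      then have "(\<lambda>i. x i \<oplus> u i) \<in> ?W" using uW by (rule W(3))
      then show ?thesis
      proof (rule W(5))
        fix i assume "i < Suc r"
        then show "v i = x i \<oplus> u i"
          using V(2)[OF v] V(2)[OF uV] by (simp add: x_def l_minus a_assoc l_neg)
      qed
    qed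
    then show ?case using fV by blast
  qed
  then show ?thesis using that by blast
qed

text \<open>
  The vectors spanning \<open>V\<close> modulo \<open>s\<close> are eliminated one at a time: the hypothesis on \<open>a\<close> expresses a
  unit multiple of the last one by the others.
\<close>

lemma vector_nakayama:
  fixes R (structure)
  assumes noeth: "noetherian_ring R" and R: "cring R" and V: "vector_submodule R r V"
    and a: "a \<in> carrier R" and unit: "\<And>c. c \<in> carrier R \<Longrightarrow> \<one>\<^bsub>R\<^esub> \<ominus>\<^bsub>R\<^esub> a \<otimes>\<^bsub>R\<^esub> c \<in> Units R"
    and s: "\<And>j. j < t \<Longrightarrow> s j \<in> V"
    and aV: "\<And>v. v \<in> V \<Longrightarrow> \<exists>v'\<in>V. \<exists>w\<in>combinations R r t s. \<forall>i<r. v i = a \<otimes>\<^bsub>R\<^esub> v' i \<oplus>\<^bsub>R\<^esub> w i"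
  shows "V \<subseteq> combinations R r t s"
proof -
  interpret cring R by fact
  note V' = vector_submoduleD[OF V]
  have drop: "V \<subseteq> combinations R r t s"
    if "\<And>j. j < t + q \<Longrightarrow> f j \<in> V" "V \<subseteq> combinations R r (t + q) f" "\<And>j. j < t \<Longrightarrow> f j = s j" for q f
    using that
  proof (induction q)
    case 0
    then have "combinations R r t f = combinations R r t s"
      using V'(2)[OF s] unfolding combinations_def
      by (intro Collect_cong ex_cong conj_cong refl all_cong arg_cong2[of _ _ _ _ "(=)"] finsum_cong') auto
    then show ?case using 0 by simp
  next
    case (Suc q)
    let ?W = "combinations R r (t + q) f"
    have fc: "f j i \<in> carrier R" if "j \<le> t + q" "i < r" for j i
      using V'(2)[OF Suc.prems(1)] that by simp
    have Wsub: "vector_submodule R r ?W" by (rule combinations_submodule) (use fc in auto)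
    note W = vector_submoduleD[OF Wsub]
    define g where "g = f (t + q)"
    have split: "\<exists>w\<in>?W. \<exists>c\<in>carrier R. \<forall>i<r. v i = w i \<oplus> g i \<otimes> c" if "v \<in> V" for v
      using Suc.prems(2) that combinations_Suc[of "t + q" r f v] fc unfolding g_def by auto
    have gV: "g \<in> V" using Suc.prems(1)[of "t + q"] by (simp add: g_def)
    have sW: "combinations R r t s \<subseteq> ?W"
      by (rule combinations_subset[OF Wsub])
        (metis Suc.prems(3) in_combinations fc less_imp_le trans_less_add1)
    obtain v' w1 where v': "v' \<in> V" "w1 \<in> ?W" "\<forall>i<r. g i = a \<otimes> v' i \<oplus> w1 i"
      using aV[OF gV] sW by blast
    obtain w2 c where c: "w2 \<in> ?W" "c \<in> carrier R" "\<forall>i<r. v' i = w2 i \<oplus> g i \<otimes> c"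
      using split[OF v'(1)] by blast
    define u where "u = inv (\<one> \<ominus> a \<otimes> c)"
    have u: "u \<in> carrier R" "u \<otimes> (\<one> \<ominus> a \<otimes> c) = \<one>"
      using unit[OF c(2)] by (auto simp: u_def)
    have gW: "g \<in> ?W"
    proof (rule W(5))
      show "(\<lambda>i. u \<otimes> (a \<otimes> w2 i \<oplus> w1 i)) \<in> ?W"
        by (intro W(3,4)) (use u a c v' in auto)
      fix i assume i: "i < r"
      note cl = V'(2)[OF gV i] W(2)[OF c(1) i] W(2)[OF v'(2) i] a c(2) u(1)
      have "g i = (a \<otimes> w2 i \<oplus> w1 i) \<oplus> (a \<otimes> c) \<otimes> g i"
        using v'(3) c(3) i cl by (auto simp: r_distr a_ac m_ac)
      moreover have "(\<one> \<ominus> a \<otimes> c) \<otimes> g i = g i \<ominus> (a \<otimes> c) \<otimes> g i"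
        using cl by (simp add: minus_eq l_distr l_minus)
      moreover have "(a \<otimes> w2 i \<oplus> w1 i) \<oplus> (a \<otimes> c) \<otimes> g i \<ominus> (a \<otimes> c) \<otimes> g i = a \<otimes> w2 i \<oplus> w1 i"
        using cl by (simp add: minus_eq a_assoc r_neg)
      ultimately have "(\<one> \<ominus> a \<otimes> c) \<otimes> g i = a \<otimes> w2 i \<oplus> w1 i" by metis
      then have "u \<otimes> (a \<otimes> w2 i \<oplus> w1 i) = (u \<otimes> (\<one> \<ominus> a \<otimes> c)) \<otimes> g i"
        using cl by (simp add: m_assoc)
      then show "g i = u \<otimes> (a \<otimes> w2 i \<oplus> w1 i)" using u cl by simp
    qed
    have "V \<subseteq> ?W"
    proof
      fix v assume "v \<in> V"
      then obtain w d where w: "w \<in> ?W" "d \<in> carrier R" "\<forall>i<r. v i = w i \<oplus> g i \<otimes> d"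
        using split by blast
      show "v \<in> ?W"
      proof (rule W(5))
        show "(\<lambda>i. w i \<oplus> d \<otimes> g i) \<in> ?W" by (intro W(3,4) w gW)
      qed (use w V'(2)[OF gV] in \<open>auto simp: m_comm\<close>)
    qed
    then show ?case using Suc by simp
  qed
  obtain q g where g: "\<And>j. j < q \<Longrightarrow> g j \<in> V" "V \<subseteq> combinations R r q g"
    using vector_submodule_finitely_generated[OF noeth R V] by blast
  define f where "f j = (if j < t then s j else g (j - t))" for j
  have fV: "f j \<in> V" if "j < t + q" for j using s g that by (auto simp: f_def)
  have fc: "f j i \<in> carrier R" if "j < t + q" "i < r" for j i using V'(2) fV that by blast
  have "g j \<in> combinations R r (t + q) f" if "j < q" for j
    using in_combinations[of "t + q" r f "t + j"] fc that by (simp add: f_def)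
  then have "V \<subseteq> combinations R r (t + q) f"
    using combinations_subset[OF combinations_submodule[of "t + q" r f], of q g] fc g(2) by blast
  then show ?thesis by (rule drop[rotated]) (use fV in \<open>auto simp: f_def\<close>)
qed

section \<open>Reduction to the closed point\<close>

context module
begin

text \<open>
  Whether all relations are trivial depends only on the ideal that the coefficients generate.
\<close>

lemma relations_trivial_change_generators:
  assumes b: "\<And>i. i < r \<Longrightarrow> b i \<in> carrier R" and b': "\<And>j. j < r' \<Longrightarrow> b' j \<in> carrier R"
    and p: "\<And>i j. i < r \<Longrightarrow> j < r' \<Longrightarrow> p j i \<in> carrier R"
    and q: "\<And>i j. i < r \<Longrightarrow> j < r' \<Longrightarrow> q i j \<in> carrier R"
    and pb: "\<And>j. j < r' \<Longrightarrow> b' j = (\<Oplus>i\<in>{..<r}. b i \<otimes> p j i)"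
    and qb: "\<And>i. i < r \<Longrightarrow> b i = (\<Oplus>j\<in>{..<r'}. b' j \<otimes> q i j)"
    and triv: "relations_trivial R M r b"
  shows "relations_trivial R M r' b'"
  unfolding relations_trivial_def
proof (intro allI impI)
  fix y assume "linear_relation R M r' b' y"
  then have y: "\<And>j. j < r' \<Longrightarrow> y j \<in> carrier M"
    and rel: "(\<Oplus>\<^bsub>M\<^esub>j\<in>{..<r'}. b' j \<odot>\<^bsub>M\<^esub> y j) = \<zero>\<^bsub>M\<^esub>"
    by (auto simp: linear_relation_def)
  define u where "u i = (\<Oplus>\<^bsub>M\<^esub>j\<in>{..<r'}. p j i \<odot>\<^bsub>M\<^esub> y j)" for i
  have u: "u i \<in> carrier M" if "i < r" for i
    using y p that by (auto simp: u_def intro!: M.finsum_closed)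
  have "(\<Oplus>\<^bsub>M\<^esub>i\<in>{..<r}. b i \<odot>\<^bsub>M\<^esub> u i) = (\<Oplus>\<^bsub>M\<^esub>j\<in>{..<r'}. (\<Oplus>i\<in>{..<r}. b i \<otimes> p j i) \<odot>\<^bsub>M\<^esub> y j)"
    unfolding u_def using b p y by (intro finsum_smult_swap[of _ _ b "\<lambda>i j. p j i"]) auto
  also have "\<dots> = (\<Oplus>\<^bsub>M\<^esub>j\<in>{..<r'}. b' j \<odot>\<^bsub>M\<^esub> y j)"
    using b' y by (intro M.finsum_cong') (auto simp: pb[symmetric])
  finally have "linear_relation R M r b u" using u rel by (simp add: linear_relation_def)
  then have "trivial_relation R M r b u" using triv by (simp add: relations_trivial_def)
  then have t1: "trivial_relation R M r' b' (\<lambda>j. \<Oplus>\<^bsub>M\<^esub>i\<in>{..<r}. q i j \<odot>\<^bsub>M\<^esub> u i)"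
  proof (rule trivial_relation_map)
    fix s assume s: "syzygy R r b s"
    then have sc: "\<And>i. i < r \<Longrightarrow> s i \<in> carrier R" by (simp add: syzygy_def)
    have "(\<Oplus>j\<in>{..<r'}. b' j \<otimes> (\<Oplus>i\<in>{..<r}. q i j \<otimes> s i))
        = (\<Oplus>i\<in>{..<r}. (\<Oplus>j\<in>{..<r'}. b' j \<otimes> q i j) \<otimes> s i)"
      using b' q sc by (intro sum_mult_swap) auto
    also have "\<dots> = (\<Oplus>i\<in>{..<r}. b i \<otimes> s i)"
      using b sc by (intro R.finsum_cong') (auto simp: qb[symmetric])
    finally show "syzygy R r' b' (\<lambda>j. \<Oplus>i\<in>{..<r}. q i j \<otimes> s i)"
      using s q sc by (auto simp: syzygy_def intro!: R.finsum_closed)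
  qed (use q in auto)
  \<comment> \<open>What remains of \<open>y\<close> is a combination of the columns of the identity minus the product of
     the two matrices, and these columns are syzygies.\<close>
  define g where "g k j = (\<Oplus>i\<in>{..<r}. q i j \<otimes> p k i)" for k j
  have g: "g k j \<in> carrier R" if "k < r'" "j < r'" for k j
    using p q that by (auto simp: g_def intro!: R.finsum_closed)
  have t2: "trivial_relation R M r' b' (\<lambda>j. \<Oplus>\<^bsub>M\<^esub>k\<in>{..<r'}. ((if k = j then \<one> else \<zero>) \<oplus> \<ominus> g k j) \<odot>\<^bsub>M\<^esub> y k)"
  proof (rule trivial_relation_sum[OF _ y refl])
    fix k assume k: "k < r'"
    have "(\<Oplus>j\<in>{..<r'}. b' j \<otimes> g k j) = (\<Oplus>i\<in>{..<r}. (\<Oplus>j\<in>{..<r'}. b' j \<otimes> q i j) \<otimes> p k i)"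
      unfolding g_def using b' q p k by (intro sum_mult_swap) auto
    also have "\<dots> = (\<Oplus>i\<in>{..<r}. b i \<otimes> p k i)"
      using b p k by (intro R.finsum_cong') (auto simp: qb[symmetric])
    finally have gk: "(\<Oplus>j\<in>{..<r'}. b' j \<otimes> g k j) = b' k" using pb[OF k] by simp
    have "(\<Oplus>j\<in>{..<r'}. b' j \<otimes> ((if k = j then \<one> else \<zero>) \<oplus> \<ominus> g k j))
        = (\<Oplus>j\<in>{..<r'}. b' j \<otimes> (if k = j then \<one> else \<zero>) \<oplus> \<ominus> \<one> \<otimes> (b' j \<otimes> g k j))"
      using b' g k by (intro R.finsum_cong') (auto simp: r_distr l_minus r_minus)
    also have "\<dots> = (\<Oplus>j\<in>{..<r'}. b' j \<otimes> (if k = j then \<one> else \<zero>)) \<oplus> (\<Oplus>j\<in>{..<r'}. \<ominus> \<one> \<otimes> (b' j \<otimes> g k j))"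
      using b' g k by (intro R.finsum_addf) auto
    also have "(\<Oplus>j\<in>{..<r'}. \<ominus> \<one> \<otimes> (b' j \<otimes> g k j)) = \<ominus> \<one> \<otimes> b' k"
      using b' g k by (subst gk[symmetric], subst R.finsum_rdistr) auto
    also have "(\<Oplus>j\<in>{..<r'}. b' j \<otimes> (if k = j then \<one> else \<zero>)) = b' k"
      using finsum_mult_delta[of "{..<r'}" k b' \<one>] b' k by simp
    finally show "syzygy R r' b' (\<lambda>j. (if k = j then \<one> else \<zero>) \<oplus> \<ominus> g k j)"
      using b' g k by (auto simp: syzygy_def l_minus R.r_neg)
  qed
  show "trivial_relation R M r' b' y"
  proof (rule trivial_relation_cong[OF trivial_relation_add[OF t1 t2]])
    fix j assume j: "j < r'"
    have gy: "(\<Oplus>\<^bsub>M\<^esub>k\<in>{..<r'}. g k j \<odot>\<^bsub>M\<^esub> y k) = (\<Oplus>\<^bsub>M\<^esub>i\<in>{..<r}. q i j \<odot>\<^bsub>M\<^esub> u i)"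
      unfolding g_def u_def
      using q p y j by (intro finsum_smult_swap[symmetric, of _ _ "\<lambda>i. q i j" "\<lambda>i k. p k i"]) auto
    have qu: "(\<Oplus>\<^bsub>M\<^esub>i\<in>{..<r}. q i j \<odot>\<^bsub>M\<^esub> u i) \<in> carrier M"
      using q u j by (auto intro!: M.finsum_closed)
    have "(\<Oplus>\<^bsub>M\<^esub>k\<in>{..<r'}. ((if k = j then \<one> else \<zero>) \<oplus> \<ominus> g k j) \<odot>\<^bsub>M\<^esub> y k)
        = (\<Oplus>\<^bsub>M\<^esub>k\<in>{..<r'}. (if k = j then \<one> else \<zero>) \<odot>\<^bsub>M\<^esub> y k \<oplus>\<^bsub>M\<^esub> \<ominus> \<one> \<odot>\<^bsub>M\<^esub> (g k j \<odot>\<^bsub>M\<^esub> y k))"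
      using g y j by (intro M.finsum_cong') (auto simp: smult_l_distr smult_l_minus)
    also have "\<dots> = (\<Oplus>\<^bsub>M\<^esub>k\<in>{..<r'}. (if k = j then \<one> else \<zero>) \<odot>\<^bsub>M\<^esub> y k)
        \<oplus>\<^bsub>M\<^esub> (\<Oplus>\<^bsub>M\<^esub>k\<in>{..<r'}. \<ominus> \<one> \<odot>\<^bsub>M\<^esub> (g k j \<odot>\<^bsub>M\<^esub> y k))"
      using g y j by (intro M.finsum_addf) auto
    also have "(\<Oplus>\<^bsub>M\<^esub>k\<in>{..<r'}. (if k = j then \<one> else \<zero>) \<odot>\<^bsub>M\<^esub> y k) = y j"
      using y j by (subst finsum_delta_smult) auto
    also have "(\<Oplus>\<^bsub>M\<^esub>k\<in>{..<r'}. \<ominus> \<one> \<odot>\<^bsub>M\<^esub> (g k j \<odot>\<^bsub>M\<^esub> y k)) = \<ominus>\<^bsub>M\<^esub> (\<Oplus>\<^bsub>M\<^esub>i\<in>{..<r}. q i j \<odot>\<^bsub>M\<^esub> u i)"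
      using g y j qu
      by (subst finsum_smult_ldistr[symmetric]) (auto simp: gy smult_l_minus)
    finally show "y j = (\<Oplus>\<^bsub>M\<^esub>k\<in>{..<r'}. ((if k = j then \<one> else \<zero>) \<oplus> \<ominus> g k j) \<odot>\<^bsub>M\<^esub> y k)
        \<oplus>\<^bsub>M\<^esub> (\<Oplus>\<^bsub>M\<^esub>i\<in>{..<r}. q i j \<odot>\<^bsub>M\<^esub> u i)"
      using y j qu by (simp add: M.a_assoc M.l_neg)
  qed
qed

lemma relations_trivial_generates:
  assumes "generates R r b J" "generates R r' b' J" "J \<subseteq> carrier R" "relations_trivial R M r b"
  shows "relations_trivial R M r' b'"
proof -
  have "\<exists>c. (\<forall>i<r. c i \<in> carrier R) \<and> b' j = (\<Oplus>i\<in>{..<r}. b i \<otimes> c i)" if "j < r'" for j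
    using assms(1,2) that unfolding generates_def by blast
  then obtain p where p: "\<And>j. j < r' \<Longrightarrow> (\<forall>i<r. p j i \<in> carrier R) \<and> b' j = (\<Oplus>i\<in>{..<r}. b i \<otimes> p j i)"
    by metis
  have "\<exists>c. (\<forall>i<r'. c i \<in> carrier R) \<and> b j = (\<Oplus>i\<in>{..<r'}. b' i \<otimes> c i)" if "j < r" for j
    using assms(1,2) that unfolding generates_def by blast
  then obtain q where q: "\<And>j. j < r \<Longrightarrow> (\<forall>i<r'. q j i \<in> carrier R) \<and> b j = (\<Oplus>i\<in>{..<r'}. b' i \<otimes> q j i)"
    by metis
  show ?thesis
    by (rule relations_trivial_change_generators[of r b r' b' p q])
      (use assms p q in \<open>auto simp: generates_def\<close>)
qed

text \<open>
  This is the exact sequence \<open>Tor\<^sub>1(R/(J:b\<^sub>0)) \<rightarrow> Tor\<^sub>1(R/J) \<rightarrow> Tor\<^sub>1(R/(J + b\<^sub>0))\<close> in coordinates: \<open>J\<close> is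
  generated by \<open>b\<close>, the colon ideal by \<open>d\<close>, the matrix \<open>F\<close> writes multiplication by \<open>b\<^sub>0\<close> from the
  colon ideal to \<open>J\<close> in these generators, and the last group is assumed to vanish.
\<close>

lemma relation_from_colon_ideal:
  assumes b: "\<And>i. i < r \<Longrightarrow> b i \<in> carrier R" and b0: "b0 \<in> carrier R"
    and d: "\<And>k. k < q \<Longrightarrow> d k \<in> carrier R"
    and F: "\<And>k i. k < q \<Longrightarrow> i < r \<Longrightarrow> F k i \<in> carrier R"
    and Fb: "\<And>k. k < q \<Longrightarrow> b0 \<otimes> d k = (\<Oplus>i\<in>{..<r}. b i \<otimes> F k i)"
    and colon: "\<And>c s. c \<in> carrier R \<Longrightarrow> \<forall>i<r. s i \<in> carrier R \<Longrightarrow> (\<Oplus>i\<in>{..<r}. b i \<otimes> s i) \<oplus> b0 \<otimes> c = \<zero> \<Longrightarrow>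
        \<exists>e. (\<forall>k<q. e k \<in> carrier R) \<and> c = (\<Oplus>k\<in>{..<q}. d k \<otimes> e k)"
    and triv: "relations_trivial R M (Suc r) (b(r := b0))"
    and y: "linear_relation R M r b y"
  obtains v where "linear_relation R M q d v"
    "trivial_relation R M r b (\<lambda>i. y i \<oplus>\<^bsub>M\<^esub> (\<Oplus>\<^bsub>M\<^esub>k\<in>{..<q}. F k i \<odot>\<^bsub>M\<^esub> v k))"
proof -
  have split: "(\<Oplus>i\<in>{..<Suc r}. (b(r := b0)) i \<otimes> s i) = (\<Oplus>i\<in>{..<r}. b i \<otimes> s i) \<oplus> b0 \<otimes> s r"
    if "\<And>i. i < Suc r \<Longrightarrow> s i \<in> carrier R" for s
  proof -
    have "(\<Oplus>i\<in>{..<Suc r}. (b(r := b0)) i \<otimes> s i) = (\<Oplus>i\<in>{..<r}. (b(r := b0)) i \<otimes> s i) \<oplus> b0 \<otimes> s r"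
      using b b0 that by (subst R.finsum_lessThan_Suc) (auto simp: less_Suc_eq_le[symmetric] less_Suc_eq)
    also have "(\<Oplus>i\<in>{..<r}. (b(r := b0)) i \<otimes> s i) = (\<Oplus>i\<in>{..<r}. b i \<otimes> s i)"
      using b that by (intro R.finsum_cong') auto
    finally show ?thesis .
  qed
  \<comment> \<open>For every trivial relation \<open>Y\<close> on the generators of \<open>J + b\<^sub>0\<close>, the last coordinate is expressed in
     the colon ideal, and eliminating it leaves a trivial relation on the generators of \<open>J\<close>.\<close>
  have "\<exists>v. (\<forall>k<q. v k \<in> carrier M) \<and> Y r = (\<Oplus>\<^bsub>M\<^esub>k\<in>{..<q}. d k \<odot>\<^bsub>M\<^esub> v k) \<and>
      trivial_relation R M r b (\<lambda>i. Y i \<oplus>\<^bsub>M\<^esub> (\<Oplus>\<^bsub>M\<^esub>k\<in>{..<q}. F k i \<odot>\<^bsub>M\<^esub> v k))"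
    if "trivial_relation R M (Suc r) (b(r := b0)) Y" for Y
    using that
  proof induction
    case (zero Y)
    then show ?case using d F
      by (intro exI[of _ "\<lambda>_. \<zero>\<^bsub>M\<^esub>"])
        (auto intro!: trivial_relation.zero M.add.finprod_one_eqI M.add.finprod_one_eqI[symmetric]
          simp: M.add.finprod_one_eqI)
  next
    case (add_syzygy Y s z Y')
    then obtain v where v: "\<forall>k<q. v k \<in> carrier M" "Y r = (\<Oplus>\<^bsub>M\<^esub>k\<in>{..<q}. d k \<odot>\<^bsub>M\<^esub> v k)"
      "trivial_relation R M r b (\<lambda>i. Y i \<oplus>\<^bsub>M\<^esub> (\<Oplus>\<^bsub>M\<^esub>k\<in>{..<q}. F k i \<odot>\<^bsub>M\<^esub> v k))" by blast
    have s: "\<And>i. i < Suc r \<Longrightarrow> s i \<in> carrier R" and z: "z \<in> carrier M"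
      and bs: "(\<Oplus>i\<in>{..<r}. b i \<otimes> s i) \<oplus> b0 \<otimes> s r = \<zero>"
      using add_syzygy.hyps split[of s] by (auto simp: syzygy_def)
    have Y: "\<And>i. i < Suc r \<Longrightarrow> Y i \<in> carrier M"
      using trivial_relation_closed[OF add_syzygy.hyps(1)] .
    obtain e where e: "\<forall>k<q. e k \<in> carrier R" "s r = (\<Oplus>k\<in>{..<q}. d k \<otimes> e k)"
      using colon[OF _ _ bs] s by auto
    define s' where "s' i = s i \<oplus> (\<Oplus>k\<in>{..<q}. F k i \<otimes> e k)" for i
    have Fe: "(\<Oplus>k\<in>{..<q}. F k i \<otimes> e k) \<in> carrier R" if "i < r" for i
      using F e that by (auto intro!: R.finsum_closed)
    have s': "syzygy R r b s'"
      unfolding syzygy_def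
    proof (intro conjI allI impI)
      show "s' i \<in> carrier R" if "i < r" for i using s Fe that by (auto simp: s'_def)
      have "(\<Oplus>i\<in>{..<r}. b i \<otimes> s' i) = (\<Oplus>i\<in>{..<r}. b i \<otimes> s i \<oplus> b i \<otimes> (\<Oplus>k\<in>{..<q}. F k i \<otimes> e k))"
        using b s Fe by (intro R.finsum_cong') (auto simp: s'_def r_distr)
      also have "\<dots> = (\<Oplus>i\<in>{..<r}. b i \<otimes> s i) \<oplus> (\<Oplus>i\<in>{..<r}. b i \<otimes> (\<Oplus>k\<in>{..<q}. F k i \<otimes> e k))"
        using b s Fe by (intro R.finsum_addf) auto
      also have "(\<Oplus>i\<in>{..<r}. b i \<otimes> (\<Oplus>k\<in>{..<q}. F k i \<otimes> e k)) = (\<Oplus>k\<in>{..<q}. (\<Oplus>i\<in>{..<r}. b i \<otimes> F k i) \<otimes> e k)"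
        using b F e by (intro sum_mult_swap) auto
      also have "\<dots> = (\<Oplus>k\<in>{..<q}. b0 \<otimes> (d k \<otimes> e k))"
        using b0 d e by (intro R.finsum_cong') (auto simp: Fb[symmetric] m_assoc)
      also have "\<dots> = b0 \<otimes> s r"
        using b0 d e by (simp add: R.finsum_rdistr Pi_def)
      finally show "(\<Oplus>i\<in>{..<r}. b i \<otimes> s' i) = \<zero>" using bs by simp
    qed
    define v' where "v' k = v k \<oplus>\<^bsub>M\<^esub> e k \<odot>\<^bsub>M\<^esub> z" for k
    have sum: "(\<Oplus>\<^bsub>M\<^esub>k\<in>{..<q}. f k \<odot>\<^bsub>M\<^esub> v' k)
        = (\<Oplus>\<^bsub>M\<^esub>k\<in>{..<q}. f k \<odot>\<^bsub>M\<^esub> v k) \<oplus>\<^bsub>M\<^esub> (\<Oplus>k\<in>{..<q}. f k \<otimes> e k) \<odot>\<^bsub>M\<^esub> z"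
      if "\<And>k. k < q \<Longrightarrow> f k \<in> carrier R" for f
      unfolding v'_def using v e z that by (intro finsum_smult_add_smult) auto
    have "Y' r = (\<Oplus>\<^bsub>M\<^esub>k\<in>{..<q}. d k \<odot>\<^bsub>M\<^esub> v' k)"
      using sum[of d] d add_syzygy.hyps(4)[of r] v(2) e(2) by simp
    moreover have "trivial_relation R M r b (\<lambda>i. Y' i \<oplus>\<^bsub>M\<^esub> (\<Oplus>\<^bsub>M\<^esub>k\<in>{..<q}. F k i \<odot>\<^bsub>M\<^esub> v' k))"
    proof (rule trivial_relation.add_syzygy[OF v(3) s' z])
      fix i assume i: "i < r"
      have "(\<Oplus>\<^bsub>M\<^esub>k\<in>{..<q}. F k i \<odot>\<^bsub>M\<^esub> v k) \<in> carrier M"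
        using F v i by (auto intro!: M.finsum_closed)
      then show "Y' i \<oplus>\<^bsub>M\<^esub> (\<Oplus>\<^bsub>M\<^esub>k\<in>{..<q}. F k i \<odot>\<^bsub>M\<^esub> v' k)
          = Y i \<oplus>\<^bsub>M\<^esub> (\<Oplus>\<^bsub>M\<^esub>k\<in>{..<q}. F k i \<odot>\<^bsub>M\<^esub> v k) \<oplus>\<^bsub>M\<^esub> s' i \<odot>\<^bsub>M\<^esub> z"
        using add_syzygy.hyps(4)[of i] sum[of "\<lambda>k. F k i"] F i s[of i] z Fe Y[of i]
        by (simp add: s'_def smult_l_distr M.a_ac)
    qed
    moreover have "\<forall>k<q. v' k \<in> carrier M" using v e z by (simp add: v'_def)
    ultimately show ?case by blast
  qed
  \<comment> \<open>The relation \<open>y\<close>, extended by zero, is of this kind because \<open>Tor\<^sub>1\<close> vanishes for \<open>J + b\<^sub>0\<close>.\<close>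
  moreover have "trivial_relation R M (Suc r) (b(r := b0)) (y(r := \<zero>\<^bsub>M\<^esub>))"
  proof -
    have yc: "\<And>i. i < r \<Longrightarrow> y i \<in> carrier M" using y by (simp add: linear_relation_def)
    have "(\<Oplus>\<^bsub>M\<^esub>i\<in>{..<Suc r}. (b(r := b0)) i \<odot>\<^bsub>M\<^esub> (y(r := \<zero>\<^bsub>M\<^esub>)) i)
        = (\<Oplus>\<^bsub>M\<^esub>i\<in>{..<r}. (b(r := b0)) i \<odot>\<^bsub>M\<^esub> (y(r := \<zero>\<^bsub>M\<^esub>)) i) \<oplus>\<^bsub>M\<^esub> b0 \<odot>\<^bsub>M\<^esub> \<zero>\<^bsub>M\<^esub>"
      using b b0 yc by (subst M.finsum_lessThan_Suc) (auto simp: less_Suc_eq_le[symmetric] less_Suc_eq)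
    also have "(\<Oplus>\<^bsub>M\<^esub>i\<in>{..<r}. (b(r := b0)) i \<odot>\<^bsub>M\<^esub> (y(r := \<zero>\<^bsub>M\<^esub>)) i) = (\<Oplus>\<^bsub>M\<^esub>i\<in>{..<r}. b i \<odot>\<^bsub>M\<^esub> y i)"
      using b yc by (intro M.finsum_cong') auto
    finally have "linear_relation R M (Suc r) (b(r := b0)) (y(r := \<zero>\<^bsub>M\<^esub>))"
      using y b0 by (auto simp: linear_relation_def less_Suc_eq)
    then show ?thesis using triv by (simp add: relations_trivial_def)
  qed
  ultimately obtain v where v: "\<forall>k<q. v k \<in> carrier M"
    "(y(r := \<zero>\<^bsub>M\<^esub>)) r = (\<Oplus>\<^bsub>M\<^esub>k\<in>{..<q}. d k \<odot>\<^bsub>M\<^esub> v k)"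
    "trivial_relation R M r b (\<lambda>i. (y(r := \<zero>\<^bsub>M\<^esub>)) i \<oplus>\<^bsub>M\<^esub> (\<Oplus>\<^bsub>M\<^esub>k\<in>{..<q}. F k i \<odot>\<^bsub>M\<^esub> v k))" by blast
  show ?thesis
  proof (rule that)
    show "linear_relation R M q d v" using v by (simp add: linear_relation_def)
    show "trivial_relation R M r b (\<lambda>i. y i \<oplus>\<^bsub>M\<^esub> (\<Oplus>\<^bsub>M\<^esub>k\<in>{..<q}. F k i \<odot>\<^bsub>M\<^esub> v k))"
      by (rule trivial_relation_cong[OF v(3)]) simp
  qed
qed

end

lemma (in cring) colon_ideal:
  assumes "ideal J R" "b \<in> carrier R"
  shows "ideal {c \<in> carrier R. b \<otimes> c \<in> J} R"
proof -
  interpret J: ideal J R by fact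
  have swap: "b \<otimes> (x \<otimes> a) = x \<otimes> (b \<otimes> a)" if "a \<in> carrier R" "x \<in> carrier R" for a x
    using assms(2) that by (simp add: m_lcomm)
  show ?thesis
  proof (rule idealI)
    show "subgroup {c \<in> carrier R. b \<otimes> c \<in> J} (add_monoid R)"
    proof (rule add.subgroupI)
      show "{c \<in> carrier R. b \<otimes> c \<in> J} \<noteq> {}" using assms(2) by (auto intro!: exI[of _ \<zero>])
    qed (use assms(2) in \<open>auto simp: r_minus r_distr\<close>)
    fix a x assume a: "a \<in> {c \<in> carrier R. b \<otimes> c \<in> J}" "x \<in> carrier R"
    then show "x \<otimes> a \<in> {c \<in> carrier R. b \<otimes> c \<in> J}"
      using swap by (auto intro: J.I_l_closed)
    then show "a \<otimes> x \<in> {c \<in> carrier R. b \<otimes> c \<in> J}"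
      using a by (simp add: m_comm)
  qed (rule ring_axioms)
qed

lemma (in ideal) linear_combination_in_ideal:
  assumes "cring R" "finite S" "\<And>i. i \<in> S \<Longrightarrow> b i \<in> I" "\<And>i. i \<in> S \<Longrightarrow> c i \<in> carrier R"
  shows "(\<Oplus>i\<in>S. b i \<otimes> c i) \<in> I"
  using assms(2-)
proof (induction S)
  case (insert x S)
  then show ?case
    by (subst finsum_insert) (auto intro!: a_closed I_r_closed simp: Icarr)
qed simp

lemma noetherian_maximal_member:
  assumes noeth: "noetherian_ring R" and ne: "F \<noteq> {}" and ideals: "F \<subseteq> {J. ideal J R}"
  obtains J where "J \<in> F" "\<And>K. K \<in> F \<Longrightarrow> J \<subseteq> K \<Longrightarrow> K = J"
proof -
  have "\<Union>C \<in> F" if "C \<noteq> {}" "subset.chain F C" for C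
  proof -
    have "subset.chain {J. ideal J R} C" using that(2) ideals unfolding subset_chain_def by blast
    then have "\<Union>C \<in> C" by (rule noetherian_ring.ideal_chain_is_trivial[OF noeth that(1)])
    then show ?thesis using that(2) unfolding subset_chain_def by blast
  qed
  with ne have "\<exists>J\<in>F. \<forall>K\<in>F. J \<subseteq> K \<longrightarrow> K = J" by (intro subset_Zorn_nonempty)
  then show ?thesis using that by blast
qed

context module
begin

lemma relations_trivial_unit_ideal:
  assumes "generates R r b (carrier R)"
  shows "relations_trivial R M r b"
proof (rule relations_trivial_generates[OF _ assms])
  have one: "(\<Oplus>i\<in>{..<Suc 0}. \<one> \<otimes> c i) = c 0" if "c 0 \<in> carrier R" for c
    using that by (subst R.finsum_lessThan_Suc) (auto simp: R.finsum_empty)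
  show "generates R 1 (\<lambda>_. \<one>) (carrier R)"
    unfolding generates_def
  proof (intro conjI ballI)
    fix x assume "x \<in> carrier R"
    then show "\<exists>c. (\<forall>i<1::nat. c i \<in> carrier R) \<and> x = (\<Oplus>i\<in>{..<1}. \<one> \<otimes> c i)"
      using one[of "\<lambda>_. x"] by (auto intro!: exI[of _ "\<lambda>_. x"])
  qed simp
  show "relations_trivial R M 1 (\<lambda>_. \<one>)"
    unfolding relations_trivial_def
    by (auto simp: linear_relation_def lessThan_Suc intro!: trivial_relation.zero)
qed simp

lemma exists_maximal_ideal_with_nontrivial_relation:
  assumes noeth: "noetherian_ring R"
    and b: "\<And>i. i < r \<Longrightarrow> b i \<in> carrier R" and nontriv: "\<not> relations_trivial R M r b"
  obtains J r' b' where "ideal J R" "generates R r' b' J" "\<not> relations_trivial R M r' b'"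
    "\<And>J' q d. ideal J' R \<Longrightarrow> J \<subset> J' \<Longrightarrow> generates R q d J' \<Longrightarrow> relations_trivial R M q d"
proof -
  let ?B = "{J. ideal J R \<and> (\<exists>r b. generates R r b J \<and> \<not> relations_trivial R M r b)}"
  have "Idl (b ` {..<r}) \<in> ?B"
    using genideal_generates[of r b] genideal_ideal[of "b ` {..<r}"] b nontriv by blast
  then have "?B \<noteq> {}" by blast
  then obtain J where J: "J \<in> ?B" "\<And>K. K \<in> ?B \<Longrightarrow> J \<subseteq> K \<Longrightarrow> K = J"
    by (rule noetherian_maximal_member[OF noeth]) blast+
  from J(1) obtain r' b' where "generates R r' b' J" "\<not> relations_trivial R M r' b'" by blast
  moreover have "relations_trivial R M q d" if "ideal J' R" "J \<subset> J'" "generates R q d J'" for J' q d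
  proof (rule ccontr)
    assume "\<not> relations_trivial R M q d"
    then have "J' \<in> ?B" using that by blast
    then show False using J(2)[of J'] that(2) by blast
  qed
  ultimately show ?thesis using that J(1) by blast
qed

text \<open>
  An ideal \<open>J\<close> maximal among those with a nontrivial relation would satisfy \<open>(J : b\<^sub>0) = J\<close> for every
  \<open>b\<^sub>0\<close> outside \<open>J\<close>, since otherwise both outer terms of the exact sequence in
  \<open>relation_from_colon_ideal\<close> vanish. It does not contain \<open>n\<close>, so some \<open>p\<close> in \<open>P\<close> lies outside
  \<open>J\<close>, and then the same exact sequence says that \<open>p\<close> acts surjectively on relations modulo trivial
  ones. Hypothesis \<open>nakayama\<close> excludes this.
\<close>

lemma relations_trivial_from_closed_point:
  assumes noeth: "noetherian_ring R" and n: "maximalideal n R" and P: "n = Idl P" "P \<subseteq> carrier R"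
    and base: "generates R r0 g n" "relations_trivial R M r0 g"
    and nakayama: "\<And>r b p. \<lbrakk>\<And>i. i < r \<Longrightarrow> b i \<in> carrier R; p \<in> P;
        \<And>y. linear_relation R M r b y \<Longrightarrow> \<exists>v. linear_relation R M r b v \<and>
          trivial_relation R M r b (\<lambda>i. y i \<oplus>\<^bsub>M\<^esub> p \<odot>\<^bsub>M\<^esub> v i)\<rbrakk> \<Longrightarrow> relations_trivial R M r b"
    and b: "\<And>i. i < r \<Longrightarrow> b i \<in> carrier R"
  shows "relations_trivial R M r b"
proof (rule ccontr)
  assume "\<not> ?thesis"
  with noeth b obtain J r b where J: "ideal J R" and gen: "generates R r b J"
    and nontriv: "\<not> relations_trivial R M r b"
    and above: "\<And>J' q d. ideal J' R \<Longrightarrow> J \<subset> J' \<Longrightarrow> generates R q d J' \<Longrightarrow> relations_trivial R M q d"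
    using exists_maximal_ideal_with_nontrivial_relation by blast
  interpret J: ideal J R by fact
  have bJ: "\<And>i. i < r \<Longrightarrow> b i \<in> J" and bc: "\<And>i. i < r \<Longrightarrow> b i \<in> carrier R"
    using gen J.Icarr by (auto simp: generates_def)
  have combJ: "(\<Oplus>i\<in>{..<r}. b i \<otimes> s i) \<in> J" if "\<forall>i<r. s i \<in> carrier R" for s
    using J.linear_combination_in_ideal[OF is_cring, of "{..<r}" b s] bJ that by auto
  have adjoin: "relations_trivial R M (Suc r) (b(r := b0))" if b0: "b0 \<in> carrier R" "b0 \<notin> J" for b0
  proof (rule above)
    let ?S = "(b(r := b0)) ` {..<Suc r}"
    have c: "(b(r := b0)) i \<in> carrier R" if "i < Suc r" for i using bc b0 that by (auto simp: less_Suc_eq)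
    then have S: "?S \<subseteq> carrier R" by blast
    show K: "ideal (Idl ?S) R" by (rule genideal_ideal[OF S])
    show "generates R (Suc r) (b(r := b0)) (Idl ?S)"
      by (rule genideal_generates) (rule c)
    have in_K: "(b(r := b0)) i \<in> Idl ?S" if "i < Suc r" for i
      using genideal_self[OF S] that by blast
    have "J \<subseteq> Idl ?S"
    proof
      fix x assume "x \<in> J"
      then obtain s where s: "\<forall>i<r. s i \<in> carrier R" "x = (\<Oplus>i\<in>{..<r}. b i \<otimes> s i)"
        using gen unfolding generates_def by blast
      have "b i \<in> Idl ?S" if "i < r" for i using in_K[of i] that by simp
      then show "x \<in> Idl ?S"
        using ideal.linear_combination_in_ideal[OF K is_cring, of "{..<r}" b s] s by simp
    qed
    moreover have "b0 \<in> Idl ?S" using in_K[of r] by simp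
    ultimately show "J \<subset> Idl ?S" using b0 by blast
  qed
  \<comment> \<open>A relation with last coefficient \<open>c\<close> puts \<open>c\<close> into the colon ideal.\<close>
  have last: "b0 \<otimes> c \<in> J"
    if "b0 \<in> carrier R" "c \<in> carrier R" "\<forall>i<r. s i \<in> carrier R" "(\<Oplus>i\<in>{..<r}. b i \<otimes> s i) \<oplus> b0 \<otimes> c = \<zero>"
    for b0 c s
  proof -
    have "b0 \<otimes> c = \<ominus> (\<Oplus>i\<in>{..<r}. b i \<otimes> s i)"
      using that combJ[OF that(3)] J.Icarr by (metis R.m_closed R.minus_equality R.a_comm)
    then show ?thesis using combJ[OF that(3)] by simp
  qed
  have colon: "{c \<in> carrier R. b0 \<otimes> c \<in> J} = J" if b0: "b0 \<in> carrier R" "b0 \<notin> J" for b0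
  proof (rule ccontr)
    let ?Q = "{c \<in> carrier R. b0 \<otimes> c \<in> J}"
    assume "?Q \<noteq> J"
    moreover have "J \<subseteq> ?Q" using b0 J.Icarr J.I_l_closed by blast
    ultimately have "J \<subset> ?Q" by blast
    have Q: "ideal ?Q R" by (rule colon_ideal[OF J b0(1)])
    then obtain q d where d: "generates R q d ?Q" using noetherian_generators[OF noeth is_cring] by blast
    then have triv_d: "relations_trivial R M q d" using above[OF Q \<open>J \<subset> ?Q\<close>] by blast
    have dQ: "d k \<in> ?Q" if "k < q" for k using d that unfolding generates_def by blast
    have "\<exists>c. (\<forall>i<r. c i \<in> carrier R) \<and> b0 \<otimes> d k = (\<Oplus>i\<in>{..<r}. b i \<otimes> c i)" if "k < q" for k
      using gen dQ[OF that] unfolding generates_def by blast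
    then obtain F where F: "\<And>k. k < q \<Longrightarrow> (\<forall>i<r. F k i \<in> carrier R) \<and> b0 \<otimes> d k = (\<Oplus>i\<in>{..<r}. b i \<otimes> F k i)"
      by metis
    have "trivial_relation R M r b y" if y: "linear_relation R M r b y" for y
    proof -
      have yc: "\<And>i. i < r \<Longrightarrow> y i \<in> carrier M" using y by (simp add: linear_relation_def)
      obtain v where v: "linear_relation R M q d v"
        and yv: "trivial_relation R M r b (\<lambda>i. y i \<oplus>\<^bsub>M\<^esub> (\<Oplus>\<^bsub>M\<^esub>k\<in>{..<q}. F k i \<odot>\<^bsub>M\<^esub> v k))"
      proof (rule relation_from_colon_ideal[OF bc b0(1) _ _ _ _ adjoin[OF b0] y])
        show "\<exists>e. (\<forall>k<q. e k \<in> carrier R) \<and> c = (\<Oplus>k\<in>{..<q}. d k \<otimes> e k)"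
          if "c \<in> carrier R" "\<forall>i<r. s i \<in> carrier R" "(\<Oplus>i\<in>{..<r}. b i \<otimes> s i) \<oplus> b0 \<otimes> c = \<zero>" for c s
          using last[OF b0(1) that] that(1) d unfolding generates_def by blast
      qed (use F dQ in auto)
      have vc: "\<And>k. k < q \<Longrightarrow> v k \<in> carrier M" using v by (simp add: linear_relation_def)
      have "trivial_relation R M q d v" using triv_d v by (simp add: relations_trivial_def)
      then have Fv: "trivial_relation R M r b (\<lambda>i. \<Oplus>\<^bsub>M\<^esub>k\<in>{..<q}. F k i \<odot>\<^bsub>M\<^esub> v k)"
      proof (rule trivial_relation_map)
        fix s assume s: "syzygy R q d s"
        then have sc: "\<And>k. k < q \<Longrightarrow> s k \<in> carrier R" by (simp add: syzygy_def)
        have "(\<Oplus>i\<in>{..<r}. b i \<otimes> (\<Oplus>k\<in>{..<q}. F k i \<otimes> s k)) = (\<Oplus>k\<in>{..<q}. (\<Oplus>i\<in>{..<r}. b i \<otimes> F k i) \<otimes> s k)"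
          using bc F sc by (intro sum_mult_swap) auto
        also have "\<dots> = (\<Oplus>k\<in>{..<q}. b0 \<otimes> (d k \<otimes> s k))"
          using b0 dQ F sc by (intro R.finsum_cong') (auto simp: m_assoc[symmetric])
        also have "\<dots> = b0 \<otimes> (\<Oplus>k\<in>{..<q}. d k \<otimes> s k)"
          using b0 dQ sc by (intro R.finsum_rdistr[symmetric]) auto
        finally show "syzygy R r b (\<lambda>i. \<Oplus>k\<in>{..<q}. F k i \<otimes> s k)"
          using s F sc b0 by (auto simp: syzygy_def intro!: R.finsum_closed)
      qed (use F in auto)
      show ?thesis
      proof (rule trivial_relation_cong[OF trivial_relation_add[OF trivial_relation_minus[OF Fv] yv]])
        fix i assume "i < r"
        moreover from this have "(\<Oplus>\<^bsub>M\<^esub>k\<in>{..<q}. F k i \<odot>\<^bsub>M\<^esub> v k) \<in> carrier M"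
          using F vc by (auto intro!: M.finsum_closed)
        ultimately show "y i = y i \<oplus>\<^bsub>M\<^esub> (\<Oplus>\<^bsub>M\<^esub>k\<in>{..<q}. F k i \<odot>\<^bsub>M\<^esub> v k) \<oplus>\<^bsub>M\<^esub> \<ominus>\<^bsub>M\<^esub> (\<Oplus>\<^bsub>M\<^esub>k\<in>{..<q}. F k i \<odot>\<^bsub>M\<^esub> v k)"
          using yc by (simp add: M.a_assoc M.r_neg)
      qed
    qed
    then show False using nontriv by (simp add: relations_trivial_def)
  qed
  have "\<not> P \<subseteq> J"
  proof
    assume "P \<subseteq> J"
    then have "n \<subseteq> J" unfolding P(1) by (rule genideal_minimal[OF J])
    then have "J = n \<or> J = carrier R"
      using maximalideal.I_maximal[OF n J] J.a_subset by blast
    then show False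
    proof
      assume "J = carrier R"
      then show False using relations_trivial_unit_ideal gen nontriv by blast
    next
      assume "J = n"
      then show False
        using relations_trivial_generates[OF base(1) _ _ base(2)] gen nontriv J.a_subset by blast
    qed
  qed
  then obtain p where p: "p \<in> P" "p \<notin> J" by blast
  then have pc: "p \<in> carrier R" using P(2) by blast
  have "relations_trivial R M r b"
  proof (rule nakayama[OF bc p(1)])
    fix y assume y: "linear_relation R M r b y"
    have delta: "(\<Oplus>i\<in>{..<r}. b i \<otimes> (if k = i then p else \<zero>)) = p \<otimes> b k" if "k < r" for k
      using finsum_mult_delta[of "{..<r}" k b p] bc pc that by (simp add: m_comm)
    obtain v where v: "linear_relation R M r b v"
      and yv: "trivial_relation R M r b (\<lambda>i. y i \<oplus>\<^bsub>M\<^esub> (\<Oplus>\<^bsub>M\<^esub>k\<in>{..<r}. (if k = i then p else \<zero>) \<odot>\<^bsub>M\<^esub> v k))"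
    proof (rule relation_from_colon_ideal[of r b p r b "\<lambda>k i. if k = i then p else \<zero>" y])
      show "\<exists>e. (\<forall>k<r. e k \<in> carrier R) \<and> c = (\<Oplus>k\<in>{..<r}. b k \<otimes> e k)"
        if "c \<in> carrier R" "\<forall>i<r. s i \<in> carrier R" "(\<Oplus>i\<in>{..<r}. b i \<otimes> s i) \<oplus> p \<otimes> c = \<zero>" for c s
      proof -
        have "c \<in> J" using last[OF pc that] that(1) colon[OF pc p(2)] by blast
        then show ?thesis using gen unfolding generates_def by blast
      qed
    qed (use adjoin[OF pc p(2)] y pc bc delta in auto)
    have vc: "\<And>k. k < r \<Longrightarrow> v k \<in> carrier M" using v by (simp add: linear_relation_def)
    have "trivial_relation R M r b (\<lambda>i. y i \<oplus>\<^bsub>M\<^esub> p \<odot>\<^bsub>M\<^esub> v i)"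
      by (rule trivial_relation_cong[OF yv]) (subst finsum_delta_smult, use vc pc in auto)
    with v show "\<exists>v. linear_relation R M r b v \<and> trivial_relation R M r b (\<lambda>i. y i \<oplus>\<^bsub>M\<^esub> p \<odot>\<^bsub>M\<^esub> v i)"
      by blast
  qed
  with nontriv show False by contradiction
qed

end

section \<open>The equational criterion for flatness\<close>

text \<open>
  The equational form of flatness; \<open>equationally_flat_exact\<close> below derives the exactness of tensored
  sequences from it.
\<close>

definition equationally_flat :: "('r, 'c) ring_scheme \<Rightarrow> ('r, 'n, 'd) module_scheme \<Rightarrow> bool"
  where "equationally_flat R N \<longleftrightarrow>
    (\<forall>r b. (\<forall>i<r. b i \<in> carrier R) \<longrightarrow> relations_trivial R N r b)"

context module
begin

text \<open>
  Over an equationally flat module, finitely many elements can be written in coordinates that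
  satisfy any given finite list of their linear relations. The relations are imposed one at a time:
  each becomes a single relation among the current coordinate vectors, and it is trivial.
\<close>

lemma compatible_coordinates:
  assumes flat: "equationally_flat R M"
    and S: "finite S" "S \<subseteq> carrier M" and L: "finite L"
    and rel: "\<And>k b n. (k, b, n) \<in> L \<Longrightarrow> linear_relation R M k b n \<and> (\<forall>i<k. b i \<in> carrier R)"
  obtains t w a where "\<And>j. j < t \<Longrightarrow> w j \<in> carrier M" "\<And>j x. j < t \<Longrightarrow> a j x \<in> carrier R"
    "\<And>x. x \<in> S \<Longrightarrow> x = (\<Oplus>\<^bsub>M\<^esub>j\<in>{..<t::nat}. a j x \<odot>\<^bsub>M\<^esub> w j)"
    "\<And>k b n j. (k, b, n) \<in> L \<Longrightarrow> j < t \<Longrightarrow> syzygy R k b (\<lambda>i. a j (n i))"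
proof -
  define S' where "S' = S \<union> (\<Union>(k, b, n)\<in>L. n ` {..<k})"
  have S'fin: "finite S'" using S L by (auto simp: S'_def)
  have S'sub: "S' \<subseteq> carrier M" using S rel by (fastforce simp: S'_def linear_relation_def)
  have "\<exists>t w a. (\<forall>j<t. w j \<in> carrier M) \<and> (\<forall>j<t. \<forall>x. a j x \<in> carrier R) \<and>
      (\<forall>x\<in>S'. x = (\<Oplus>\<^bsub>M\<^esub>j\<in>{..<t::nat}. a j x \<odot>\<^bsub>M\<^esub> w j)) \<and>
      (\<forall>(k, b, n)\<in>L'. \<forall>j<t. syzygy R k b (\<lambda>i. a j (n i)))" if "L' \<subseteq> L" for L'
    using finite_subset[OF that L] that
  proof (induction L')
    case empty
    obtain h where h: "bij_betw h {..<card S'} S'"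
      using ex_bij_betw_nat_finite[OF S'fin] by (auto simp: atLeast0LessThan)
    have hc: "h j \<in> carrier M" if "j < card S'" for j
      using h S'sub that by (auto simp: bij_betw_def)
    have "x = (\<Oplus>\<^bsub>M\<^esub>j\<in>{..<card S'}. (if x = h j then \<one> else \<zero>) \<odot>\<^bsub>M\<^esub> h j)" if "x \<in> S'" for x
    proof -
      obtain j where j: "j < card S'" "x = h j" using h \<open>x \<in> S'\<close> by (auto simp: bij_betw_def)
      have "(\<Oplus>\<^bsub>M\<^esub>i\<in>{..<card S'}. (if x = h i then \<one> else \<zero>) \<odot>\<^bsub>M\<^esub> h i)
          = (\<Oplus>\<^bsub>M\<^esub>i\<in>{..<card S'}. (if i = j then \<one> else \<zero>) \<odot>\<^bsub>M\<^esub> h i)"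
        using j h hc by (intro M.finsum_cong') (auto simp: bij_betw_def inj_on_def)
      also have "\<dots> = \<one> \<odot>\<^bsub>M\<^esub> h j" using j hc by (intro finsum_delta_smult) auto
      finally show ?thesis using j hc by simp
    qed
    then show ?case using hc
      by (intro exI[of _ "card S'"] exI[of _ h] exI[of _ "\<lambda>j x. if x = h j then \<one> else \<zero>"]) auto
  next
    case (insert l L')
    then obtain t w a where w: "\<And>j. j < t \<Longrightarrow> w j \<in> carrier M" and a: "\<And>j x. j < t \<Longrightarrow> a j x \<in> carrier R"
      and S'eq: "\<And>x. x \<in> S' \<Longrightarrow> x = (\<Oplus>\<^bsub>M\<^esub>j\<in>{..<t::nat}. a j x \<odot>\<^bsub>M\<^esub> w j)"
      and L': "\<And>k b n j. (k, b, n) \<in> L' \<Longrightarrow> j < t \<Longrightarrow> syzygy R k b (\<lambda>i. a j (n i))"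
      by auto blast
    obtain k b n where l: "l = (k, b, n)" by (cases l)
    have kbn: "linear_relation R M k b n" "\<And>i. i < k \<Longrightarrow> b i \<in> carrier R" "\<And>i. i < k \<Longrightarrow> n i \<in> S'"
      using rel[of k b n] insert.prems unfolding l S'_def by (auto intro!: bexI[of _ "(k, b, n)"])
    define c where "c j = (\<Oplus>i\<in>{..<k}. b i \<otimes> a j (n i))" for j
    have c: "c j \<in> carrier R" if "j < t" for j
      using kbn a that by (auto simp: c_def intro!: R.finsum_closed)
    have "(\<Oplus>\<^bsub>M\<^esub>j\<in>{..<t}. c j \<odot>\<^bsub>M\<^esub> w j)
        = (\<Oplus>\<^bsub>M\<^esub>i\<in>{..<k}. b i \<odot>\<^bsub>M\<^esub> (\<Oplus>\<^bsub>M\<^esub>j\<in>{..<t}. a j (n i) \<odot>\<^bsub>M\<^esub> w j))"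
      unfolding c_def using kbn(2) a w
      by (intro finsum_smult_swap[symmetric, of _ _ b "\<lambda>i j. a j (n i)"]) auto
    also have "\<dots> = (\<Oplus>\<^bsub>M\<^esub>i\<in>{..<k}. b i \<odot>\<^bsub>M\<^esub> n i)"
      using kbn S'sub by (intro M.finsum_cong') (auto simp: S'eq[symmetric])
    finally have "linear_relation R M t c w"
      using kbn(1) w by (simp add: linear_relation_def)
    then have "trivial_relation R M t c w"
      using flat c unfolding equationally_flat_def relations_trivial_def by blast
    then obtain t' s z where s: "\<And>l. l < t' \<Longrightarrow> syzygy R t c (s l)" and z: "\<And>l. l < t' \<Longrightarrow> z l \<in> carrier M"
      and wz: "\<And>j. j < t \<Longrightarrow> w j = (\<Oplus>\<^bsub>M\<^esub>l\<in>{..<t'::nat}. s l j \<odot>\<^bsub>M\<^esub> z l)"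
      by (rule trivial_relation_explicit) blast
    have sc: "s l j \<in> carrier R" if "l < t'" "j < t" for l j using s that by (simp add: syzygy_def)
    define a' where "a' l x = (\<Oplus>j\<in>{..<t}. a j x \<otimes> s l j)" for l x
    have a': "a' l x \<in> carrier R" if "l < t'" for l x
      using a sc that by (auto simp: a'_def intro!: R.finsum_closed)
    have "x = (\<Oplus>\<^bsub>M\<^esub>l\<in>{..<t'}. a' l x \<odot>\<^bsub>M\<^esub> z l)" if "x \<in> S'" for x
    proof -
      have "(\<Oplus>\<^bsub>M\<^esub>l\<in>{..<t'}. a' l x \<odot>\<^bsub>M\<^esub> z l)
          = (\<Oplus>\<^bsub>M\<^esub>j\<in>{..<t}. a j x \<odot>\<^bsub>M\<^esub> (\<Oplus>\<^bsub>M\<^esub>l\<in>{..<t'}. s l j \<odot>\<^bsub>M\<^esub> z l))"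
        unfolding a'_def using a sc z
        by (intro finsum_smult_swap[symmetric, of _ _ "\<lambda>j. a j x" "\<lambda>j l. s l j"]) auto
      also have "\<dots> = (\<Oplus>\<^bsub>M\<^esub>j\<in>{..<t}. a j x \<odot>\<^bsub>M\<^esub> w j)"
        using a w by (intro M.finsum_cong') (auto simp: wz[symmetric])
      finally show ?thesis using S'eq[OF that] by simp
    qed
    moreover have "syzygy R k' b' (\<lambda>i. a' m (n' i))"
      if kbn': "(k', b', n') \<in> insert (k, b, n) L'" and m: "m < t'" for k' b' n' m
    proof -
      have b': "\<And>i. i < k' \<Longrightarrow> b' i \<in> carrier R"
        using rel[of k' b' n'] kbn' insert.prems unfolding l by auto
      have "(\<Oplus>i\<in>{..<k'}. b' i \<otimes> a' m (n' i)) = (\<Oplus>j\<in>{..<t}. (\<Oplus>i\<in>{..<k'}. b' i \<otimes> a j (n' i)) \<otimes> s m j)"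
        unfolding a'_def using b' a sc m by (intro sum_mult_swap) auto
      also have "\<dots> = \<zero>"
      proof (cases "(k', b', n') \<in> L'")
        case True
        then show ?thesis using L' sc m by (intro R.add.finprod_one_eqI) (auto simp: syzygy_def)
      next
        case False
        then have "(k', b', n') = (k, b, n)" using kbn' by blast
        then show ?thesis using s[OF m] by (auto simp: syzygy_def c_def)
      qed
      finally show ?thesis using a' m by (simp add: syzygy_def)
    qed
    ultimately show ?case using z a' unfolding l
      by (intro exI[of _ t'] exI[of _ z] exI[of _ a']) blast
  qed
  from this[OF subset_refl] obtain t w a where
    w: "\<forall>j<t. w j \<in> carrier M" and a: "\<forall>j<t. \<forall>x. a j x \<in> carrier R"
    and eq: "\<forall>x\<in>S'. x = (\<Oplus>\<^bsub>M\<^esub>j\<in>{..<t::nat}. a j x \<odot>\<^bsub>M\<^esub> w j)"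
    and syz: "\<forall>(k, b, n)\<in>L. \<forall>j<t. syzygy R k b (\<lambda>i. a j (n i))"
    by (elim exE conjE)
  show ?thesis
  proof (rule that)
    show "x = (\<Oplus>\<^bsub>M\<^esub>j\<in>{..<t}. a j x \<odot>\<^bsub>M\<^esub> w j)" if "x \<in> S" for x
      using bspec[OF eq, of x] that by (simp only: S'_def Un_iff simp_thms)
  qed (use w a syz in blast)+
qed

end

section \<open>Vanishing in a tensor product\<close>

lemma tensor_relations_subgroup:
  assumes "module R M" "module R N"
  shows "subgroup (tensor_relations R M N) (free_on_pairs M N)"
  unfolding tensor_relations_def
  by (intro group.generate_is_subgroup group_free_Abelian_group bilinear_relators_subset assms)

lemma tensor_relations_add:
  assumes "module R M" "module R N" "c \<in> tensor_relations R M N" "d \<in> tensor_relations R M N"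
  shows "c + d \<in> tensor_relations R M N"
  using subgroup.m_closed[OF tensor_relations_subgroup[OF assms(1,2)] assms(3,4)] by simp

lemma tensor_relations_minus:
  assumes "module R M" "module R N" "c \<in> tensor_relations R M N"
  shows "- c \<in> tensor_relations R M N"
proof -
  note sg = tensor_relations_subgroup[OF assms(1,2)]
  have "Poly_Mapping.keys c \<subseteq> carrier M \<times> carrier N"
    using subgroup.mem_carrier[OF sg assms(3)] by simp
  then show ?thesis using subgroup.m_inv_closed[OF sg assms(3)] by simp
qed

lemma tensor_relations_diff:
  assumes "module R M" "module R N" "c \<in> tensor_relations R M N" "d \<in> tensor_relations R M N"
  shows "c - d \<in> tensor_relations R M N"
  using tensor_relations_add[OF assms(1-3) tensor_relations_minus[OF assms(1,2,4)]] by simp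

lemma tensor_relations_zero: "0 \<in> tensor_relations R M N"
  using generate.one[of "free_on_pairs M N"] by (simp add: tensor_relations_def)

lemma tensor_relations_sum:
  assumes "module R M" "module R N" "\<And>i. i \<in> S \<Longrightarrow> c i \<in> tensor_relations R M N"
  shows "(\<Sum>i\<in>S. c i) \<in> tensor_relations R M N"
  using assms(3)
  by (induction S rule: infinite_finite_induct)
    (auto simp: tensor_relations_zero intro!: tensor_relations_add[OF assms(1,2)])

lemma tensor_relations_relators:
  assumes "x \<in> carrier M" "y \<in> carrier N"
  shows "x' \<in> carrier M \<Longrightarrow> frag_of (x \<oplus>\<^bsub>M\<^esub> x', y) - frag_of (x, y) - frag_of (x', y) \<in> tensor_relations R M N"
    and "y' \<in> carrier N \<Longrightarrow> frag_of (x, y \<oplus>\<^bsub>N\<^esub> y') - frag_of (x, y) - frag_of (x, y') \<in> tensor_relations R M N"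
    and "r \<in> carrier R \<Longrightarrow> frag_of (r \<odot>\<^bsub>M\<^esub> x, y) - frag_of (x, r \<odot>\<^bsub>N\<^esub> y) \<in> tensor_relations R M N"
  using assms unfolding tensor_relations_def bilinear_relators_def
  by (blast intro: generate.incl)+

lemma tensor_relations_zero_left:
  assumes "module R M" "module R N" "y \<in> carrier N"
  shows "frag_of (\<zero>\<^bsub>M\<^esub>, y) \<in> tensor_relations R M N"
proof -
  interpret M: module R M by fact
  show ?thesis
    using tensor_relations_minus[OF assms(1,2) tensor_relations_relators(1)[OF M.M.zero_closed assms(3) M.M.zero_closed]]
    by simp
qed

lemma tensor_relations_zero_right:
  assumes "module R M" "module R N" "x \<in> carrier M"
  shows "frag_of (x, \<zero>\<^bsub>N\<^esub>) \<in> tensor_relations R M N"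
proof -
  interpret N: module R N by fact
  show ?thesis
    using tensor_relations_minus[OF assms(1,2) tensor_relations_relators(2)[OF assms(3) N.M.zero_closed N.M.zero_closed]]
    by simp
qed

lemma tensor_relations_finsum_left:
  assumes M: "module R M" and N: "module R N" and "finite S" "y \<in> carrier N" "\<And>i. i \<in> S \<Longrightarrow> x i \<in> carrier M"
  shows "frag_of (\<Oplus>\<^bsub>M\<^esub>i\<in>S. x i, y) - (\<Sum>i\<in>S. frag_of (x i, y)) \<in> tensor_relations R M N"
  using assms(3,5)
proof (induction S)
  interpret M: module R M by fact
  { case empty
    show ?case using tensor_relations_zero_left[OF M N assms(4)] by simp
  next
    case (insert i S)
    have c: "(\<Oplus>\<^bsub>M\<^esub>i\<in>S. x i) \<in> carrier M" using insert by (auto intro!: M.M.finsum_closed)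
    have "frag_of (x i \<oplus>\<^bsub>M\<^esub> (\<Oplus>\<^bsub>M\<^esub>i\<in>S. x i), y) - frag_of (x i, y) - frag_of (\<Oplus>\<^bsub>M\<^esub>i\<in>S. x i, y)
        + (frag_of (\<Oplus>\<^bsub>M\<^esub>i\<in>S. x i, y) - (\<Sum>i\<in>S. frag_of (x i, y))) \<in> tensor_relations R M N"
      using insert c assms(4) by (intro tensor_relations_add[OF M N] tensor_relations_relators(1)) auto
    then show ?case using insert by (simp add: M.M.finsum_insert Pi_def algebra_simps) }
qed

lemma tensor_relations_finsum_right:
  assumes M: "module R M" and N: "module R N" and "finite S" "x \<in> carrier M" "\<And>i. i \<in> S \<Longrightarrow> y i \<in> carrier N"
  shows "frag_of (x, \<Oplus>\<^bsub>N\<^esub>i\<in>S. y i) - (\<Sum>i\<in>S. frag_of (x, y i)) \<in> tensor_relations R M N"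
  using assms(3,5)
proof (induction S)
  interpret N: module R N by fact
  { case empty
    show ?case using tensor_relations_zero_right[OF M N assms(4)] by simp
  next
    case (insert i S)
    have c: "(\<Oplus>\<^bsub>N\<^esub>i\<in>S. y i) \<in> carrier N" using insert by (auto intro!: N.M.finsum_closed)
    have "frag_of (x, y i \<oplus>\<^bsub>N\<^esub> (\<Oplus>\<^bsub>N\<^esub>i\<in>S. y i)) - frag_of (x, y i) - frag_of (x, \<Oplus>\<^bsub>N\<^esub>i\<in>S. y i)
        + (frag_of (x, \<Oplus>\<^bsub>N\<^esub>i\<in>S. y i) - (\<Sum>i\<in>S. frag_of (x, y i))) \<in> tensor_relations R M N"
      using insert c assms(4) by (intro tensor_relations_add[OF M N] tensor_relations_relators(2)) auto
    then show ?case using insert by (simp add: N.M.finsum_insert Pi_def algebra_simps) }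
qed

text \<open>Every tensor is a sum of pure tensors: a sign can be moved into the left factor.\<close>

lemma free_on_pairs_pure_tensors:
  assumes M: "module R M" and N: "module R N" and c: "c \<in> carrier (free_on_pairs M N)"
  obtains k x y where "\<And>i. i < k \<Longrightarrow> x i \<in> carrier M" "\<And>i. i < k \<Longrightarrow> y i \<in> carrier N"
    "c - (\<Sum>i<k::nat. frag_of (x i, y i)) \<in> tensor_relations R M N"
proof -
  interpret M: module R M by fact
  have "\<exists>zs. set zs \<subseteq> carrier M \<times> carrier N \<and> c - sum_list (map frag_of zs) \<in> tensor_relations R M N"
    using c unfolding carrier_free_Abelian_group_iff
  proof (induction c rule: frag_induction)
    case zero
    show ?case by (intro exI[of _ "[]"]) (simp add: tensor_relations_zero)
  next
    case (one p)
    then show ?case by (intro exI[of _ "[p]"]) (simp add: tensor_relations_zero)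
  next
    case (diff a b)
    have neg: "frag_of (x, y) + frag_of (\<ominus>\<^bsub>M\<^esub> x, y) \<in> tensor_relations R M N"
      if "x \<in> carrier M" "y \<in> carrier N" for x y
      using tensor_relations_diff[OF M N tensor_relations_zero_left[OF M N that(2)]
          tensor_relations_relators(1)[OF that M.M.a_inv_closed[OF that(1)]]] that
      by (simp add: M.M.r_neg algebra_simps)
    from diff obtain zs ws where zs: "set zs \<subseteq> carrier M \<times> carrier N" "a - sum_list (map frag_of zs) \<in> tensor_relations R M N"
      and ws: "set ws \<subseteq> carrier M \<times> carrier N" "b - sum_list (map frag_of ws) \<in> tensor_relations R M N" by blast
    let ?neg = "map (\<lambda>(x, y). (\<ominus>\<^bsub>M\<^esub> x, y))"
    have "sum_list (map frag_of ws) + sum_list (map frag_of (?neg ws)) \<in> tensor_relations R M N"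
      using ws(1)
    proof (induction ws)
      case Nil
      then show ?case by (simp add: tensor_relations_zero)
    next
      case (Cons p ws)
      obtain x y where p: "p = (x, y)" by (cases p)
      have "(frag_of (x, y) + frag_of (\<ominus>\<^bsub>M\<^esub> x, y)) + (sum_list (map frag_of ws) + sum_list (map frag_of (?neg ws))) \<in> tensor_relations R M N"
        using Cons p by (intro tensor_relations_add[OF M N neg]) auto
      then show ?case by (simp add: p algebra_simps)
    qed
    then have "(a - sum_list (map frag_of zs)) - (b - sum_list (map frag_of ws))
        - (sum_list (map frag_of ws) + sum_list (map frag_of (?neg ws))) \<in> tensor_relations R M N"
      by (intro tensor_relations_diff[OF M N tensor_relations_diff[OF M N zs(2) ws(2)]])
    then have "a - b - sum_list (map frag_of (zs @ ?neg ws)) \<in> tensor_relations R M N"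
      by (simp add: algebra_simps)
    moreover have "set (zs @ ?neg ws) \<subseteq> carrier M \<times> carrier N" using zs ws by auto
    ultimately show ?case by blast
  qed
  then obtain zs where zs: "set zs \<subseteq> carrier M \<times> carrier N"
    "c - sum_list (map frag_of zs) \<in> tensor_relations R M N" by blast
  have "zs ! i \<in> carrier M \<times> carrier N" if "i < length zs" for i using zs(1) that by auto
  moreover have "sum_list (map frag_of zs) = (\<Sum>i<length zs. frag_of (fst (zs ! i), snd (zs ! i)))"
    by (simp add: sum_list_sum_nth atLeast0LessThan)
  ultimately show ?thesis
    using that[of "length zs" "\<lambda>i. fst (zs ! i)" "\<lambda>i. snd (zs ! i)"] zs(2) by (auto simp: mem_Times_iff)
qed

text \<open>
  For a tensor that vanishes, finitely many linear relations among elements of \<open>N\<close> are responsible: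
  any function \<open>\<alpha>\<close> to the ring that respects them sends the tensor to zero.
\<close>

lemma (in abelian_monoid) finsum_lessThan_2:
  assumes "f 0 \<in> carrier G" "f 1 \<in> carrier G"
  shows "(\<Oplus>i\<in>{..<2::nat}. f i) = f 0 \<oplus> f 1"
proof -
  have "{..<2::nat} = {0, 1}" by auto
  then show ?thesis using assms by (simp add: finsum_insert finsum_empty)
qed

lemma (in abelian_monoid) finsum_lessThan_3:
  assumes "f 0 \<in> carrier G" "f 1 \<in> carrier G" "f 2 \<in> carrier G"
  shows "(\<Oplus>i\<in>{..<3::nat}. f i) = f 0 \<oplus> f 1 \<oplus> f 2"
proof -
  have "{..<3::nat} = {0, 1, 2}" by auto
  then show ?thesis using assms by (simp add: finsum_insert finsum_empty a_assoc)
qed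

lemma tensor_relations_finite_support:
  fixes R :: "('a, 'c) ring_scheme" (structure)
    and M :: "('a, 'm, 'd) module_scheme" and N :: "('a, 'n, 'e) module_scheme"
  assumes M: "module R M" and N: "module R N" and c: "c \<in> tensor_relations R M N"
  obtains L where "finite L"
    "\<And>k b n. (k, b, n) \<in> L \<Longrightarrow> linear_relation R N k b n \<and> (\<forall>i<k. b i \<in> carrier R)"
    "\<And>\<alpha> h. \<lbrakk>\<And>y. \<alpha> y \<in> carrier R; \<And>k b n. (k, b, n) \<in> L \<Longrightarrow> syzygy R k b (\<lambda>i. \<alpha> (n i));
      h \<in> hom (free_on_pairs M N) (add_monoid M);
      \<And>x y. x \<in> carrier M \<Longrightarrow> y \<in> carrier N \<Longrightarrow> h (frag_of (x, y)) = \<alpha> y \<odot>\<^bsub>M\<^esub> x\<rbrakk> \<Longrightarrow> h c = \<zero>\<^bsub>M\<^esub>"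
proof -
  interpret M: module R M by fact
  interpret N: module R N by fact
  define resp where "resp L \<alpha> h \<longleftrightarrow> (\<forall>y. \<alpha> y \<in> carrier R) \<and>
      (\<forall>(k, b, n)\<in>L. syzygy R k b (\<lambda>i. \<alpha> (n i))) \<and> h \<in> hom (free_on_pairs M N) (add_monoid M) \<and>
      (\<forall>x\<in>carrier M. \<forall>y\<in>carrier N. h (frag_of (x, y)) = \<alpha> y \<odot>\<^bsub>M\<^esub> x)"
    for L :: "(nat \<times> (nat \<Rightarrow> 'a) \<times> (nat \<Rightarrow> 'n)) set" and \<alpha> h
  define valid where "valid L \<longleftrightarrow> finite L \<and>
      (\<forall>(k, b, n)\<in>L. linear_relation R N k b n \<and> (\<forall>i<k. b i \<in> carrier R))"
    for L :: "(nat \<times> (nat \<Rightarrow> 'a) \<times> (nat \<Rightarrow> 'n)) set"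
  interpret F: group "free_on_pairs M N" by simp
  have hom: "group_hom (free_on_pairs M N) (add_monoid M) h" if "resp L \<alpha> h" for L \<alpha> h
    using that unfolding resp_def group_hom_def group_hom_axioms_def
    by (simp add: M.M.a_group)
  have hdiff: "h (c - d) = h c \<ominus>\<^bsub>M\<^esub> h d" and hc: "h c \<in> carrier M"
    if "resp L \<alpha> h" "c \<in> carrier (free_on_pairs M N)" "d \<in> carrier (free_on_pairs M N)" for L \<alpha> h c d
  proof -
    interpret h: group_hom "free_on_pairs M N" "add_monoid M" h using hom[OF that(1)] .
    show "h c \<in> carrier M" using h.hom_closed[OF that(2)] by simp
    have "h (c - d) = h (c \<otimes>\<^bsub>free_on_pairs M N\<^esub> inv\<^bsub>free_on_pairs M N\<^esub> d)" using that(3) by simp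
    also have "\<dots> = h c \<oplus>\<^bsub>M\<^esub> inv\<^bsub>add_monoid M\<^esub> (h d)"
      using that(2,3) by (subst h.hom_mult) (auto simp del: carrier_free_Abelian_group_iff inv_free_Abelian_group)
    finally show "h (c - d) = h c \<ominus>\<^bsub>M\<^esub> h d" by (simp add: a_minus_def a_inv_def)
  qed
  have hdiff3: "h (frag_of p - frag_of q - frag_of s) = h (frag_of p) \<ominus>\<^bsub>M\<^esub> h (frag_of q) \<ominus>\<^bsub>M\<^esub> h (frag_of s)"
    if h: "resp L \<alpha> h" and "p \<in> carrier M \<times> carrier N" "q \<in> carrier M \<times> carrier N" "s \<in> carrier M \<times> carrier N"
    for L \<alpha> h p q s
  proof -
    have "frag_of p - frag_of q \<in> carrier (free_on_pairs M N)"
      using that keys_diff[of "frag_of p" "frag_of q"] by (auto split: if_splits)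
    then show ?thesis using that by (simp add: hdiff[OF h])
  qed
  have relator: "\<exists>L. valid L \<and> (\<forall>\<alpha> h. resp L \<alpha> h \<longrightarrow> h c = \<zero>\<^bsub>M\<^esub>)"
    if "c \<in> bilinear_relators R M N" for c
  proof -
    from that consider
        x x' y where "c = frag_of (x \<oplus>\<^bsub>M\<^esub> x', y) - frag_of (x, y) - frag_of (x', y)"
          "x \<in> carrier M" "x' \<in> carrier M" "y \<in> carrier N"
      | x y y' where "c = frag_of (x, y \<oplus>\<^bsub>N\<^esub> y') - frag_of (x, y) - frag_of (x, y')"
          "x \<in> carrier M" "y \<in> carrier N" "y' \<in> carrier N"
      | r x y where "c = frag_of (r \<odot>\<^bsub>M\<^esub> x, y) - frag_of (x, r \<odot>\<^bsub>N\<^esub> y)"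
          "r \<in> carrier R" "x \<in> carrier M" "y \<in> carrier N"
      unfolding bilinear_relators_def by blast
    then show ?thesis
    proof cases
      case 1
      show ?thesis
      proof (intro exI[of _ "{}"] conjI allI impI)
        fix \<alpha> h assume h: "resp {} \<alpha> h"
        then have "\<alpha> y \<in> carrier R" by (simp add: resp_def)
        then show "h c = \<zero>\<^bsub>M\<^esub>"
          using h 1 by (simp add: hdiff3[OF h] resp_def M.smult_r_distr M.M.minus_eq M.M.minus_add M.M.a_ac M.M.r_neg M.M.r_neg1)
      qed (simp add: valid_def)
    next
      case 2
      define L where "L = {(3::nat, \<lambda>i::nat. if i = 2 then \<ominus> \<one> else \<one>,
          \<lambda>i::nat. if i = 0 then y else if i = 1 then y' else y \<oplus>\<^bsub>N\<^esub> y')}"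
      show ?thesis
      proof (intro exI[of _ L] conjI allI impI)
        show "valid L" using 2
          by (auto simp: valid_def L_def linear_relation_def N.M.finsum_lessThan_3 N.smult_l_minus N.M.r_neg)
        fix \<alpha> h assume h: "resp L \<alpha> h"
        then have \<alpha>: "\<And>y. \<alpha> y \<in> carrier R" by (simp add: resp_def)
        have "\<alpha> y \<oplus> \<alpha> y' \<oplus> \<ominus> \<alpha> (y \<oplus>\<^bsub>N\<^esub> y') = \<zero>"
          using h \<alpha> by (simp add: resp_def L_def syzygy_def M.R.finsum_lessThan_3 M.R.l_minus)
        then have "\<alpha> (y \<oplus>\<^bsub>N\<^esub> y') = \<alpha> y \<oplus> \<alpha> y'"
          using \<alpha> by (metis M.R.a_closed M.R.minus_equality M.R.minus_minus M.R.a_inv_closed)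
        then show "h c = \<zero>\<^bsub>M\<^esub>"
          using h 2 \<alpha> by (simp add: hdiff3[OF h] resp_def M.smult_l_distr M.M.minus_eq M.M.minus_add M.M.a_ac M.M.r_neg M.M.r_neg1)
      qed
    next
      case 3
      define L where "L = {(2::nat, \<lambda>i::nat. if i = 0 then r else \<ominus> \<one>,
          \<lambda>i::nat. if i = 0 then y else r \<odot>\<^bsub>N\<^esub> y)}"
      show ?thesis
      proof (intro exI[of _ L] conjI allI impI)
        show "valid L" using 3
          by (auto simp: valid_def L_def linear_relation_def N.M.finsum_lessThan_2 N.smult_l_minus N.M.r_neg)
        fix \<alpha> h assume h: "resp L \<alpha> h"
        then have \<alpha>: "\<And>y. \<alpha> y \<in> carrier R" by (simp add: resp_def)
        have "r \<otimes> \<alpha> y \<oplus> \<ominus> \<alpha> (r \<odot>\<^bsub>N\<^esub> y) = \<zero>"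
          using h \<alpha> 3 by (simp add: resp_def L_def syzygy_def M.R.finsum_lessThan_2 M.R.l_minus)
        then have "\<alpha> (r \<odot>\<^bsub>N\<^esub> y) = r \<otimes> \<alpha> y"
          using \<alpha> 3 by (metis M.R.m_closed M.R.minus_equality M.R.minus_minus M.R.a_inv_closed)
        then have "\<alpha> (r \<odot>\<^bsub>N\<^esub> y) \<odot>\<^bsub>M\<^esub> x = \<alpha> y \<odot>\<^bsub>M\<^esub> (r \<odot>\<^bsub>M\<^esub> x)"
          using \<alpha> 3 by (simp add: M.R.m_comm M.smult_assoc1[symmetric])
        then show "h c = \<zero>\<^bsub>M\<^esub>"
          using h 3 \<alpha> by (simp add: hdiff[OF h] resp_def M.M.minus_eq M.M.r_neg)
      qed
    qed
  qed
  have "\<exists>L. valid L \<and> (\<forall>\<alpha> h. resp L \<alpha> h \<longrightarrow> h c = \<zero>\<^bsub>M\<^esub>)"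
    using c unfolding tensor_relations_def
  proof (induction rule: generate.induct)
    case one
    show ?case
    proof (intro exI[of _ "{}"] conjI allI impI)
      fix \<alpha> h assume "resp {} \<alpha> h"
      from hom[OF this] show "h \<one>\<^bsub>free_on_pairs M N\<^esub> = \<zero>\<^bsub>M\<^esub>"
        using group_hom.hom_one by fastforce
    qed (simp add: valid_def)
  next
    case (eng c d)
    then obtain L K where L: "valid L" "\<And>\<alpha> h. resp L \<alpha> h \<Longrightarrow> h c = \<zero>\<^bsub>M\<^esub>"
      and K: "valid K" "\<And>\<alpha> h. resp K \<alpha> h \<Longrightarrow> h d = \<zero>\<^bsub>M\<^esub>" by blast
    have cd: "c \<in> carrier (free_on_pairs M N)" "d \<in> carrier (free_on_pairs M N)"
      using eng F.generate_in_carrier[OF bilinear_relators_subset[OF M N]] by blast+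
    show ?case
    proof (intro exI[of _ "L \<union> K"] conjI allI impI)
      show "valid (L \<union> K)" using L K by (auto simp: valid_def)
      fix \<alpha> h assume h: "resp (L \<union> K) \<alpha> h"
      then have "resp L \<alpha> h" "resp K \<alpha> h" by (auto simp: resp_def)
      then have "h c = \<zero>\<^bsub>M\<^esub>" "h d = \<zero>\<^bsub>M\<^esub>" using L(2) K(2) by blast+
      moreover have "h \<in> hom (free_on_pairs M N) (add_monoid M)" using h by (simp add: resp_def)
      ultimately show "h (c \<otimes>\<^bsub>free_on_pairs M N\<^esub> d) = \<zero>\<^bsub>M\<^esub>"
        using hom_mult[of h "free_on_pairs M N" "add_monoid M", OF _ cd] by simp
    qed
  next
    case (incl c)
    then show ?case by (rule relator)
  next
    case (inv c)
    then obtain L where L: "valid L" "\<And>\<alpha> h. resp L \<alpha> h \<Longrightarrow> h c = \<zero>\<^bsub>M\<^esub>" using relator by blast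
    have cc: "c \<in> carrier (free_on_pairs M N)" using inv bilinear_relators_subset[OF M N] by blast
    have "h (inv\<^bsub>free_on_pairs M N\<^esub> c) = \<zero>\<^bsub>M\<^esub>" if "resp L \<alpha> h" for \<alpha> h
      using group_hom.hom_inv[OF hom[OF that] cc] L(2)[OF that] by (simp add: a_inv_def[symmetric])
    then show ?case using L(1) by blast
  qed
  then obtain L where L: "valid L" "\<And>\<alpha> h. resp L \<alpha> h \<Longrightarrow> h c = \<zero>\<^bsub>M\<^esub>" by blast
  show ?thesis
  proof (rule that)
    show "finite L" using L by (simp add: valid_def)
    show "linear_relation R N k b n \<and> (\<forall>i<k. b i \<in> carrier R)" if "(k, b, n) \<in> L" for k b n
      using L that by (auto simp: valid_def)
    fix \<alpha> h
    assume "\<And>y. \<alpha> y \<in> carrier R" "\<And>k b n. (k, b, n) \<in> L \<Longrightarrow> syzygy R k b (\<lambda>i. \<alpha> (n i))"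
      "h \<in> hom (free_on_pairs M N) (add_monoid M)"
      "\<And>x y. x \<in> carrier M \<Longrightarrow> y \<in> carrier N \<Longrightarrow> h (frag_of (x, y)) = \<alpha> y \<odot>\<^bsub>M\<^esub> x"
    then have "resp L \<alpha> h" by (auto simp: resp_def)
    then show "h c = \<zero>\<^bsub>M\<^esub>" by (rule L(2))
  qed
qed

lemma hom_sum_frag_of:
  assumes M: "abelian_group M" and h: "h \<in> hom (free_Abelian_group S) (add_monoid M)"
    and p: "\<And>i. i < k \<Longrightarrow> p i \<in> S"
  shows "h (\<Sum>i<k::nat. frag_of (p i)) = (\<Oplus>\<^bsub>M\<^esub>i\<in>{..<k}. h (frag_of (p i)))"
  using p
proof (induction k)
  interpret M: abelian_group M by fact
  { case 0
    have "h \<one>\<^bsub>free_Abelian_group S\<^esub> = \<one>\<^bsub>add_monoid M\<^esub>"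
      by (intro hom_one[OF h]) (auto simp: M.a_group)
    then show ?case by simp
  next
    case (Suc k)
    have mem: "(\<Sum>i<k. frag_of (p i)) \<in> carrier (free_Abelian_group S)"
      by (rule sum_closed_free_Abelian_group) (use Suc.prems in auto)
    have "frag_of (p k) \<in> carrier (free_Abelian_group S)" using Suc.prems by simp
    with mem have "h ((\<Sum>i<k. frag_of (p i)) + frag_of (p k)) = h (\<Sum>i<k. frag_of (p i)) \<oplus>\<^bsub>M\<^esub> h (frag_of (p k))"
      using hom_mult[OF h] by fastforce
    moreover have "h (frag_of (p i)) \<in> carrier M" if "i \<le> k" for i
      using hom_in_carrier[OF h, of "frag_of (p i)"] Suc.prems that by simp
    ultimately show ?case using Suc by (simp add: M.finsum_lessThan_Suc) }
qed

text \<open>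
  The equational criterion for vanishing. Coordinates for the right factors that respect the linear
  relations responsible for the vanishing give functions \<open>\<alpha>\<close> as in
  \<open>tensor_relations_finite_support\<close>.
\<close>

lemma tensor_vanishing_criterion:
  fixes R :: "('a, 'c) ring_scheme" (structure)
  assumes M: "module R M" and N: "module R N" and flat: "equationally_flat R N"
    and x: "\<And>i. i < k \<Longrightarrow> x i \<in> carrier M" and y: "\<And>i. i < k \<Longrightarrow> y i \<in> carrier N"
    and zero: "(\<Sum>i<k::nat. frag_of (x i, y i)) \<in> tensor_relations R M N"
  obtains t w a where "\<And>j. j < t \<Longrightarrow> w j \<in> carrier N" "\<And>j i. j < t \<Longrightarrow> i < k \<Longrightarrow> a j i \<in> carrier R"
    "\<And>i. i < k \<Longrightarrow> y i = (\<Oplus>\<^bsub>N\<^esub>j\<in>{..<t::nat}. a j i \<odot>\<^bsub>N\<^esub> w j)"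
    "\<And>j. j < t \<Longrightarrow> (\<Oplus>\<^bsub>M\<^esub>i\<in>{..<k}. a j i \<odot>\<^bsub>M\<^esub> x i) = \<zero>\<^bsub>M\<^esub>"
proof -
  interpret M: module R M by fact
  interpret N: module R N by fact
  show ?thesis
  proof (rule tensor_relations_finite_support[OF M N zero])
    fix L assume L: "finite L"
      "\<And>k b n. (k, b, n) \<in> L \<Longrightarrow> linear_relation R N k b n \<and> (\<forall>i<k. b i \<in> carrier R)"
    assume supp: "\<And>\<alpha> h. \<lbrakk>\<And>y. \<alpha> y \<in> carrier R; \<And>k b n. (k, b, n) \<in> L \<Longrightarrow> syzygy R k b (\<lambda>i. \<alpha> (n i));
      h \<in> hom (free_on_pairs M N) (add_monoid M);
      \<And>x y. x \<in> carrier M \<Longrightarrow> y \<in> carrier N \<Longrightarrow> h (frag_of (x, y)) = \<alpha> y \<odot>\<^bsub>M\<^esub> x\<rbrakk>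
      \<Longrightarrow> h (\<Sum>i<k. frag_of (x i, y i)) = \<zero>\<^bsub>M\<^esub>"
    have S: "finite (y ` {..<k})" "y ` {..<k} \<subseteq> carrier N" using y by auto
    show ?thesis
    proof (rule N.compatible_coordinates[OF flat S L])
      fix t w a
      assume w: "\<And>j. j < t \<Longrightarrow> w j \<in> carrier N" and a: "\<And>j x. j < t \<Longrightarrow> a j x \<in> carrier R"
        and yw: "\<And>z. z \<in> y ` {..<k} \<Longrightarrow> z = (\<Oplus>\<^bsub>N\<^esub>j\<in>{..<t::nat}. a j z \<odot>\<^bsub>N\<^esub> w j)"
        and resp: "\<And>k b n j. (k, b, n) \<in> L \<Longrightarrow> j < t \<Longrightarrow> syzygy R k b (\<lambda>i. a j (n i))"
      show ?thesis
      proof (rule that)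
        show "w j \<in> carrier N" if "j < t" for j using w that .
        show "a j (y i) \<in> carrier R" if "j < t" for j i using a that .
        show "y i = (\<Oplus>\<^bsub>N\<^esub>j\<in>{..<t}. a j (y i) \<odot>\<^bsub>N\<^esub> w j)" if "i < k" for i
          by (rule yw) (use that in blast)
        fix j assume j: "j < t"
        have "(\<lambda>(x, y). a j y \<odot>\<^bsub>M\<^esub> x) ` (carrier M \<times> carrier N) \<subseteq> carrier (add_monoid M)"
          using a[OF j] by auto
        from comm_group.free_Abelian_group_universal[OF M.M.a_comm_group this]
        obtain h where h: "h \<in> hom (free_on_pairs M N) (add_monoid M)"
          "\<And>p. p \<in> carrier M \<times> carrier N \<Longrightarrow> h (frag_of p) = (\<lambda>(x, y). a j y \<odot>\<^bsub>M\<^esub> x) p" by blast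
        have "h (\<Sum>i<k. frag_of (x i, y i)) = \<zero>\<^bsub>M\<^esub>"
          by (rule supp[of "a j"]) (use a resp j h in auto)
        moreover have "h (\<Sum>i<k. frag_of (x i, y i)) = (\<Oplus>\<^bsub>M\<^esub>i\<in>{..<k}. h (frag_of (x i, y i)))"
          by (rule hom_sum_frag_of[OF _ h(1)]) (use x y in \<open>auto simp: M.M.abelian_group_axioms\<close>)
        moreover have "(\<Oplus>\<^bsub>M\<^esub>i\<in>{..<k}. h (frag_of (x i, y i))) = (\<Oplus>\<^bsub>M\<^esub>i\<in>{..<k}. a j (y i) \<odot>\<^bsub>M\<^esub> x i)"
          using x y a[OF j] h(2) by (intro M.M.finsum_cong') auto
        ultimately show "(\<Oplus>\<^bsub>M\<^esub>i\<in>{..<k}. a j (y i) \<odot>\<^bsub>M\<^esub> x i) = \<zero>\<^bsub>M\<^esub>" by simp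
      qed
    qed
  qed
qed

lemma tensor_change_coordinates:
  assumes M: "module R M" and N: "module R N"
    and x: "\<And>i. i < k \<Longrightarrow> x i \<in> carrier M" and w: "\<And>j. j < t \<Longrightarrow> w j \<in> carrier N"
    and a: "\<And>j i. j < t \<Longrightarrow> i < k \<Longrightarrow> a j i \<in> carrier R"
    and y: "\<And>i. i < k \<Longrightarrow> y i = (\<Oplus>\<^bsub>N\<^esub>j\<in>{..<t::nat}. a j i \<odot>\<^bsub>N\<^esub> w j)"
  shows "(\<Sum>i<k::nat. frag_of (x i, y i)) - (\<Sum>j<t. frag_of (\<Oplus>\<^bsub>M\<^esub>i\<in>{..<k}. a j i \<odot>\<^bsub>M\<^esub> x i, w j))
    \<in> tensor_relations R M N"
proof -
  interpret M: module R M by fact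
  interpret N: module R N by fact
  have 1: "(\<Sum>i<k. frag_of (x i, y i) - (\<Sum>j<t. frag_of (x i, a j i \<odot>\<^bsub>N\<^esub> w j))) \<in> tensor_relations R M N"
    by (rule tensor_relations_sum[OF M N])
      (use x w a in \<open>auto simp: y intro!: tensor_relations_finsum_right[OF M N]\<close>)
  have 2: "(\<Sum>i<k. \<Sum>j<t. frag_of (a j i \<odot>\<^bsub>M\<^esub> x i, w j) - frag_of (x i, a j i \<odot>\<^bsub>N\<^esub> w j)) \<in> tensor_relations R M N"
    by (intro tensor_relations_sum[OF M N] tensor_relations_relators(3)) (use x w a in auto)
  have 3: "(\<Sum>j<t. frag_of (\<Oplus>\<^bsub>M\<^esub>i\<in>{..<k}. a j i \<odot>\<^bsub>M\<^esub> x i, w j) - (\<Sum>i<k. frag_of (a j i \<odot>\<^bsub>M\<^esub> x i, w j)))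
      \<in> tensor_relations R M N"
    by (intro tensor_relations_sum[OF M N] tensor_relations_finsum_left[OF M N]) (use x w a in auto)
  have "(\<Sum>i<k. frag_of (x i, y i)) - (\<Sum>j<t. frag_of (\<Oplus>\<^bsub>M\<^esub>i\<in>{..<k}. a j i \<odot>\<^bsub>M\<^esub> x i, w j))
    = (\<Sum>i<k. frag_of (x i, y i) - (\<Sum>j<t. frag_of (x i, a j i \<odot>\<^bsub>N\<^esub> w j)))
      - (\<Sum>i<k. \<Sum>j<t. frag_of (a j i \<odot>\<^bsub>M\<^esub> x i, w j) - frag_of (x i, a j i \<odot>\<^bsub>N\<^esub> w j))
      - (\<Sum>j<t. frag_of (\<Oplus>\<^bsub>M\<^esub>i\<in>{..<k}. a j i \<odot>\<^bsub>M\<^esub> x i, w j) - (\<Sum>i<k. frag_of (a j i \<odot>\<^bsub>M\<^esub> x i, w j)))"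
    using sum.swap[of "\<lambda>i j. frag_of (a j i \<odot>\<^bsub>M\<^esub> x i, w j)" "{..<t}" "{..<k}"]
    by (simp add: sum_subtractf)
  then show ?thesis
    using tensor_relations_diff[OF M N tensor_relations_diff[OF M N 1 2] 3] by simp
qed

section \<open>Faithful flatness\<close>

lemma lin_mapsD:
  assumes "f \<in> lin_maps R M M'"
  shows "x \<in> carrier M \<Longrightarrow> f x \<in> carrier M'"
    and "x \<in> carrier M \<Longrightarrow> y \<in> carrier M \<Longrightarrow> f (x \<oplus>\<^bsub>M\<^esub> y) = f x \<oplus>\<^bsub>M'\<^esub> f y"
    and "a \<in> carrier R \<Longrightarrow> x \<in> carrier M \<Longrightarrow> f (a \<odot>\<^bsub>M\<^esub> x) = a \<odot>\<^bsub>M'\<^esub> f x"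
  using assms by (auto simp: lin_maps_def hom_def)

abbreviation push_left :: "('m \<Rightarrow> 'm') \<Rightarrow> ('m \<times> 'n \<Rightarrow>\<^sub>0 int) \<Rightarrow> ('m' \<times> 'n \<Rightarrow>\<^sub>0 int)" where
  "push_left f \<equiv> frag_extend (\<lambda>(x, y). frag_of (f x, y))"

lemma push_left_closed:
  assumes "f \<in> lin_maps R M M'" "c \<in> carrier (free_on_pairs M N)"
  shows "push_left f c \<in> carrier (free_on_pairs M' N)"
proof -
  show ?thesis
    using assms(2) keys_frag_extend[of "\<lambda>(x, y). frag_of (f x, y)" c]
    by (fastforce simp: carrier_free_Abelian_group_iff lin_mapsD(1)[OF assms(1)] split: prod.splits)
qed

lemma tensor_coset_eq_iff:
  assumes M: "module R M" and N: "module R N"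
    and c: "c \<in> carrier (free_on_pairs M N)" and d: "d \<in> carrier (free_on_pairs M N)"
  shows "tensor_relations R M N #>\<^bsub>free_on_pairs M N\<^esub> c = tensor_relations R M N #>\<^bsub>free_on_pairs M N\<^esub> d
    \<longleftrightarrow> c - d \<in> tensor_relations R M N"
proof -
  interpret F: group "free_on_pairs M N" by simp
  note sg = tensor_relations_subgroup[OF M N]
  have "c \<in> tensor_relations R M N #>\<^bsub>free_on_pairs M N\<^esub> d \<longleftrightarrow> c - d \<in> tensor_relations R M N"
    unfolding r_coset_def by (auto simp: algebra_simps intro!: bexI[of _ "c - d"])
  then show ?thesis
    using F.repr_independence[OF _ d sg, of c] F.rcos_self[OF c sg] by metis
qed

text \<open>Exactness of the tensored sequence, with cosets replaced by representatives.\<close>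

lemma exact_at_tensor_iff:
  assumes M1: "module R M1" and M2: "module R M2" and M3: "module R M3" and N: "module R N"
    and f: "f \<in> lin_maps R M1 M2" and g: "g \<in> lin_maps R M2 M3"
  shows "exact_at (tensor_product R M1 N) (tensor_map R M2 N f)
      (tensor_product R M2 N) (tensor_map R M3 N g) (tensor_product R M3 N) \<longleftrightarrow>
    (\<forall>c\<in>carrier (free_on_pairs M2 N). push_left g c \<in> tensor_relations R M3 N \<longleftrightarrow>
      (\<exists>d\<in>carrier (free_on_pairs M1 N). c - push_left f d \<in> tensor_relations R M2 N))"
    (is "?exact \<longleftrightarrow> ?pointwise")
proof -
  let ?q2 = "\<lambda>c. tensor_relations R M2 N #>\<^bsub>free_on_pairs M2 N\<^esub> c"
  let ?q3 = "\<lambda>c. tensor_relations R M3 N #>\<^bsub>free_on_pairs M3 N\<^esub> c"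
  let ?im = "(\<lambda>d. ?q2 (push_left f d)) ` carrier (free_on_pairs M1 N)"
  let ?ker = "kernel (tensor_product R M2 N) (tensor_product R M3 N) (tensor_map R M3 N g)"
  have img: "tensor_map R M2 N f ` carrier (tensor_product R M1 N)
      = ?im"
    unfolding tensor_product_def carrier_FactGroup image_image
    by (rule image_cong[OF refl]) (rule tensor_map_coset[OF M1 M2 N f])
  have one: "\<one>\<^bsub>tensor_product R M3 N\<^esub> = ?q3 0"
  proof -
    interpret F: group "free_on_pairs M3 N" by simp
    show ?thesis
      unfolding tensor_product_def one_FactGroup
      by (rule F.coset_join2[symmetric])
        (auto simp: tensor_relations_subgroup[OF M3 N] tensor_relations_zero)
  qed
  have ker: "?q2 c \<in> ?ker
      \<longleftrightarrow> push_left g c \<in> tensor_relations R M3 N" if c: "c \<in> carrier (free_on_pairs M2 N)" for c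
  proof -
    have "?q2 c \<in> carrier (tensor_product R M2 N)"
      unfolding tensor_product_def carrier_FactGroup using c by blast
    moreover have "tensor_map R M3 N g (?q2 c) = ?q3 (push_left g c)"
      by (rule tensor_map_coset[OF M2 M3 N g c])
    ultimately show ?thesis
      unfolding kernel_def mem_Collect_eq one
      using tensor_coset_eq_iff[OF M3 N push_left_closed[OF g c], of 0] by simp
  qed
  have kersub: "?ker
      \<subseteq> ?q2 ` carrier (free_on_pairs M2 N)"
    unfolding kernel_def tensor_product_def carrier_FactGroup by blast
  have mem: "?q2 c \<in> ?im \<longleftrightarrow>
      (\<exists>d\<in>carrier (free_on_pairs M1 N). c - push_left f d \<in> tensor_relations R M2 N)"
    if "c \<in> carrier (free_on_pairs M2 N)" for c
    unfolding image_iff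
    by (rule bex_cong[OF refl]) (rule tensor_coset_eq_iff[OF M2 N that push_left_closed[OF f]])
  have imgsub: "?im \<subseteq> ?q2 ` carrier (free_on_pairs M2 N)"
    using push_left_closed[OF f] by blast
  show ?thesis
  proof
    assume ?exact
    then have eq: "?im
        = ?ker"
      unfolding exact_at_def img .
    show ?pointwise
    proof
      fix c assume c: "c \<in> carrier (free_on_pairs M2 N)"
      show "push_left g c \<in> tensor_relations R M3 N \<longleftrightarrow>
          (\<exists>d\<in>carrier (free_on_pairs M1 N). c - push_left f d \<in> tensor_relations R M2 N)"
        unfolding ker[OF c, symmetric] mem[OF c, symmetric] eq ..
    qed
  next
    assume *: ?pointwise
    have "C \<in> ?im \<longleftrightarrow>
        C \<in> ?ker" for C
    proof (cases "C \<in> ?q2 ` carrier (free_on_pairs M2 N)")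
      case True
      then obtain c where c: "c \<in> carrier (free_on_pairs M2 N)" "C = ?q2 c" by blast
      then show ?thesis using ker[OF c(1)] mem[OF c(1)] * by simp
    next
      case False
      then show ?thesis using imgsub kersub by blast
    qed
    then show ?exact
      unfolding exact_at_def img by blast
  qed
qed

lemma lin_maps_finsum:
  assumes M: "module R M" and M': "module R M'" and f: "f \<in> lin_maps R M M'"
    and S: "finite S" "\<And>i. i \<in> S \<Longrightarrow> a i \<in> carrier R" "\<And>i. i \<in> S \<Longrightarrow> x i \<in> carrier M"
  shows "f (\<Oplus>\<^bsub>M\<^esub>i\<in>S. a i \<odot>\<^bsub>M\<^esub> x i) = (\<Oplus>\<^bsub>M'\<^esub>i\<in>S. a i \<odot>\<^bsub>M'\<^esub> f (x i))"
  using S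
proof (induction S)
  interpret M: module R M by fact
  interpret M': module R M' by fact
  note add = lin_mapsD(2)[OF f] and cl = lin_mapsD(1)[OF f] and sm = lin_mapsD(3)[OF f]
  { case empty
    have "f \<zero>\<^bsub>M\<^esub> = \<zero>\<^bsub>M'\<^esub>" using sm[of "\<zero>\<^bsub>R\<^esub>" "\<zero>\<^bsub>M\<^esub>"] cl[of "\<zero>\<^bsub>M\<^esub>"] by simp
    then show ?case by simp
  next
    case (insert i S)
    have "(\<Oplus>\<^bsub>M\<^esub>i\<in>S. a i \<odot>\<^bsub>M\<^esub> x i) \<in> carrier M" using insert by (auto intro!: M.M.finsum_closed)
    then show ?case using insert cl
      by (subst M.M.finsum_insert, simp, simp, force, force, subst M'.M.finsum_insert, simp, simp, force, force)
        (simp add: add sm) }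
qed

lemma exact_at_add_monoid_iff:
  "exact_at (add_monoid M1) f (add_monoid M2) g (add_monoid M3) \<longleftrightarrow>
    f ` carrier M1 = {x \<in> carrier M2. g x = \<zero>\<^bsub>M3\<^esub>}"
  by (simp add: exact_at_def kernel_def)

lemma push_left_sum:
  "push_left f (\<Sum>i<k::nat. frag_of (x i, y i)) = (\<Sum>i<k. frag_of (f (x i), y i))"
  by (simp add: frag_extend_sum)

lemma sum_frag_of_closed:
  assumes "\<And>i. i < k \<Longrightarrow> x i \<in> carrier M" "\<And>i. i < k \<Longrightarrow> y i \<in> carrier N"
  shows "(\<Sum>i<k::nat. frag_of (x i, y i)) \<in> carrier (free_on_pairs M N)"
  by (rule sum_closed_free_Abelian_group) (use assms in auto)

text \<open>
  A tensor killed by \<open>g\<close> can be written \<open>\<Sum> u\<^sub>j \<otimes> w\<^sub>j\<close> with all \<open>g u\<^sub>j = 0\<close>, by the vanishing criterion. Each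
  \<open>u\<^sub>j\<close> then lifts along \<open>f\<close>.
\<close>

lemma equationally_flat_exact:
  fixes R :: "('a, 'c) ring_scheme" (structure)
  assumes N: "module R N" and flat: "equationally_flat R N"
    and M1: "module R M1" and M2: "module R M2" and M3: "module R M3"
    and f: "f \<in> lin_maps R M1 M2" and g: "g \<in> lin_maps R M2 M3"
    and exact: "exact_at (add_monoid M1) f (add_monoid M2) g (add_monoid M3)"
  shows "exact_at (tensor_product R M1 N) (tensor_map R M2 N f)
    (tensor_product R M2 N) (tensor_map R M3 N g) (tensor_product R M3 N)"
proof -
  interpret M2: module R M2 by fact
  have ex: "f ` carrier M1 = {x \<in> carrier M2. g x = \<zero>\<^bsub>M3\<^esub>}"
    using exact by (simp add: exact_at_add_monoid_iff)
  show ?thesis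
    unfolding exact_at_tensor_iff[OF M1 M2 M3 N f g]
  proof (intro ballI iffI)
    fix c assume c: "c \<in> carrier (free_on_pairs M2 N)" and gc: "push_left g c \<in> tensor_relations R M3 N"
    obtain k x y where x: "\<And>i. i < k \<Longrightarrow> x i \<in> carrier M2" and y: "\<And>i. i < k \<Longrightarrow> y i \<in> carrier N"
      and cxy: "c - (\<Sum>i<k::nat. frag_of (x i, y i)) \<in> tensor_relations R M2 N"
      using free_on_pairs_pure_tensors[OF M2 N c] by blast
    have "push_left g c - push_left g (c - (\<Sum>i<k. frag_of (x i, y i))) \<in> tensor_relations R M3 N"
      by (rule tensor_relations_diff[OF M3 N gc frag_extend_tensor_relations[OF M2 M3 N g cxy]])
    then have gxy: "(\<Sum>i<k. frag_of (g (x i), y i)) \<in> tensor_relations R M3 N"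
      by (simp add: frag_extend_diff push_left_sum)
    show "\<exists>d\<in>carrier (free_on_pairs M1 N). c - push_left f d \<in> tensor_relations R M2 N"
    proof (rule tensor_vanishing_criterion[OF M3 N flat _ y gxy])
      show "g (x i) \<in> carrier M3" if "i < k" for i using lin_mapsD(1)[OF g x[OF that]] .
      fix t w a
      assume w: "\<And>j. j < t \<Longrightarrow> w j \<in> carrier N" and a: "\<And>j i. j < t \<Longrightarrow> i < k \<Longrightarrow> a j i \<in> carrier R"
        and yw: "\<And>i. i < k \<Longrightarrow> y i = (\<Oplus>\<^bsub>N\<^esub>j\<in>{..<t::nat}. a j i \<odot>\<^bsub>N\<^esub> w j)"
        and zero: "\<And>j. j < t \<Longrightarrow> (\<Oplus>\<^bsub>M3\<^esub>i\<in>{..<k}. a j i \<odot>\<^bsub>M3\<^esub> g (x i)) = \<zero>\<^bsub>M3\<^esub>"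
      define u where "u j = (\<Oplus>\<^bsub>M2\<^esub>i\<in>{..<k}. a j i \<odot>\<^bsub>M2\<^esub> x i)" for j
      have "u j \<in> f ` carrier M1" if "j < t" for j
      proof -
        have "u j \<in> carrier M2" using a x that by (auto simp: u_def intro!: M2.M.finsum_closed)
        moreover have "g (u j) = \<zero>\<^bsub>M3\<^esub>"
          unfolding u_def using a x that zero[OF that] by (subst lin_maps_finsum[OF M2 M3 g]) auto
        ultimately show ?thesis using ex by blast
      qed
      then have "\<exists>m. m \<in> carrier M1 \<and> f m = u j" if "j < t" for j using that by fastforce
      then obtain m where m: "\<And>j. j < t \<Longrightarrow> m j \<in> carrier M1" "\<And>j. j < t \<Longrightarrow> f (m j) = u j" by metis
      have "(\<Sum>i<k. frag_of (x i, y i)) - (\<Sum>j<t. frag_of (u j, w j)) \<in> tensor_relations R M2 N"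
        unfolding u_def by (rule tensor_change_coordinates[OF M2 N x w a yw])
      then have "c - (\<Sum>i<k. frag_of (x i, y i)) + ((\<Sum>i<k. frag_of (x i, y i)) - (\<Sum>j<t. frag_of (u j, w j)))
          \<in> tensor_relations R M2 N" by (rule tensor_relations_add[OF M2 N cxy])
      then have "c - push_left f (\<Sum>j<t. frag_of (m j, w j)) \<in> tensor_relations R M2 N"
        using m by (simp add: push_left_sum)
      moreover have "(\<Sum>j<t. frag_of (m j, w j)) \<in> carrier (free_on_pairs M1 N)"
        by (rule sum_frag_of_closed) (use m w in auto)
      ultimately show ?thesis by blast
    qed
  next
    fix c assume c: "c \<in> carrier (free_on_pairs M2 N)"
      and "\<exists>d\<in>carrier (free_on_pairs M1 N). c - push_left f d \<in> tensor_relations R M2 N"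
    then obtain d where d: "d \<in> carrier (free_on_pairs M1 N)" "c - push_left f d \<in> tensor_relations R M2 N"
      by blast
    obtain k x y where x: "\<And>i. i < k \<Longrightarrow> x i \<in> carrier M1" and y: "\<And>i. i < k \<Longrightarrow> y i \<in> carrier N"
      and dxy: "d - (\<Sum>i<k::nat. frag_of (x i, y i)) \<in> tensor_relations R M1 N"
      using free_on_pairs_pure_tensors[OF M1 N d(1)] by blast
    have 1: "push_left g (c - push_left f d) \<in> tensor_relations R M3 N"
      by (rule frag_extend_tensor_relations[OF M2 M3 N g d(2)])
    have 2: "push_left g (push_left f (d - (\<Sum>i<k. frag_of (x i, y i)))) \<in> tensor_relations R M3 N"
      by (intro frag_extend_tensor_relations[OF M2 M3 N g] frag_extend_tensor_relations[OF M1 M2 N f] dxy)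
    have 3: "(\<Sum>i<k. frag_of (g (f (x i)), y i)) \<in> tensor_relations R M3 N"
    proof (rule tensor_relations_sum[OF M3 N])
      fix i assume i: "i \<in> {..<k}"
      then have "g (f (x i)) = \<zero>\<^bsub>M3\<^esub>" using ex x by blast
      then show "frag_of (g (f (x i)), y i) \<in> tensor_relations R M3 N"
        using tensor_relations_zero_left[OF M3 N] y i by simp
    qed
    show "push_left g c \<in> tensor_relations R M3 N"
      using tensor_relations_add[OF M3 N tensor_relations_add[OF M3 N 1 2] 3]
      by (simp add: frag_extend_diff push_left_sum)
  qed
qed

text \<open>
  For the converse the exactness is tested on tensors \<open>v \<otimes> e\<close>. The coordinates of \<open>e\<close> that witness a
  vanishing include a unit, and solving the corresponding equation for \<open>v\<close> gives the exactness.
\<close>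

theorem equationally_flat_imp_faithfully_flat:
  fixes R :: "('a, 'c) ring_scheme" (structure)
  assumes N: "module R N" and flat: "equationally_flat R N" and e: "e \<in> carrier N"
    and unit: "\<And>t a w. \<lbrakk>\<And>j. j < t \<Longrightarrow> a j \<in> carrier R; \<And>j. j < t \<Longrightarrow> w j \<in> carrier N;
        e = (\<Oplus>\<^bsub>N\<^esub>j\<in>{..<t::nat}. a j \<odot>\<^bsub>N\<^esub> w j)\<rbrakk> \<Longrightarrow> \<exists>j<t. a j \<in> Units R"
  shows "faithfully_flat_module TYPE('m) R N"
proof -
  have "exact_at (add_monoid M1) f (add_monoid M2) g (add_monoid M3)"
    if M1: "module R M1" and M2: "module R M2" and M3: "module R M3"
      and f: "f \<in> lin_maps R M1 M2" and g: "g \<in> lin_maps R M2 M3"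
      and exact: "exact_at (tensor_product R M1 N) (tensor_map R M2 N f)
        (tensor_product R M2 N) (tensor_map R M3 N g) (tensor_product R M3 N)"
    for M1 M2 M3 :: "('a, 'm) module" and f g
  proof -
    interpret M1: module R M1 by fact
    interpret M2: module R M2 by fact
    interpret M3: module R M3 by fact
    have ex: "push_left g c \<in> tensor_relations R M3 N \<longleftrightarrow>
        (\<exists>d\<in>carrier (free_on_pairs M1 N). c - push_left f d \<in> tensor_relations R M2 N)"
      if "c \<in> carrier (free_on_pairs M2 N)" for c
      using exact that unfolding exact_at_tensor_iff[OF M1 M2 M3 N f g] by blast
    have gf: "g (f m) = \<zero>\<^bsub>M3\<^esub>" if m: "m \<in> carrier M1" for m
    proof -
      have fm: "f m \<in> carrier M2" by (rule lin_mapsD(1)[OF f m])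
      have gfm: "g (f m) \<in> carrier M3" by (rule lin_mapsD(1)[OF g fm])
      have "frag_of (f m, e) \<in> carrier (free_on_pairs M2 N)" using fm e by simp
      moreover have "\<exists>d\<in>carrier (free_on_pairs M1 N). frag_of (f m, e) - push_left f d \<in> tensor_relations R M2 N"
        using m e by (intro bexI[of _ "frag_of (m, e)"]) (auto simp: tensor_relations_zero)
      ultimately have "push_left g (frag_of (f m, e)) \<in> tensor_relations R M3 N"
        by (subst ex) auto
      then have *: "(\<Sum>i<Suc 0. frag_of (g (f m), e)) \<in> tensor_relations R M3 N" by simp
      show ?thesis
      proof (rule tensor_vanishing_criterion[OF M3 N flat gfm e *])
        fix t w a
        assume w: "\<And>j. j < t \<Longrightarrow> w j \<in> carrier N" and a: "\<And>j i. j < t \<Longrightarrow> i < Suc 0 \<Longrightarrow> a j i \<in> carrier R"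
          and ew: "\<And>i. i < Suc 0 \<Longrightarrow> e = (\<Oplus>\<^bsub>N\<^esub>j\<in>{..<t::nat}. a j i \<odot>\<^bsub>N\<^esub> w j)"
          and zero: "\<And>j. j < t \<Longrightarrow> (\<Oplus>\<^bsub>M3\<^esub>i\<in>{..<Suc 0}. a j i \<odot>\<^bsub>M3\<^esub> g (f m)) = \<zero>\<^bsub>M3\<^esub>"
        have "\<exists>j<t. a j 0 \<in> Units R"
          by (rule unit[OF _ w ew[of 0]]) (use a in auto)
        then obtain j where j: "j < t" "a j 0 \<in> Units R" by blast
        have "(\<Oplus>\<^bsub>M3\<^esub>i\<in>{..<Suc 0}. a j i \<odot>\<^bsub>M3\<^esub> g (f m)) = a j 0 \<odot>\<^bsub>M3\<^esub> g (f m)"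
          using a[OF j(1)] gfm by (subst M3.M.finsum_lessThan_Suc) auto
        then have z: "a j 0 \<odot>\<^bsub>M3\<^esub> g (f m) = \<zero>\<^bsub>M3\<^esub>" using zero[OF j(1)] by simp
        have "g (f m) = inv (a j 0) \<odot>\<^bsub>M3\<^esub> (a j 0 \<odot>\<^bsub>M3\<^esub> g (f m))"
          using j a gfm by (simp add: M3.smult_assoc1[symmetric])
        then show ?thesis unfolding z using j by simp
      qed
    qed
    have im: "v \<in> f ` carrier M1" if v: "v \<in> carrier M2" "g v = \<zero>\<^bsub>M3\<^esub>" for v
    proof -
      have ve: "frag_of (v, e) \<in> carrier (free_on_pairs M2 N)" using v e by simp
      have "push_left g (frag_of (v, e)) \<in> tensor_relations R M3 N"
        using tensor_relations_zero_left[OF M3 N e] v by simp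
      then obtain d where d: "d \<in> carrier (free_on_pairs M1 N)"
        "frag_of (v, e) - push_left f d \<in> tensor_relations R M2 N"
        using ex[OF ve] by blast
      \<comment> \<open>Representing \<open>- d\<close> instead of \<open>d\<close> makes the relation below a plain sum of pure tensors.\<close>
      then have "- d \<in> carrier (free_on_pairs M1 N)" by simp
      then obtain k x y where x: "\<And>i. i < k \<Longrightarrow> x i \<in> carrier M1" and y: "\<And>i. i < k \<Longrightarrow> y i \<in> carrier N"
        and dxy: "- d - (\<Sum>i<k::nat. frag_of (x i, y i)) \<in> tensor_relations R M1 N"
        using free_on_pairs_pure_tensors[OF M1 N] by blast
      define x' where "x' i = (if i < k then f (x i) else v)" for i
      define y' where "y' i = (if i < k then y i else e)" for i
      have x': "x' i \<in> carrier M2" and y': "y' i \<in> carrier N" for i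
        using lin_mapsD(1)[OF f x] v y e by (auto simp: x'_def y'_def)
      have "push_left f (- d - (\<Sum>i<k. frag_of (x i, y i))) \<in> tensor_relations R M2 N"
        by (rule frag_extend_tensor_relations[OF M1 M2 N f dxy])
      from tensor_relations_diff[OF M2 N d(2) this]
      have "(\<Sum>i<k. frag_of (f (x i), y i)) + frag_of (v, e) \<in> tensor_relations R M2 N"
        by (simp add: frag_extend_diff frag_extend_minus push_left_sum algebra_simps)
      then have *: "(\<Sum>i<Suc k. frag_of (x' i, y' i)) \<in> tensor_relations R M2 N"
        by (simp add: x'_def y'_def)
      show ?thesis
      proof (rule tensor_vanishing_criterion[OF M2 N flat x' y' *])
        fix t w a
        assume w: "\<And>j. j < t \<Longrightarrow> w j \<in> carrier N" and a: "\<And>j i. j < t \<Longrightarrow> i < Suc k \<Longrightarrow> a j i \<in> carrier R"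
          and yw: "\<And>i. i < Suc k \<Longrightarrow> y' i = (\<Oplus>\<^bsub>N\<^esub>j\<in>{..<t::nat}. a j i \<odot>\<^bsub>N\<^esub> w j)"
          and zero: "\<And>j. j < t \<Longrightarrow> (\<Oplus>\<^bsub>M2\<^esub>i\<in>{..<Suc k}. a j i \<odot>\<^bsub>M2\<^esub> x' i) = \<zero>\<^bsub>M2\<^esub>"
        have ew: "e = (\<Oplus>\<^bsub>N\<^esub>j\<in>{..<t}. a j k \<odot>\<^bsub>N\<^esub> w j)" using yw[of k] by (simp add: y'_def)
        have "\<exists>j<t. a j k \<in> Units R"
          by (rule unit[OF _ w ew]) (use a in auto)
        then obtain j where j: "j < t" "a j k \<in> Units R" by blast
        define b where "b i = a j i" for i
        have b: "b i \<in> carrier R" if "i < Suc k" for i using a[OF j(1) that] by (simp add: b_def)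
        define p where "p = (\<Oplus>\<^bsub>M1\<^esub>i\<in>{..<k}. b i \<odot>\<^bsub>M1\<^esub> x i)"
        have p: "p \<in> carrier M1" unfolding p_def using b x by (auto intro!: M1.M.finsum_closed)
        have fp: "f p \<in> carrier M2" using lin_mapsD(1)[OF f p] .
        have "(\<Oplus>\<^bsub>M2\<^esub>i\<in>{..<k}. b i \<odot>\<^bsub>M2\<^esub> x' i) = (\<Oplus>\<^bsub>M2\<^esub>i\<in>{..<k}. b i \<odot>\<^bsub>M2\<^esub> f (x i))"
          using b lin_mapsD(1)[OF f x] by (intro M2.M.finsum_cong') (auto simp: x'_def)
        also have "\<dots> = f p"
          unfolding p_def using b x by (intro lin_maps_finsum[OF M1 M2 f, symmetric]) auto
        finally have "f p \<oplus>\<^bsub>M2\<^esub> b k \<odot>\<^bsub>M2\<^esub> v = \<zero>\<^bsub>M2\<^esub>"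
          using zero[OF j(1)] b x' by (simp add: b_def[symmetric] M2.M.finsum_lessThan_Suc) (simp add: x'_def)
        then have bv: "b k \<odot>\<^bsub>M2\<^esub> v = \<ominus>\<^bsub>M2\<^esub> f p"
          using fp b v by (metis M2.M.a_comm M2.M.minus_equality M2.smult_closed lessI)
        have bk: "b k \<in> Units R" "inv (b k) \<in> carrier R" using j by (auto simp: b_def)
        have "v = inv (b k) \<odot>\<^bsub>M2\<^esub> (b k \<odot>\<^bsub>M2\<^esub> v)"
          using bk v b by (simp add: M2.smult_assoc1[symmetric])
        also have "\<dots> = (\<ominus> (inv (b k))) \<odot>\<^bsub>M2\<^esub> f p"
          unfolding bv using bk fp by (simp add: M2.smult_r_minus M2.smult_l_minus)
        also have "\<dots> = f ((\<ominus> (inv (b k))) \<odot>\<^bsub>M1\<^esub> p)"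
          using bk p by (simp add: lin_mapsD(3)[OF f])
        finally show ?thesis by (rule image_eqI) (use bk p in auto)
      qed
    qed
    show ?thesis
      unfolding exact_at_add_monoid_iff using gf im lin_mapsD(1)[OF f] by blast
  qed
  then show ?thesis
    unfolding faithfully_flat_module_def
    using N equationally_flat_exact[OF N flat] by blast
qed

section \<open>Units in local rings\<close>

text \<open>
  A proper ideal containing a nonunit extends to a maximal ideal by Zorn's lemma, and there is only
  one maximal ideal.
\<close>

lemma local_ring_unit:
  fixes R (structure)
  assumes noeth: "noetherian_ring R" and loc: "local_ring R m" and x: "x \<in> carrier R" "x \<notin> m"
  shows "x \<in> Units R"
proof (rule ccontr)
  assume non: "x \<notin> Units R"
  interpret cring R using loc by (simp add: local_ring_def)
  let ?B = "{J. ideal J R \<and> x \<in> J \<and> \<one> \<notin> J}"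
  have "\<one> \<notin> PIdl x"
  proof
    assume "\<one> \<in> PIdl x"
    then obtain y where "y \<in> carrier R" "\<one> = y \<otimes> x" by (auto simp: cgenideal_def)
    then have "x \<in> Units R" using x(1) by (auto simp: Units_def m_comm intro!: bexI[of _ y])
    then show False using non by blast
  qed
  then have "PIdl x \<in> ?B" using cgenideal_ideal[OF x(1)] cgenideal_self[OF x(1)] by blast
  then have "?B \<noteq> {}" by blast
  then obtain J where JB: "J \<in> ?B" and max: "\<And>K. K \<in> ?B \<Longrightarrow> J \<subseteq> K \<Longrightarrow> K = J"
    by (rule noetherian_maximal_member[OF noeth]) blast+
  then have J: "ideal J R" "x \<in> J" "\<one> \<notin> J" by blast+
  have "maximalideal J R"
  proof (rule maximalidealI[OF J(1)])
    show "carrier R \<noteq> J" using J(3) by auto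
    fix K assume K: "ideal K R" "J \<subseteq> K" "K \<subseteq> carrier R"
    show "K = J \<or> K = carrier R"
    proof (cases "\<one> \<in> K")
      case True
      then show ?thesis using ideal.one_imp_carrier[OF K(1)] by blast
    next
      case False
      then show ?thesis using max[of K] K J by blast
    qed
  qed
  then have "J = m" using loc by (simp add: local_ring_def)
  then show False using J x by blast
qed

lemma local_ring_one_minus_unit:
  fixes R (structure)
  assumes noeth: "noetherian_ring R" and loc: "local_ring R m" and a: "a \<in> m" and c: "c \<in> carrier R"
  shows "\<one> \<ominus> a \<otimes> c \<in> Units R"
proof (rule local_ring_unit[OF noeth loc])
  interpret cring R using loc by (simp add: local_ring_def)
  interpret m: maximalideal m R using loc by (simp add: local_ring_def)
  have ac: "a \<otimes> c \<in> m" "a \<otimes> c \<in> carrier R" using m.I_r_closed[OF a c] m.Icarr by auto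
  show "\<one> \<ominus> a \<otimes> c \<in> carrier R" using ac by simp
  show "\<one> \<ominus> a \<otimes> c \<notin> m"
  proof
    assume "\<one> \<ominus> a \<otimes> c \<in> m"
    then have "(\<one> \<ominus> a \<otimes> c) \<oplus> a \<otimes> c \<in> m" using ac m.a_closed by blast
    then have "\<one> \<in> m" using ac by (simp add: minus_eq a_assoc l_neg)
    then show False using m.one_imp_carrier m.I_notcarr by auto
  qed
qed

section \<open>Ultrapowers of rings\<close>

locale ring_ultrapower =
  fixes A :: "'a ring" (structure) and I :: "'x set" and U :: "'x set set"
  assumes A_cring: "cring A" and ultrafilter: "ultrafilter_on I U"
begin

abbreviation "P \<equiv> power_ring A I"
abbreviation "S \<equiv> ultrapower A I U"
abbreviation "cls f \<equiv> null_ideal A I U +>\<^bsub>P\<^esub> f"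

definition almost :: "('x \<Rightarrow> bool) \<Rightarrow> bool" where "almost Q \<longleftrightarrow> {x \<in> I. Q x} \<in> U"

lemma almost_mono:
  assumes "almost Q" "\<And>x. x \<in> I \<Longrightarrow> Q x \<Longrightarrow> Q' x"
  shows "almost Q'"
proof -
  have "{x \<in> I. Q x} \<subseteq> {x \<in> I. Q' x}" using assms(2) by blast
  then show ?thesis using ultrafilter assms(1) unfolding ultrafilter_on_def almost_def by blast
qed

lemma almost_conj:
  assumes "almost Q" "almost Q'"
  shows "almost (\<lambda>x. Q x \<and> Q' x)"
proof -
  have "{x \<in> I. Q x \<and> Q' x} = {x \<in> I. Q x} \<inter> {x \<in> I. Q' x}" by blast
  then show ?thesis using ultrafilter assms unfolding ultrafilter_on_def almost_def by metis
qed

lemma almost_everywhere: "(\<And>x. x \<in> I \<Longrightarrow> Q x) \<Longrightarrow> almost Q"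
proof -
  assume "\<And>x. x \<in> I \<Longrightarrow> Q x"
  then have "{x \<in> I. Q x} = I" by blast
  then show ?thesis using ultrafilter unfolding ultrafilter_on_def almost_def by simp
qed

lemma almost_all_less:
  assumes "\<And>i. i < (r::nat) \<Longrightarrow> almost (Q i)"
  shows "almost (\<lambda>x. \<forall>i<r. Q i x)"
  using assms
proof (induction r)
  case 0
  show ?case by (rule almost_everywhere) simp
next
  case (Suc r)
  have "almost (\<lambda>x. (\<forall>i<r. Q i x) \<and> Q r x)" using Suc by (intro almost_conj) auto
  then show ?case by (rule almost_mono) (auto simp: less_Suc_eq)
qed

lemma almost_not_False: "\<not> almost (\<lambda>_. False)"
  using ultrafilter by (simp add: almost_def ultrafilter_on_def)

sublocale A: cring A by (rule A_cring)
sublocale P: cring P by (rule power_ring_cring) (rule A_cring)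
sublocale null: ideal "null_ideal A I U" P by (rule null_ideal_ideal) (rule A_cring ultrafilter)+
sublocale S: cring S
  unfolding ultrapower_def by (rule null.quotient_is_cring) (rule P.is_cring)
sublocale cls: ring_hom_cring P S "\<lambda>f. cls f"
  unfolding ultrapower_def by (rule null.rcos_ring_hom_cring) (rule P.is_cring)

lemma power_val: "f \<in> carrier P \<Longrightarrow> x \<in> I \<Longrightarrow> f x \<in> carrier A"
  by (auto simp: power_ring_def)

lemma power_restrict: "(\<And>x. x \<in> I \<Longrightarrow> f x \<in> carrier A) \<Longrightarrow> (\<lambda>x\<in>I. f x) \<in> carrier P"
  by (auto simp: power_ring_def)

lemma power_eval:
  assumes "x \<in> I"
  shows "(f \<otimes>\<^bsub>P\<^esub> g) x = f x \<otimes> g x" "(f \<oplus>\<^bsub>P\<^esub> g) x = f x \<oplus> g x" "\<zero>\<^bsub>P\<^esub> x = \<zero>" "\<one>\<^bsub>P\<^esub> x = \<one>"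
  using assms by (auto simp: power_ring_def)

lemma power_eval_finsum:
  assumes "x \<in> I" "finite K" "\<And>k. k \<in> K \<Longrightarrow> F k \<in> carrier P"
  shows "(\<Oplus>\<^bsub>P\<^esub>k\<in>K. F k) x = (\<Oplus>k\<in>K. F k x)"
  using assms(2,3)
  by (induction K) (auto simp: P.finsum_insert A.finsum_insert Pi_def power_eval[OF assms(1)] power_val[OF _ assms(1)])

lemma cls_eq_iff: "f \<in> carrier P \<Longrightarrow> g \<in> carrier P \<Longrightarrow> cls f = cls g \<longleftrightarrow> almost (\<lambda>x. f x = g x)"
  unfolding almost_def by (rule ultrapower_class_eq_iff[OF A_cring ultrafilter])

lemma cls_surj:
  assumes "s \<in> carrier S"
  obtains f where "f \<in> carrier P" "s = cls f"
  using assms unfolding ultrapower_def FactRing_def A_RCOSETS_def' by auto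

lemma representatives:
  assumes "\<And>i. i < (r::nat) \<Longrightarrow> y i \<in> carrier S"
  obtains f where "\<And>i. i < r \<Longrightarrow> f i \<in> carrier P" "\<And>i. i < r \<Longrightarrow> y i = cls (f i)"
proof -
  have "\<exists>f. f \<in> carrier P \<and> y i = cls f" if "i < r" for i
    by (rule cls_surj[OF assms[OF that]]) blast
  then obtain f where "\<And>i. i < r \<Longrightarrow> f i \<in> carrier P \<and> y i = cls (f i)" by metis
  then show ?thesis by (intro that[of f]) blast+
qed

lemma cls_lincomb:
  assumes "finite K" "\<And>k. k \<in> K \<Longrightarrow> F k \<in> carrier P" "\<And>k. k \<in> K \<Longrightarrow> G k \<in> carrier P"
  shows "(\<Oplus>\<^bsub>S\<^esub>k\<in>K. cls (F k) \<otimes>\<^bsub>S\<^esub> cls (G k)) = cls (\<Oplus>\<^bsub>P\<^esub>k\<in>K. F k \<otimes>\<^bsub>P\<^esub> G k)"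
proof -
  have "cls (\<Oplus>\<^bsub>P\<^esub>k\<in>K. F k \<otimes>\<^bsub>P\<^esub> G k) = (\<Oplus>\<^bsub>S\<^esub>k\<in>K. cls (F k \<otimes>\<^bsub>P\<^esub> G k))"
    using assms by (subst cls.hom_finsum) (auto simp: o_def)
  also have "\<dots> = (\<Oplus>\<^bsub>S\<^esub>k\<in>K. cls (F k) \<otimes>\<^bsub>S\<^esub> cls (G k))"
    using assms by (intro S.finsum_cong') auto
  finally show ?thesis ..
qed

text \<open>The theorem of Los, for the one kind of formula that occurs.\<close>

lemma lincomb_eq_iff:
  assumes "finite K" "\<And>k. k \<in> K \<Longrightarrow> F k \<in> carrier P" "\<And>k. k \<in> K \<Longrightarrow> G k \<in> carrier P" "h \<in> carrier P"
  shows "cls h = (\<Oplus>\<^bsub>S\<^esub>k\<in>K. cls (F k) \<otimes>\<^bsub>S\<^esub> cls (G k)) \<longleftrightarrow>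
    almost (\<lambda>x. h x = (\<Oplus>k\<in>K. F k x \<otimes> G k x))"
proof -
  have c: "(\<Oplus>\<^bsub>P\<^esub>k\<in>K. F k \<otimes>\<^bsub>P\<^esub> G k) \<in> carrier P"
    using assms by (auto intro!: P.finsum_closed)
  have ev: "(\<Oplus>\<^bsub>P\<^esub>k\<in>K. F k \<otimes>\<^bsub>P\<^esub> G k) x = (\<Oplus>k\<in>K. F k x \<otimes> G k x)" if x: "x \<in> I" for x
  proof -
    have "(\<Oplus>\<^bsub>P\<^esub>k\<in>K. F k \<otimes>\<^bsub>P\<^esub> G k) x = (\<Oplus>k\<in>K. (F k \<otimes>\<^bsub>P\<^esub> G k) x)"
      using assms by (intro power_eval_finsum[OF x]) auto
    also have "\<dots> = (\<Oplus>k\<in>K. F k x \<otimes> G k x)"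
      using assms x by (intro A.finsum_cong') (auto simp: power_eval power_val)
    finally show ?thesis .
  qed
  have "(\<Oplus>\<^bsub>S\<^esub>k\<in>K. cls (F k) \<otimes>\<^bsub>S\<^esub> cls (G k)) = cls (\<Oplus>\<^bsub>P\<^esub>k\<in>K. F k \<otimes>\<^bsub>P\<^esub> G k)"
    using assms by (intro cls_lincomb) auto
  then have "cls h = (\<Oplus>\<^bsub>S\<^esub>k\<in>K. cls (F k) \<otimes>\<^bsub>S\<^esub> cls (G k)) \<longleftrightarrow>
      almost (\<lambda>x. h x = (\<Oplus>\<^bsub>P\<^esub>k\<in>K. F k \<otimes>\<^bsub>P\<^esub> G k) x)"
    using cls_eq_iff[OF assms(4) c] by simp
  also have "\<dots> \<longleftrightarrow> almost (\<lambda>x. h x = (\<Oplus>k\<in>K. F k x \<otimes> G k x))"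
    using ev by (auto elim!: almost_mono)
  finally show ?thesis .
qed

lemma lincomb_zero_iff:
  assumes "finite K" "\<And>k. k \<in> K \<Longrightarrow> F k \<in> carrier P" "\<And>k. k \<in> K \<Longrightarrow> G k \<in> carrier P"
  shows "(\<Oplus>\<^bsub>S\<^esub>k\<in>K. cls (F k) \<otimes>\<^bsub>S\<^esub> cls (G k)) = \<zero>\<^bsub>S\<^esub> \<longleftrightarrow>
    almost (\<lambda>x. (\<Oplus>k\<in>K. F k x \<otimes> G k x) = \<zero>)"
proof -
  have "(\<Oplus>\<^bsub>S\<^esub>k\<in>K. cls (F k) \<otimes>\<^bsub>S\<^esub> cls (G k)) = \<zero>\<^bsub>S\<^esub> \<longleftrightarrow>
      cls \<zero>\<^bsub>P\<^esub> = (\<Oplus>\<^bsub>S\<^esub>k\<in>K. cls (F k) \<otimes>\<^bsub>S\<^esub> cls (G k))" by auto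
  also have "\<dots> \<longleftrightarrow> almost (\<lambda>x. \<zero>\<^bsub>P\<^esub> x = (\<Oplus>k\<in>K. F k x \<otimes> G k x))"
    by (rule lincomb_eq_iff) (use assms in auto)
  also have "\<dots> \<longleftrightarrow> almost (\<lambda>x. (\<Oplus>k\<in>K. F k x \<otimes> G k x) = \<zero>)"
    by (rule iffI; erule almost_mono) (auto simp: power_eval)
  finally show ?thesis .
qed

text \<open>Coordinates that exist at almost every index can be chosen to form elements of the ultrapower.\<close>

lemma combination_from_almost_all:
  assumes s: "\<And>j i. j < t \<Longrightarrow> i < r \<Longrightarrow> s j i \<in> carrier P" and h: "\<And>i. i < r \<Longrightarrow> h i \<in> carrier P"
    and comb: "almost (\<lambda>x. (\<lambda>i. h i x) \<in> combinations A r t (\<lambda>j i. s j i x))"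
  obtains z where "\<And>j. j < t \<Longrightarrow> z j \<in> carrier S"
    "\<And>i. i < r \<Longrightarrow> cls (h i) = (\<Oplus>\<^bsub>S\<^esub>j\<in>{..<t}. cls (s j i) \<otimes>\<^bsub>S\<^esub> z j)"
proof -
  define Z where "Z x = (SOME z. (\<forall>j<t. z j \<in> carrier A) \<and>
      (\<forall>i<r. h i x = (\<Oplus>j\<in>{..<t}. s j i x \<otimes> z j)))" for x
  define good where "good x \<longleftrightarrow> (\<lambda>i. h i x) \<in> combinations A r t (\<lambda>j i. s j i x)" for x
  have Z: "(\<forall>j<t. Z x j \<in> carrier A) \<and> (\<forall>i<r. h i x = (\<Oplus>j\<in>{..<t}. s j i x \<otimes> Z x j))" if "good x" for x
    using that unfolding Z_def good_def combinations_def mem_Collect_eq by (rule someI_ex)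
  define z where "z j = (\<lambda>x\<in>I. if good x then Z x j else \<zero>)" for j
  have z: "z j \<in> carrier P" if "j < t" for j
    unfolding z_def using Z that by (intro power_restrict) auto
  have "cls (h i) = (\<Oplus>\<^bsub>S\<^esub>j\<in>{..<t}. cls (s j i) \<otimes>\<^bsub>S\<^esub> cls (z j))" if i: "i < r" for i
  proof -
    have "almost (\<lambda>x. h i x = (\<Oplus>j\<in>{..<t}. s j i x \<otimes> z j x))"
    proof (rule almost_mono[OF comb])
      fix x assume x: "x \<in> I" and "(\<lambda>i. h i x) \<in> combinations A r t (\<lambda>j i. s j i x)"
      then have g: "good x" by (simp add: good_def)
      then have "h i x = (\<Oplus>j\<in>{..<t}. s j i x \<otimes> Z x j)" using Z i by blast
      also have "\<dots> = (\<Oplus>j\<in>{..<t}. s j i x \<otimes> z j x)"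
        using Z[OF g] x g i s by (intro A.finsum_cong') (auto simp: z_def power_val)
      finally show "h i x = (\<Oplus>j\<in>{..<t}. s j i x \<otimes> z j x)" .
    qed
    then show ?thesis using lincomb_eq_iff[of "{..<t}" "\<lambda>j. s j i" z "h i"] s z h i by simp
  qed
  then show ?thesis using that[of "\<lambda>j. cls (z j)"] z by simp
qed

end

lemma (in cring) syzygies_submodule:
  assumes b: "\<And>i. i < r \<Longrightarrow> b i \<in> carrier R"
  shows "vector_submodule R r {s. syzygy R r b s}"
  unfolding vector_submodule_def
proof (intro conjI ballI allI impI)
  show "(\<lambda>i. \<zero>) \<in> {s. syzygy R r b s}"
    using b by (auto simp: syzygy_def intro!: add.finprod_one_eqI)
  fix v assume v: "v \<in> {s. syzygy R r b s}"
  then have vc: "\<And>i. i < r \<Longrightarrow> v i \<in> carrier R" by (simp add: syzygy_def)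
  show "v i \<in> carrier R" if "i < r" for i using vc that .
  show "(\<lambda>i. v i \<oplus> w i) \<in> {s. syzygy R r b s}" if w: "w \<in> {s. syzygy R r b s}" for w
  proof -
    have wc: "\<And>i. i < r \<Longrightarrow> w i \<in> carrier R" using w by (simp add: syzygy_def)
    have "(\<Oplus>i\<in>{..<r}. b i \<otimes> (v i \<oplus> w i)) = (\<Oplus>i\<in>{..<r}. b i \<otimes> v i \<oplus> b i \<otimes> w i)"
      using b vc wc by (intro finsum_cong') (auto simp: r_distr)
    also have "\<dots> = (\<Oplus>i\<in>{..<r}. b i \<otimes> v i) \<oplus> (\<Oplus>i\<in>{..<r}. b i \<otimes> w i)"
      using b vc wc by (intro finsum_addf) auto
    finally show ?thesis using v w by (simp add: syzygy_def)
  qed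
  show "(\<lambda>i. c \<otimes> v i) \<in> {s. syzygy R r b s}" if c: "c \<in> carrier R" for c
  proof -
    have "(\<Oplus>i\<in>{..<r}. b i \<otimes> (c \<otimes> v i)) = (\<Oplus>i\<in>{..<r}. c \<otimes> (b i \<otimes> v i))"
      using b vc c by (intro finsum_cong') (auto simp: m_lcomm)
    also have "\<dots> = c \<otimes> (\<Oplus>i\<in>{..<r}. b i \<otimes> v i)"
      using b vc c by (intro finsum_rdistr[symmetric]) auto
    finally show ?thesis using v c by (simp add: syzygy_def)
  qed
  show "w \<in> {s. syzygy R r b s}" if w: "\<forall>i<r. w i = v i" for w
  proof -
    have "(\<Oplus>i\<in>{..<r}. b i \<otimes> w i) = (\<Oplus>i\<in>{..<r}. b i \<otimes> v i)"
      using b vc w by (intro finsum_cong') auto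
    then show ?thesis using v w by (simp add: syzygy_def)
  qed
qed

context ring_ultrapower
begin

text \<open>
  A family of vectors failing the pointwise hypothesis of \<open>vector_nakayama\<close> at almost every index
  would form a solution that violates \<open>divisible\<close>. So the pointwise hypothesis holds almost
  everywhere, although the solution modules may need arbitrarily many generators as the index
  varies.
\<close>

lemma ultrapower_nakayama:
  fixes r t :: nat
  assumes noeth: "noetherian_ring A" and loc: "local_ring A m" and a: "a \<in> m"
    and b: "\<And>i. i < r \<Longrightarrow> b i \<in> carrier P" and s: "\<And>j i. j < t \<Longrightarrow> i < r \<Longrightarrow> s j i \<in> carrier P"
    and syz: "\<And>j. j < t \<Longrightarrow> (\<Oplus>\<^bsub>S\<^esub>i\<in>{..<r}. cls (b i) \<otimes>\<^bsub>S\<^esub> cls (s j i)) = \<zero>\<^bsub>S\<^esub>"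
    and divisible: "\<And>y. \<lbrakk>\<And>i. i < r \<Longrightarrow> y i \<in> carrier S; (\<Oplus>\<^bsub>S\<^esub>i\<in>{..<r}. cls (b i) \<otimes>\<^bsub>S\<^esub> y i) = \<zero>\<^bsub>S\<^esub>\<rbrakk> \<Longrightarrow>
      \<exists>v z. (\<forall>i<r. v i \<in> carrier S) \<and> (\<Oplus>\<^bsub>S\<^esub>i\<in>{..<r}. cls (b i) \<otimes>\<^bsub>S\<^esub> v i) = \<zero>\<^bsub>S\<^esub> \<and> (\<forall>j<t. z j \<in> carrier S) \<and>
        (\<forall>i<r. y i = ultrapower_diagonal A I U a \<otimes>\<^bsub>S\<^esub> v i \<oplus>\<^bsub>S\<^esub> (\<Oplus>\<^bsub>S\<^esub>j\<in>{..<t}. cls (s j i) \<otimes>\<^bsub>S\<^esub> z j))"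
    and y: "\<And>i. i < r \<Longrightarrow> y i \<in> carrier S" "(\<Oplus>\<^bsub>S\<^esub>i\<in>{..<r}. cls (b i) \<otimes>\<^bsub>S\<^esub> y i) = \<zero>\<^bsub>S\<^esub>"
  obtains z where "\<And>j. j < t \<Longrightarrow> z j \<in> carrier S"
    "\<And>i. i < r \<Longrightarrow> y i = (\<Oplus>\<^bsub>S\<^esub>j\<in>{..<t}. cls (s j i) \<otimes>\<^bsub>S\<^esub> z j)"
proof -
  have ac: "a \<in> carrier A"
  proof -
    interpret m: maximalideal m A using loc by (simp add: local_ring_def)
    show ?thesis using m.Icarr a .
  qed
  define V where "V x = {v. syzygy A r (\<lambda>i. b i x) v}" for x
  define comb where "comb x = combinations A r t (\<lambda>j i. s j i x)" for x
  define good where "good x \<longleftrightarrow> (\<forall>v\<in>V x. \<exists>v'\<in>V x. \<exists>w\<in>comb x. \<forall>i<r. v i = a \<otimes> v' i \<oplus> w i)" for x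
  have Vsub: "vector_submodule A r (V x)" if "x \<in> I" for x
    unfolding V_def by (rule A.syzygies_submodule) (use b that power_val in auto)
  have "almost good"
  proof -
    define fails where "fails x v \<longleftrightarrow> v \<in> V x \<and> \<not> (\<exists>v'\<in>V x. \<exists>w\<in>comb x. \<forall>i<r. v i = a \<otimes> v' i \<oplus> w i)" for x v
    define bad where "bad x = (SOME v. fails x v)" for x
    have "fails x (bad x)" if "\<not> good x" for x
    proof -
      have "\<exists>v. fails x v" using that unfolding good_def fails_def by blast
      then show ?thesis unfolding bad_def by (rule someI_ex)
    qed
    then have bad: "bad x \<in> V x \<and> \<not> (\<exists>v'\<in>V x. \<exists>w\<in>comb x. \<forall>i<r. bad x i = a \<otimes> v' i \<oplus> w i)" if "\<not> good x" for x
      using that unfolding fails_def by blast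
    define h where "h i = (\<lambda>x\<in>I. if good x then \<zero> else bad x i)" for i
    have h: "h i \<in> carrier P" if "i < r" for i
      unfolding h_def by (rule power_restrict) (use bad that in \<open>auto simp: V_def syzygy_def\<close>)
    have hrel: "(\<Oplus>i\<in>{..<r}. b i x \<otimes> h i x) = \<zero>" if x: "x \<in> I" for x
    proof (cases "good x")
      case True
      then show ?thesis using x b by (auto simp: h_def power_val intro!: A.add.finprod_one_eqI)
    next
      case False
      then have "(\<Oplus>i\<in>{..<r}. b i x \<otimes> h i x) = (\<Oplus>i\<in>{..<r}. b i x \<otimes> bad x i)"
        using x b bad[OF False] by (intro A.finsum_cong') (auto simp: h_def power_val V_def syzygy_def)
      then show ?thesis using bad[OF False] by (simp add: V_def syzygy_def)
    qed
    have "(\<Oplus>\<^bsub>S\<^esub>i\<in>{..<r}. cls (b i) \<otimes>\<^bsub>S\<^esub> cls (h i)) = \<zero>\<^bsub>S\<^esub>"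
      by (subst lincomb_zero_iff) (use b h hrel in \<open>auto intro!: almost_everywhere\<close>)
    from divisible[OF _ this] h obtain v z where v: "\<forall>i<r. v i \<in> carrier S"
      "(\<Oplus>\<^bsub>S\<^esub>i\<in>{..<r}. cls (b i) \<otimes>\<^bsub>S\<^esub> v i) = \<zero>\<^bsub>S\<^esub>" and z: "\<forall>j<t. z j \<in> carrier S"
      and hv: "\<forall>i<r. cls (h i) = ultrapower_diagonal A I U a \<otimes>\<^bsub>S\<^esub> v i \<oplus>\<^bsub>S\<^esub> (\<Oplus>\<^bsub>S\<^esub>j\<in>{..<t}. cls (s j i) \<otimes>\<^bsub>S\<^esub> z j)"
      by auto
    obtain v0 where v0: "\<And>i. i < r \<Longrightarrow> v0 i \<in> carrier P" "\<And>i. i < r \<Longrightarrow> v i = cls (v0 i)"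
      using representatives[of r v] v(1) by blast
    obtain z0 where z0: "\<And>j. j < t \<Longrightarrow> z0 j \<in> carrier P" "\<And>j. j < t \<Longrightarrow> z j = cls (z0 j)"
      using representatives[of t z] z by blast
    have "(\<Oplus>\<^bsub>S\<^esub>i\<in>{..<r}. cls (b i) \<otimes>\<^bsub>S\<^esub> cls (v0 i)) = (\<Oplus>\<^bsub>S\<^esub>i\<in>{..<r}. cls (b i) \<otimes>\<^bsub>S\<^esub> v i)"
      using b v0 v by (intro S.finsum_cong') auto
    then have v_almost: "almost (\<lambda>x. (\<Oplus>i\<in>{..<r}. b i x \<otimes> v0 i x) = \<zero>)"
      using lincomb_zero_iff[of "{..<r}" b v0] b v0 v by simp
    have h_almost: "almost (\<lambda>x. h i x = a \<otimes> v0 i x \<oplus> (\<Oplus>j\<in>{..<t}. s j i x \<otimes> z0 j x))" if i: "i < r" for i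
    proof -
      define da where "da = (\<lambda>x\<in>I. a)"
      have da: "da \<in> carrier P" "ultrapower_diagonal A I U a = cls da"
        using ac by (auto simp: da_def ultrapower_diagonal_def intro!: power_restrict)
      define e where "e = (\<Oplus>\<^bsub>P\<^esub>j\<in>{..<t}. s j i \<otimes>\<^bsub>P\<^esub> z0 j)"
      have e: "e \<in> carrier P" unfolding e_def using s z0 i by (auto intro!: P.finsum_closed)
      have "(\<Oplus>\<^bsub>S\<^esub>j\<in>{..<t}. cls (s j i) \<otimes>\<^bsub>S\<^esub> z j) = (\<Oplus>\<^bsub>S\<^esub>j\<in>{..<t}. cls (s j i) \<otimes>\<^bsub>S\<^esub> cls (z0 j))"
        using s z0 i by (intro S.finsum_cong') auto
      also have "\<dots> = cls e" unfolding e_def using s z0 i by (intro cls_lincomb) auto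
      finally have "cls (h i) = cls (da \<otimes>\<^bsub>P\<^esub> v0 i \<oplus>\<^bsub>P\<^esub> e)"
        using hv v0 da e i by simp
      then have "almost (\<lambda>x. h i x = (da \<otimes>\<^bsub>P\<^esub> v0 i \<oplus>\<^bsub>P\<^esub> e) x)"
        by (subst (asm) cls_eq_iff) (use h v0 da e i in auto)
      then show ?thesis
      proof (rule almost_mono)
        fix x assume x: "x \<in> I" and "h i x = (da \<otimes>\<^bsub>P\<^esub> v0 i \<oplus>\<^bsub>P\<^esub> e) x"
        moreover have "e x = (\<Oplus>j\<in>{..<t}. (s j i \<otimes>\<^bsub>P\<^esub> z0 j) x)"
          unfolding e_def using s z0 i by (intro power_eval_finsum[OF x]) auto
        moreover have "\<dots> = (\<Oplus>j\<in>{..<t}. s j i x \<otimes> z0 j x)"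
          using s z0 i x by (intro A.finsum_cong') (auto simp: power_eval power_val)
        ultimately show "h i x = a \<otimes> v0 i x \<oplus> (\<Oplus>j\<in>{..<t}. s j i x \<otimes> z0 j x)"
          by (simp add: power_eval da_def)
      qed
    qed
    show ?thesis
    proof (rule almost_mono[OF almost_conj[OF v_almost almost_all_less[OF h_almost]]])
      fix x assume x: "x \<in> I" and *: "(\<Oplus>i\<in>{..<r}. b i x \<otimes> v0 i x) = \<zero> \<and>
        (\<forall>i<r. h i x = a \<otimes> v0 i x \<oplus> (\<Oplus>j\<in>{..<t}. s j i x \<otimes> z0 j x))"
      show "good x"
      proof (rule ccontr)
        assume "\<not> good x"
        moreover from this have "bad x i = h i x" for i using x by (simp add: h_def)
        moreover have "(\<lambda>i. v0 i x) \<in> V x" using * v0 x by (simp add: V_def syzygy_def power_val)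
        moreover have "(\<lambda>i. \<Oplus>j\<in>{..<t}. s j i x \<otimes> z0 j x) \<in> comb x"
          unfolding comb_def combinations_def using z0 x
          by (auto simp: power_val intro!: exI[of _ "\<lambda>j. z0 j x"])
        ultimately show False using bad[of x] * by fastforce
      qed
    qed
  qed
  moreover have "almost (\<lambda>x. \<forall>j<t. (\<lambda>i. s j i x) \<in> V x)"
  proof (rule almost_all_less)
    fix j assume j: "j < t"
    have "almost (\<lambda>x. (\<Oplus>i\<in>{..<r}. b i x \<otimes> s j i x) = \<zero>)"
      using syz[OF j] lincomb_zero_iff[of "{..<r}" b "s j"] b s j by simp
    then show "almost (\<lambda>x. (\<lambda>i. s j i x) \<in> V x)"
      by (rule almost_mono) (use s j in \<open>auto simp: V_def syzygy_def power_val\<close>)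
  qed
  ultimately have "almost (\<lambda>x. good x \<and> (\<forall>j<t. (\<lambda>i. s j i x) \<in> V x))" by (rule almost_conj)
  then have V_almost: "almost (\<lambda>x. V x \<subseteq> comb x)"
  proof (rule almost_mono)
    fix x assume x: "x \<in> I" and *: "good x \<and> (\<forall>j<t. (\<lambda>i. s j i x) \<in> V x)"
    show "V x \<subseteq> comb x"
      unfolding comb_def
      by (rule vector_nakayama[OF noeth A_cring Vsub[OF x] ac local_ring_one_minus_unit[OF noeth loc a]])
        (use * in \<open>auto simp: good_def comb_def\<close>)
  qed
  obtain y0 where y0: "\<And>i. i < r \<Longrightarrow> y0 i \<in> carrier P" "\<And>i. i < r \<Longrightarrow> y i = cls (y0 i)"
    using representatives[of r y] y(1) by blast
  have "(\<Oplus>\<^bsub>S\<^esub>i\<in>{..<r}. cls (b i) \<otimes>\<^bsub>S\<^esub> cls (y0 i)) = (\<Oplus>\<^bsub>S\<^esub>i\<in>{..<r}. cls (b i) \<otimes>\<^bsub>S\<^esub> y i)"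
    using b y0 y by (intro S.finsum_cong') auto
  then have "almost (\<lambda>x. (\<Oplus>i\<in>{..<r}. b i x \<otimes> y0 i x) = \<zero>)"
    using lincomb_zero_iff[of "{..<r}" b y0] b y0 y by simp
  then have y_almost: "almost (\<lambda>x. (\<lambda>i. y0 i x) \<in> V x)"
    by (rule almost_mono) (use y0 in \<open>auto simp: V_def syzygy_def power_val\<close>)
  have "almost (\<lambda>x. (\<lambda>i. y0 i x) \<in> combinations A r t (\<lambda>j i. s j i x))"
    by (rule almost_mono[OF almost_conj[OF V_almost y_almost]]) (auto simp: comb_def)
  then obtain z where "\<And>j. j < t \<Longrightarrow> z j \<in> carrier S"
    "\<And>i. i < r \<Longrightarrow> cls (y0 i) = (\<Oplus>\<^bsub>S\<^esub>j\<in>{..<t}. cls (s j i) \<otimes>\<^bsub>S\<^esub> z j)"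
    using combination_from_almost_all[of t r s y0] s y0 by blast
  then show ?thesis using that[of z] y0 by simp
qed

end

section \<open>Maps to an ultrapower\<close>

lemma (in module) trivial_relation_in_span:
  assumes y: "trivial_relation R M r b y"
    and s: "\<And>j i. j < t \<Longrightarrow> i < r \<Longrightarrow> s j i \<in> carrier R"
    and span: "{v. syzygy R r b v} \<subseteq> combinations R r t s"
  shows "\<exists>z. (\<forall>j<t. z j \<in> carrier M) \<and> (\<forall>i<r. y i = (\<Oplus>\<^bsub>M\<^esub>j\<in>{..<t}. s j i \<odot>\<^bsub>M\<^esub> z j))"
  using y
proof induction
  case (zero y)
  then show ?case using s
    by (auto intro!: exI[of _ "\<lambda>_. \<zero>\<^bsub>M\<^esub>"] M.add.finprod_one_eqI[symmetric])
next
  case (add_syzygy x v z' y)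
  then obtain z where z: "\<forall>j<t. z j \<in> carrier M" "\<forall>i<r. x i = (\<Oplus>\<^bsub>M\<^esub>j\<in>{..<t}. s j i \<odot>\<^bsub>M\<^esub> z j)" by blast
  have "v \<in> combinations R r t s" using span add_syzygy.hyps(2) by blast
  then obtain c where c: "\<forall>j<t. c j \<in> carrier R" "\<forall>i<r. v i = (\<Oplus>j\<in>{..<t}. s j i \<otimes> c j)"
    unfolding combinations_def by blast
  have "y i = (\<Oplus>\<^bsub>M\<^esub>j\<in>{..<t}. s j i \<odot>\<^bsub>M\<^esub> (z j \<oplus>\<^bsub>M\<^esub> c j \<odot>\<^bsub>M\<^esub> z'))" if i: "i < r" for i
    using add_syzygy.hyps(4)[OF i] z c s i add_syzygy.hyps(3) by (subst finsum_smult_add_smult) auto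
  then show ?case using z c add_syzygy.hyps(3)
    by (intro exI[of _ "\<lambda>j. z j \<oplus>\<^bsub>M\<^esub> c j \<odot>\<^bsub>M\<^esub> z'"]) auto
qed

locale ultrapower_algebra = ring_ultrapower A I U
  for A :: "'a ring" (structure) and I :: "'x set" and U :: "'x set set" +
  fixes m :: "'a set" and B :: "'b ring" and n :: "'b set" and \<iota> :: "'a \<Rightarrow> 'b"
    and \<psi> :: "'b \<Rightarrow> ('x \<Rightarrow> 'a) set"
  assumes A_noetherian: "noetherian_ring A" and A_local: "local_ring A m"
    and B_noetherian: "noetherian_ring B" and B_local: "local_ring B n"
    and \<iota>_hom: "\<iota> \<in> ring_hom A B" and n_eq: "n = Idl\<^bsub>B\<^esub> (\<iota> ` m)"
    and \<psi>_hom: "\<psi> \<in> ring_hom B S"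
    and \<psi>_\<iota>: "\<And>a. a \<in> carrier A \<Longrightarrow> \<psi> (\<iota> a) = ultrapower_diagonal A I U a"
begin

sublocale B: cring B using B_local by (simp add: local_ring_def)
sublocale m: maximalideal m A using A_local by (simp add: local_ring_def)
sublocale n: maximalideal n B using B_local by (simp add: local_ring_def)
sublocale \<iota>: ring_hom_cring A B \<iota>
  by (simp add: ring_hom_cring_def ring_hom_cring_axioms_def \<iota>_hom A_cring B.is_cring)
sublocale \<psi>: ring_hom_cring B S \<psi>
  by (simp add: ring_hom_cring_def ring_hom_cring_axioms_def \<psi>_hom B.is_cring S.is_cring)

abbreviation "N \<equiv> module_via \<psi> S"

sublocale N: module B N
  by (rule module_via_module) (rule B.is_cring S.is_cring \<psi>_hom)+

lemma N_simps:
  "carrier N = carrier S" "\<zero>\<^bsub>N\<^esub> = \<zero>\<^bsub>S\<^esub>" "x \<oplus>\<^bsub>N\<^esub> y = x \<oplus>\<^bsub>S\<^esub> y" "b \<odot>\<^bsub>N\<^esub> y = \<psi> b \<otimes>\<^bsub>S\<^esub> y"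
  by (simp_all add: module_via_def)

definition const :: "'a \<Rightarrow> 'x \<Rightarrow> 'a" where "const a = (\<lambda>x\<in>I. a)"

lemma const_closed: "a \<in> carrier A \<Longrightarrow> const a \<in> carrier P"
  unfolding const_def by (rule power_restrict)

lemma const_eval: "x \<in> I \<Longrightarrow> const a x = a"
  by (simp add: const_def)

lemma \<psi>_\<iota>_cls: "a \<in> carrier A \<Longrightarrow> \<psi> (\<iota> a) = cls (const a)"
  by (simp add: \<psi>_\<iota> const_def ultrapower_diagonal_def)

text \<open>Because \<open>n\<close> is the extension of \<open>m\<close>, generators of \<open>m\<close> map to generators of \<open>n\<close>.\<close>

lemma maximal_ideal_generators:
  obtains r g where "generates A r g m" "generates B r (\<lambda>i. \<iota> (g i)) n"
proof -
  obtain r g where g: "generates A r g m"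
    using noetherian_generators[OF A_noetherian A_cring m.ideal_axioms] .
  have gm: "g i \<in> m" and gc: "g i \<in> carrier A" if "i < r" for i
    using g that m.Icarr unfolding generates_def by blast+
  let ?J = "Idl\<^bsub>B\<^esub> ((\<lambda>i. \<iota> (g i)) ` {..<r})"
  have sub: "(\<lambda>i. \<iota> (g i)) ` {..<r} \<subseteq> carrier B" using gc by auto
  have J: "ideal ?J B" by (rule B.genideal_ideal[OF sub])
  have \<iota>m: "\<iota> ` m \<subseteq> carrier B" using m.Icarr by auto
  have "\<iota> x \<in> ?J" if x: "x \<in> m" for x
  proof -
    obtain c where c: "\<forall>i<r. c i \<in> carrier A" "x = (\<Oplus>i\<in>{..<r}. g i \<otimes> c i)"
      using g x unfolding generates_def by blast
    have "\<iota> x = (\<Oplus>\<^bsub>B\<^esub>i\<in>{..<r}. \<iota> (g i \<otimes> c i))"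
      unfolding c(2) using c gc by (subst \<iota>.hom_finsum) (auto simp: o_def)
    also have "\<dots> = (\<Oplus>\<^bsub>B\<^esub>i\<in>{..<r}. \<iota> (g i) \<otimes>\<^bsub>B\<^esub> \<iota> (c i))"
      using c gc by (intro B.finsum_cong') auto
    also have "\<dots> \<in> ?J"
      using B.genideal_self[OF sub] c
      by (intro ideal.linear_combination_in_ideal[OF J B.is_cring]) auto
    finally show ?thesis .
  qed
  then have "n \<subseteq> ?J" unfolding n_eq by (intro B.genideal_minimal[OF J]) blast
  moreover have "?J \<subseteq> n"
    using B.genideal_self[OF \<iota>m] gm unfolding n_eq[symmetric]
    by (intro B.genideal_minimal[OF n.ideal_axioms]) blast
  ultimately have "n = ?J" by blast
  then have "generates B r (\<lambda>i. \<iota> (g i)) n"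
    using B.genideal_generates[of r "\<lambda>i. \<iota> (g i)"] gc by simp
  with g show ?thesis by (rule that)
qed

lemma \<psi>_lincomb:
  assumes "finite K" "\<And>i. i \<in> K \<Longrightarrow> b i \<in> carrier B" "\<And>i. i \<in> K \<Longrightarrow> c i \<in> carrier B"
  shows "\<psi> (\<Oplus>\<^bsub>B\<^esub>i\<in>K. b i \<otimes>\<^bsub>B\<^esub> c i) = (\<Oplus>\<^bsub>S\<^esub>i\<in>K. \<psi> (b i) \<otimes>\<^bsub>S\<^esub> \<psi> (c i))"
proof -
  have "\<psi> (\<Oplus>\<^bsub>B\<^esub>i\<in>K. b i \<otimes>\<^bsub>B\<^esub> c i) = (\<Oplus>\<^bsub>S\<^esub>i\<in>K. \<psi> (b i \<otimes>\<^bsub>B\<^esub> c i))"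
    using assms by (subst \<psi>.hom_finsum) (auto simp: o_def)
  also have "\<dots> = (\<Oplus>\<^bsub>S\<^esub>i\<in>K. \<psi> (b i) \<otimes>\<^bsub>S\<^esub> \<psi> (c i))"
    using assms by (intro S.finsum_cong') auto
  finally show ?thesis .
qed

text \<open>
  The syzygies over \<open>A\<close> of generators of \<open>m\<close> are finitely generated, and the same generators work at
  every index of the ultrapower. Their images in \<open>B\<close> are syzygies.
\<close>

lemma closed_point_relations_trivial:
  assumes g: "generates A r g m"
  shows "relations_trivial B N r (\<lambda>i. \<iota> (g i))"
  unfolding relations_trivial_def
proof (intro allI impI)
  fix y assume "linear_relation B N r (\<lambda>i. \<iota> (g i)) y"
  then have y: "\<And>i. i < r \<Longrightarrow> y i \<in> carrier S" and rel: "(\<Oplus>\<^bsub>S\<^esub>i\<in>{..<r}. \<psi> (\<iota> (g i)) \<otimes>\<^bsub>S\<^esub> y i) = \<zero>\<^bsub>S\<^esub>"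
    by (auto simp: linear_relation_def N_simps)
  have gc: "g i \<in> carrier A" if "i < r" for i using g that m.Icarr unfolding generates_def by blast
  have V: "vector_submodule A r {s. syzygy A r g s}" by (rule A.syzygies_submodule) (rule gc)
  obtain t s where s: "\<And>j. j < t \<Longrightarrow> s j \<in> {s. syzygy A r g s}"
    and span: "{s. syzygy A r g s} \<subseteq> combinations A r t s"
    using vector_submodule_finitely_generated[OF A_noetherian A_cring V] by blast
  have sc: "s j i \<in> carrier A" if "j < t" "i < r" for j i using s that by (simp add: syzygy_def)
  obtain f where f: "\<And>i. i < r \<Longrightarrow> f i \<in> carrier P" "\<And>i. i < r \<Longrightarrow> y i = cls (f i)"
    using representatives[of r y] y by blast
  have "(\<Oplus>\<^bsub>S\<^esub>i\<in>{..<r}. cls (const (g i)) \<otimes>\<^bsub>S\<^esub> cls (f i)) = (\<Oplus>\<^bsub>S\<^esub>i\<in>{..<r}. \<psi> (\<iota> (g i)) \<otimes>\<^bsub>S\<^esub> y i)"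
    using f gc by (intro S.finsum_cong') (auto simp: \<psi>_\<iota>_cls const_closed)
  then have "almost (\<lambda>x. (\<Oplus>i\<in>{..<r}. const (g i) x \<otimes> f i x) = \<zero>)"
    using lincomb_zero_iff[of "{..<r}" "\<lambda>i. const (g i)" f] f gc rel by (simp add: const_closed)
  then have "almost (\<lambda>x. (\<lambda>i. f i x) \<in> combinations A r t (\<lambda>j i. const (s j i) x))"
  proof (rule almost_mono)
    fix x assume x: "x \<in> I" and "(\<Oplus>i\<in>{..<r}. const (g i) x \<otimes> f i x) = \<zero>"
    then have "syzygy A r g (\<lambda>i. f i x)" using f by (simp add: syzygy_def const_eval power_val)
    then show "(\<lambda>i. f i x) \<in> combinations A r t (\<lambda>j i. const (s j i) x)"
      using span x by (auto simp: const_eval)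
  qed
  then obtain z where z: "\<And>j. j < t \<Longrightarrow> z j \<in> carrier S"
    and fz: "\<And>i. i < r \<Longrightarrow> cls (f i) = (\<Oplus>\<^bsub>S\<^esub>j\<in>{..<t}. cls (const (s j i)) \<otimes>\<^bsub>S\<^esub> z j)"
    using combination_from_almost_all[of t r "\<lambda>j i. const (s j i)" f] sc f const_closed by blast
  show "trivial_relation B N r (\<lambda>i. \<iota> (g i)) y"
  proof (rule N.trivial_relation_sum)
    show "z j \<in> carrier N" if "j < t" for j using z that by (simp add: N_simps)
    show "syzygy B r (\<lambda>i. \<iota> (g i)) (\<lambda>i. \<iota> (s j i))" if j: "j < t" for j
    proof -
      have "(\<Oplus>\<^bsub>B\<^esub>i\<in>{..<r}. \<iota> (g i) \<otimes>\<^bsub>B\<^esub> \<iota> (s j i)) = (\<Oplus>\<^bsub>B\<^esub>i\<in>{..<r}. \<iota> (g i \<otimes> s j i))"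
        using gc sc j by (intro B.finsum_cong') auto
      also have "\<dots> = \<iota> (\<Oplus>i\<in>{..<r}. g i \<otimes> s j i)"
        using gc sc j by (subst \<iota>.hom_finsum) (auto simp: o_def)
      also have "\<dots> = \<zero>\<^bsub>B\<^esub>" using s[OF j] by (simp add: syzygy_def)
      finally show ?thesis using sc j by (simp add: syzygy_def)
    qed
    show "y i = (\<Oplus>\<^bsub>N\<^esub>j\<in>{..<t}. \<iota> (s j i) \<odot>\<^bsub>N\<^esub> z j)" if i: "i < r" for i
    proof -
      have "(\<Oplus>\<^bsub>S\<^esub>j\<in>{..<t}. \<psi> (\<iota> (s j i)) \<otimes>\<^bsub>S\<^esub> z j) = (\<Oplus>\<^bsub>S\<^esub>j\<in>{..<t}. cls (const (s j i)) \<otimes>\<^bsub>S\<^esub> z j)"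
        using sc z i by (intro S.finsum_cong') (auto simp: \<psi>_\<iota>_cls const_closed)
      then show ?thesis using fz[OF i] f i by (simp add: N_simps)
    qed
  qed
qed

text \<open>
  The syzygies over \<open>B\<close> of \<open>b\<close> have finitely many generators, so \<open>ultrapower_nakayama\<close> applies to
  representatives of the images of \<open>b\<close> and of these generators.
\<close>

lemma nakayama_relations_trivial:
  assumes b: "\<And>i. i < r \<Longrightarrow> b i \<in> carrier B" and p: "p \<in> \<iota> ` m"
    and divisible: "\<And>y. linear_relation B N r b y \<Longrightarrow> \<exists>v. linear_relation B N r b v \<and>
      trivial_relation B N r b (\<lambda>i. y i \<oplus>\<^bsub>N\<^esub> p \<odot>\<^bsub>N\<^esub> v i)"
  shows "relations_trivial B N r b"
  unfolding relations_trivial_def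
proof (intro allI impI)
  fix y assume "linear_relation B N r b y"
  then have y: "\<And>i. i < r \<Longrightarrow> y i \<in> carrier S" and rel: "(\<Oplus>\<^bsub>S\<^esub>i\<in>{..<r}. \<psi> (b i) \<otimes>\<^bsub>S\<^esub> y i) = \<zero>\<^bsub>S\<^esub>"
    by (auto simp: linear_relation_def N_simps)
  obtain a where a: "a \<in> m" "p = \<iota> a" using p by blast
  then have ac: "a \<in> carrier A" using m.Icarr by blast
  have V: "vector_submodule B r {s. syzygy B r b s}" by (rule B.syzygies_submodule) (rule b)
  obtain t s where s: "\<And>j. j < t \<Longrightarrow> s j \<in> {s. syzygy B r b s}"
    and span: "{s. syzygy B r b s} \<subseteq> combinations B r t s"
    using vector_submodule_finitely_generated[OF B_noetherian B.is_cring V] by blast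
  have sc: "s j i \<in> carrier B" if "j < t" "i < r" for j i using s that by (simp add: syzygy_def)
  have \<psi>b: "\<psi> (b i) \<in> carrier S" if "i < r" for i using b that by simp
  obtain \<beta> where \<beta>: "\<And>i. i < r \<Longrightarrow> \<beta> i \<in> carrier P" "\<And>i. i < r \<Longrightarrow> \<psi> (b i) = cls (\<beta> i)"
    using representatives[of r "\<lambda>i. \<psi> (b i)"] \<psi>b by blast
  have "\<exists>f. (\<forall>i<r. f i \<in> carrier P) \<and> (\<forall>i<r. \<psi> (s j i) = cls (f i))" if "j < t" for j
    using representatives[of r "\<lambda>i. \<psi> (s j i)"] sc that by (metis \<psi>.hom_closed)
  then obtain \<sigma> where \<sigma>: "\<And>j i. j < t \<Longrightarrow> i < r \<Longrightarrow> \<sigma> j i \<in> carrier P"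
    "\<And>j i. j < t \<Longrightarrow> i < r \<Longrightarrow> \<psi> (s j i) = cls (\<sigma> j i)" by metis
  have to_\<beta>: "(\<Oplus>\<^bsub>S\<^esub>i\<in>{..<r}. cls (\<beta> i) \<otimes>\<^bsub>S\<^esub> v i) = (\<Oplus>\<^bsub>S\<^esub>i\<in>{..<r}. \<psi> (b i) \<otimes>\<^bsub>S\<^esub> v i)"
    if "\<And>i. i < r \<Longrightarrow> v i \<in> carrier S" for v
    using \<beta> \<psi>b that by (intro S.finsum_cong') auto
  have to_\<sigma>: "(\<Oplus>\<^bsub>S\<^esub>j\<in>{..<t}. cls (\<sigma> j i) \<otimes>\<^bsub>S\<^esub> z j) = (\<Oplus>\<^bsub>S\<^esub>j\<in>{..<t}. \<psi> (s j i) \<otimes>\<^bsub>S\<^esub> z j)"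
    if "i < r" "\<And>j. j < t \<Longrightarrow> z j \<in> carrier S" for i z
    using \<sigma> sc that by (intro S.finsum_cong') auto
  show "trivial_relation B N r b y"
  proof (rule ultrapower_nakayama[OF A_noetherian A_local a(1) \<beta>(1) \<sigma>(1) _ _ y])
    show "(\<Oplus>\<^bsub>S\<^esub>i\<in>{..<r}. cls (\<beta> i) \<otimes>\<^bsub>S\<^esub> y i) = \<zero>\<^bsub>S\<^esub>" using to_\<beta>[of y] y rel by simp
    show "(\<Oplus>\<^bsub>S\<^esub>i\<in>{..<r}. cls (\<beta> i) \<otimes>\<^bsub>S\<^esub> cls (\<sigma> j i)) = \<zero>\<^bsub>S\<^esub>" if j: "j < t" for j
    proof -
      have "(\<Oplus>\<^bsub>S\<^esub>i\<in>{..<r}. cls (\<beta> i) \<otimes>\<^bsub>S\<^esub> cls (\<sigma> j i)) = (\<Oplus>\<^bsub>S\<^esub>i\<in>{..<r}. \<psi> (b i) \<otimes>\<^bsub>S\<^esub> \<psi> (s j i))"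
        using \<beta> \<sigma> j b sc by (intro S.finsum_cong') auto
      also have "\<dots> = \<psi> (\<Oplus>\<^bsub>B\<^esub>i\<in>{..<r}. b i \<otimes>\<^bsub>B\<^esub> s j i)"
        using b sc j by (intro \<psi>_lincomb[symmetric]) auto
      finally show ?thesis using s[OF j] by (simp add: syzygy_def)
    qed
  next
    fix y assume y: "\<And>i. i < r \<Longrightarrow> y i \<in> carrier S"
      and "(\<Oplus>\<^bsub>S\<^esub>i\<in>{..<r}. cls (\<beta> i) \<otimes>\<^bsub>S\<^esub> y i) = \<zero>\<^bsub>S\<^esub>"
    then have "linear_relation B N r b y" using to_\<beta>[of y] by (simp add: linear_relation_def N_simps)
    from divisible[OF this] obtain v where v: "linear_relation B N r b v"
      "trivial_relation B N r b (\<lambda>i. y i \<oplus>\<^bsub>N\<^esub> p \<odot>\<^bsub>N\<^esub> v i)" by blast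
    from N.trivial_relation_in_span[OF v(2) sc span]
    obtain z where z: "\<forall>j<t. z j \<in> carrier S"
      "\<forall>i<r. y i \<oplus>\<^bsub>S\<^esub> \<psi> p \<otimes>\<^bsub>S\<^esub> v i = (\<Oplus>\<^bsub>S\<^esub>j\<in>{..<t}. \<psi> (s j i) \<otimes>\<^bsub>S\<^esub> z j)"
      by (auto simp: N_simps)
    have vc: "\<And>i. i < r \<Longrightarrow> v i \<in> carrier S" and vrel: "(\<Oplus>\<^bsub>S\<^esub>i\<in>{..<r}. \<psi> (b i) \<otimes>\<^bsub>S\<^esub> v i) = \<zero>\<^bsub>S\<^esub>"
      using v(1) by (auto simp: linear_relation_def N_simps)
    have \<psi>p: "\<psi> p = ultrapower_diagonal A I U a" "\<psi> p \<in> carrier S"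
      using \<psi>_\<iota>[OF ac] \<psi>.hom_closed[OF \<iota>.hom_closed[OF ac]] a(2) by simp_all
    have "(\<Oplus>\<^bsub>S\<^esub>i\<in>{..<r}. \<psi> (b i) \<otimes>\<^bsub>S\<^esub> (\<ominus>\<^bsub>S\<^esub> v i)) = (\<Oplus>\<^bsub>S\<^esub>i\<in>{..<r}. \<ominus>\<^bsub>S\<^esub> \<one>\<^bsub>S\<^esub> \<otimes>\<^bsub>S\<^esub> (\<psi> (b i) \<otimes>\<^bsub>S\<^esub> v i))"
      using \<psi>b vc by (intro S.finsum_cong') (auto simp: S.r_minus S.l_minus)
    also have "\<dots> = \<ominus>\<^bsub>S\<^esub> \<one>\<^bsub>S\<^esub> \<otimes>\<^bsub>S\<^esub> (\<Oplus>\<^bsub>S\<^esub>i\<in>{..<r}. \<psi> (b i) \<otimes>\<^bsub>S\<^esub> v i)"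
      using \<psi>b vc by (intro S.finsum_rdistr[symmetric]) auto
    finally have "(\<Oplus>\<^bsub>S\<^esub>i\<in>{..<r}. cls (\<beta> i) \<otimes>\<^bsub>S\<^esub> (\<ominus>\<^bsub>S\<^esub> v i)) = \<zero>\<^bsub>S\<^esub>"
      using to_\<beta>[of "\<lambda>i. \<ominus>\<^bsub>S\<^esub> v i"] vc vrel by simp
    moreover have "y i = \<psi> p \<otimes>\<^bsub>S\<^esub> (\<ominus>\<^bsub>S\<^esub> v i) \<oplus>\<^bsub>S\<^esub> (\<Oplus>\<^bsub>S\<^esub>j\<in>{..<t}. cls (\<sigma> j i) \<otimes>\<^bsub>S\<^esub> z j)" if i: "i < r" for i
    proof -
      have "(\<Oplus>\<^bsub>S\<^esub>j\<in>{..<t}. cls (\<sigma> j i) \<otimes>\<^bsub>S\<^esub> z j) = y i \<oplus>\<^bsub>S\<^esub> \<psi> p \<otimes>\<^bsub>S\<^esub> v i"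
        using to_\<sigma>[OF i, of z] z i by simp
      then show ?thesis
        using y[OF i] vc[OF i] \<psi>p(2) by (simp add: S.r_minus S.a_lcomm S.l_neg)
    qed
    ultimately show "\<exists>v z. (\<forall>i<r. v i \<in> carrier S) \<and> (\<Oplus>\<^bsub>S\<^esub>i\<in>{..<r}. cls (\<beta> i) \<otimes>\<^bsub>S\<^esub> v i) = \<zero>\<^bsub>S\<^esub> \<and>
        (\<forall>j<t. z j \<in> carrier S) \<and>
        (\<forall>i<r. y i = ultrapower_diagonal A I U a \<otimes>\<^bsub>S\<^esub> v i \<oplus>\<^bsub>S\<^esub> (\<Oplus>\<^bsub>S\<^esub>j\<in>{..<t}. cls (\<sigma> j i) \<otimes>\<^bsub>S\<^esub> z j))"
      using vc z(1) unfolding \<psi>p(1) by (intro exI[of _ "\<lambda>i. \<ominus>\<^bsub>S\<^esub> v i"] exI[of _ z]) simp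
  next
    fix z assume z: "\<And>j. j < t \<Longrightarrow> z j \<in> carrier S"
      and yz: "\<And>i. i < r \<Longrightarrow> y i = (\<Oplus>\<^bsub>S\<^esub>j\<in>{..<t}. cls (\<sigma> j i) \<otimes>\<^bsub>S\<^esub> z j)"
    show ?thesis
      by (rule N.trivial_relation_sum[of t r b s z])
        (use s z yz to_\<sigma>[of _ z] in \<open>auto simp: N_simps\<close>)
  qed
qed

lemma equationally_flat_ultrapower: "equationally_flat B N"
proof -
  obtain r g where g: "generates A r g m" "generates B r (\<lambda>i. \<iota> (g i)) n"
    by (rule maximal_ideal_generators)
  have \<iota>m: "\<iota> ` m \<subseteq> carrier B" using m.Icarr by auto
  have "relations_trivial B N k b" if b: "\<forall>i<k. b i \<in> carrier B" for k b
  proof (rule N.relations_trivial_from_closed_point[OF B_noetherian n.maximalideal_axioms n_eq \<iota>m g(2)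
        closed_point_relations_trivial[OF g(1)]])
    fix k' b' p
    assume "\<And>i. i < k' \<Longrightarrow> b' i \<in> carrier B" "p \<in> \<iota> ` m"
      "\<And>y. linear_relation B N k' b' y \<Longrightarrow> \<exists>v. linear_relation B N k' b' v \<and>
        trivial_relation B N k' b' (\<lambda>i. y i \<oplus>\<^bsub>N\<^esub> p \<odot>\<^bsub>N\<^esub> v i)"
    then show "relations_trivial B N k' b'" by (rule nakayama_relations_trivial)
  qed (use b in auto)
  then show ?thesis by (simp add: equationally_flat_def)
qed

text \<open>
  Otherwise all coefficients lie in \<open>n\<close>, their images are represented by functions with values in
  \<open>m\<close>, and \<open>1\<close> would lie in \<open>m\<close> at almost every index.
\<close>

lemma one_has_unit_coefficient:
  assumes a: "\<And>j. j < (t::nat) \<Longrightarrow> a j \<in> carrier B" and w: "\<And>j. j < t \<Longrightarrow> w j \<in> carrier N"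
    and one: "\<one>\<^bsub>S\<^esub> = (\<Oplus>\<^bsub>N\<^esub>j\<in>{..<t}. a j \<odot>\<^bsub>N\<^esub> w j)"
  shows "\<exists>j<t. a j \<in> Units B"
proof (rule ccontr)
  assume "\<not> ?thesis"
  then have an: "a j \<in> n" if "j < t" for j
    using local_ring_unit[OF B_noetherian B_local a[OF that]] that by blast
  obtain r g where g: "generates A r g m" "generates B r (\<lambda>i. \<iota> (g i)) n"
    by (rule maximal_ideal_generators)
  have gm: "g i \<in> m" and gc: "g i \<in> carrier A" if "i < r" for i
    using g that m.Icarr unfolding generates_def by blast+
  have "\<exists>f. f \<in> carrier P \<and> \<psi> (a j) = cls f \<and> almost (\<lambda>x. f x \<in> m)" if j: "j < t" for j
  proof -
    obtain c where c: "\<forall>i<r. c i \<in> carrier B" "a j = (\<Oplus>\<^bsub>B\<^esub>i\<in>{..<r}. \<iota> (g i) \<otimes>\<^bsub>B\<^esub> c i)"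
      using g(2) an[OF j] unfolding generates_def by blast
    have \<psi>c: "\<psi> (c i) \<in> carrier S" if "i < r" for i using c that by simp
    obtain \<gamma> where \<gamma>: "\<And>i. i < r \<Longrightarrow> \<gamma> i \<in> carrier P" "\<And>i. i < r \<Longrightarrow> \<psi> (c i) = cls (\<gamma> i)"
      using representatives[of r "\<lambda>i. \<psi> (c i)"] \<psi>c by blast
    obtain f where f: "f \<in> carrier P" "\<psi> (a j) = cls f"
      using cls_surj[OF \<psi>.hom_closed[OF a[OF j]]] .
    have "\<psi> (a j) = (\<Oplus>\<^bsub>S\<^esub>i\<in>{..<r}. \<psi> (\<iota> (g i)) \<otimes>\<^bsub>S\<^esub> \<psi> (c i))"
      unfolding c(2) using gc c by (intro \<psi>_lincomb) auto
    also have "\<dots> = (\<Oplus>\<^bsub>S\<^esub>i\<in>{..<r}. cls (const (g i)) \<otimes>\<^bsub>S\<^esub> cls (\<gamma> i))"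
      using gc \<gamma> by (intro S.finsum_cong') (auto simp: \<psi>_\<iota>_cls const_closed)
    finally have "almost (\<lambda>x. f x = (\<Oplus>i\<in>{..<r}. const (g i) x \<otimes> \<gamma> i x))"
      using lincomb_eq_iff[of "{..<r}" "\<lambda>i. const (g i)" \<gamma> f] f \<gamma> gc by (simp add: const_closed)
    then have "almost (\<lambda>x. f x \<in> m)"
    proof (rule almost_mono)
      fix x assume x: "x \<in> I" and "f x = (\<Oplus>i\<in>{..<r}. const (g i) x \<otimes> \<gamma> i x)"
      moreover have "(\<Oplus>i\<in>{..<r}. const (g i) x \<otimes> \<gamma> i x) \<in> m"
        by (rule m.linear_combination_in_ideal[OF A_cring])
          (use gm \<gamma> x in \<open>auto simp: const_eval power_val\<close>)
      ultimately show "f x \<in> m" by simp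
    qed
    then show ?thesis using f by blast
  qed
  then obtain f where f: "\<And>j. j < t \<Longrightarrow> f j \<in> carrier P" "\<And>j. j < t \<Longrightarrow> \<psi> (a j) = cls (f j)"
    "\<And>j. j < t \<Longrightarrow> almost (\<lambda>x. f j x \<in> m)" by metis
  obtain h where h: "\<And>j. j < t \<Longrightarrow> h j \<in> carrier P" "\<And>j. j < t \<Longrightarrow> w j = cls (h j)"
    using representatives[of t w] w by (auto simp: N_simps)
  have "cls \<one>\<^bsub>P\<^esub> = (\<Oplus>\<^bsub>S\<^esub>j\<in>{..<t}. \<psi> (a j) \<otimes>\<^bsub>S\<^esub> w j)"
    using one by (simp add: N_simps)
  also have "\<dots> = (\<Oplus>\<^bsub>S\<^esub>j\<in>{..<t}. cls (f j) \<otimes>\<^bsub>S\<^esub> cls (h j))"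
    using f h by (intro S.finsum_cong') auto
  finally have "almost (\<lambda>x. \<one>\<^bsub>P\<^esub> x = (\<Oplus>j\<in>{..<t}. f j x \<otimes> h j x))"
    by (subst (asm) lincomb_eq_iff) (use f h in auto)
  then have "almost (\<lambda>x. \<one>\<^bsub>P\<^esub> x = (\<Oplus>j\<in>{..<t}. f j x \<otimes> h j x) \<and> (\<forall>j<t. f j x \<in> m))"
    using f(3) by (intro almost_conj almost_all_less)
  then have "almost (\<lambda>_. False)"
  proof (rule almost_mono)
    fix x assume x: "x \<in> I" and *: "\<one>\<^bsub>P\<^esub> x = (\<Oplus>j\<in>{..<t}. f j x \<otimes> h j x) \<and> (\<forall>j<t. f j x \<in> m)"
    have "(\<Oplus>j\<in>{..<t}. f j x \<otimes> h j x) \<in> m"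
      by (rule m.linear_combination_in_ideal[OF A_cring]) (use * h x in \<open>auto simp: power_val\<close>)
    then have "\<one> \<in> m" using * x by (simp add: power_eval)
    then show False using m.one_imp_carrier m.I_notcarr by auto
  qed
  then show False using almost_not_False by contradiction
qed

end

theorem theorem3p2:
  fixes A :: "'a ring" and m :: "'a set"
    and B :: "'b ring" and n :: "'b set"
    and \<iota> :: "'a \<Rightarrow> 'b"
    and I :: "'x set" and U :: "'x set set"
    and \<psi> :: "'b \<Rightarrow> ('x \<Rightarrow> 'a) set"
  assumes "noetherian_ring A" and "local_ring A m"
    and "noetherian_ring B" and "local_ring B n"
    and "flat_ring_map TYPE((nat \<Rightarrow> 'a) set) A B \<iota>"
    and "n = Idl\<^bsub>B\<^esub> (\<iota> ` m)"
    and "ultrafilter_on I U"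
    and "\<psi> \<in> ring_hom B (ultrapower A I U)"
    and "\<forall>a\<in>carrier A. \<psi> (\<iota> a) = ultrapower_diagonal A I U a"
  shows "faithfully_flat_ring_map TYPE('m) B (ultrapower A I U) \<psi>"
proof -
  have "cring A" using assms(2) unfolding local_ring_def by (rule conjunct1)
  moreover have "\<iota> \<in> ring_hom A B" using assms(5) unfolding flat_ring_map_def by (rule conjunct1)
  ultimately interpret ultrapower_algebra A I U m B n \<iota> \<psi>
    by (intro ultrapower_algebra.intro ring_ultrapower.intro ultrapower_algebra_axioms.intro assms
        bspec[OF assms(9)])
  have "faithfully_flat_module TYPE('m) B N"
  proof (rule equationally_flat_imp_faithfully_flat[OF N.module_axioms equationally_flat_ultrapower])
    show "\<one>\<^bsub>S\<^esub> \<in> carrier N" by (simp add: N_simps)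
  qed (rule one_has_unit_coefficient)
  then show ?thesis
    using assms(8) by (simp add: faithfully_flat_ring_map_def)
qed

end
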